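(* Let $D \subset \mathbb{C}^{n}$ be a domain and let $u \in \mathrm{Psh}(D) \cap C^{0}(D)$ be a non-negative maximal plurisubharmonic function, that is, $u \geq 0$ and $(dd^{c}u)^{n} = 0$ in $D$. Assume that $u^{-1}(0) \subset D$ is non-empty and convex. Then any point of $u^{-1}(0)$ lies in the relative interior of a complex one-dimensional convex set contained in $u^{-1}(0)$.
   Context: $\mathrm{Psh}(D)$ denotes the set of plurisubharmonic functions in $D$, and $C^{0}(D)$ the continuous real-valued functions on $D$. For $u \in \mathrm{Psh}(D)\cap C^0(D)$, $(dd^{c}u)^{n}$ is the Monge-Ampère current in the sense of Bedford and Taylor ($dd^c$ is a positive constant multiple of $\sqrt{-1}\,\partial\bar\partial$). A complex one-dimensional convex set is a convex set in $\mathbb{C}^{n}$ whose (real) affine hull is a complex one-dimensional affine subspace of $\mathbb{C}^{n}$; its relative interior is its interior relative to its affine hull. *)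

theory Defs
  imports "HOL-Analysis.Analysis"
begin

text \<open>Points of complex n-space are vectors of type \<open>complex ^ 'n\<close>, with n = \<open>CARD('n)\<close>.
  A real-valued function u on D is a total function of which only the values on D matter.\<close>

text \<open>This is the notion for functions that do not take the value minus infinity. For such a
  function the circle means are finite, because they are bounded below by the value at the centre;
  hence integrability is part of the sub-mean value condition. The closed discs
  \<open>{a + z b : |z| \<le> 1}\<close> range over all closed discs in complex lines.\<close>

definition plurisubharmonic_on ::
    "(complex ^ 'n) set \<Rightarrow> (complex ^ 'n \<Rightarrow> real) \<Rightarrow> bool" where
  "plurisubharmonic_on D u \<longleftrightarrow>
     (\<forall>x\<in>D. \<forall>c>u x. eventually (\<lambda>y. u y < c) (at x within D)) \<and>
     (\<forall>a b. (\<forall>z::complex. norm z \<le> 1 \<longrightarrow> a + z *s b \<in> D) \<longrightarrow>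
        (\<lambda>t::real. u (a + cis t *s b)) absolutely_integrable_on {0..2 * pi} \<and>
        u a \<le> integral {0..2 * pi} (\<lambda>t. u (a + cis t *s b)) / (2 * pi))"

text \<open>A complex-valued m-form assigns to a point x and to a list of m (real) tangent vectors a
  complex number. It is real multilinear and alternating in the vectors, and zero on lists of any
  other length.\<close>

type_synonym 'n form = "complex ^ 'n \<Rightarrow> (complex ^ 'n) list \<Rightarrow> complex"

definition is_form :: "nat \<Rightarrow> 'n::finite form \<Rightarrow> bool" where
  "is_form m \<omega> \<longleftrightarrow>
     (\<forall>x vs. length vs \<noteq> m \<longrightarrow> \<omega> x vs = 0) \<and>
     (\<forall>x vs i. length vs = m \<and> i < m \<longrightarrow> linear (\<lambda>v. \<omega> x (vs[i := v]))) \<and>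
     (\<forall>x vs. \<not> distinct vs \<longrightarrow> \<omega> x vs = 0)"

definition form_support :: "'n::finite form \<Rightarrow> (complex ^ 'n) set" where
  "form_support \<omega> = closure {x. \<exists>vs. \<omega> x vs \<noteq> 0}"

fun Ck :: "nat \<Rightarrow> ('a::real_normed_vector \<Rightarrow> 'b::real_normed_vector) \<Rightarrow> bool" where
  "Ck 0 f \<longleftrightarrow> continuous_on UNIV f"
| "Ck (Suc k) f \<longleftrightarrow>
     (\<forall>x. f differentiable (at x)) \<and> (\<forall>v. Ck k (\<lambda>x. frechet_derivative f (at x) v))"

text \<open>Forms with continuous, respectively smooth, coefficients and compact support in D,
  extended by zero to the whole space.\<close>

definition continuous_test_form :: "(complex ^ 'n::finite) set \<Rightarrow> nat \<Rightarrow> 'n form \<Rightarrow> bool" where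
  "continuous_test_form D m \<omega> \<longleftrightarrow>
     is_form m \<omega> \<and> compact (form_support \<omega>) \<and> form_support \<omega> \<subseteq> D \<and>
     (\<forall>vs. continuous_on UNIV (\<lambda>x. \<omega> x vs))"

definition test_form :: "(complex ^ 'n::finite) set \<Rightarrow> nat \<Rightarrow> 'n form \<Rightarrow> bool" where
  "test_form D m \<omega> \<longleftrightarrow>
     is_form m \<omega> \<and> compact (form_support \<omega>) \<and> form_support \<omega> \<subseteq> D \<and>
     (\<forall>vs k. Ck k (\<lambda>x. \<omega> x vs))"

text \<open>The complex linear and antilinear parts of the differential of a function, applied to v:
  the sums over j of \<open>v\<^sub>j \<partial>f/\<partial>z\<^sub>j\<close>, respectively of \<open>cnj v\<^sub>j\<close> times the derivative of f
  with respect to \<open>cnj z\<^sub>j\<close>.\<close>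

definition del_fun ::
    "(complex ^ 'n::finite \<Rightarrow> complex) \<Rightarrow> complex ^ 'n \<Rightarrow> complex ^ 'n \<Rightarrow> complex" where
  "del_fun f x v =
     (frechet_derivative f (at x) v - \<i> * frechet_derivative f (at x) (\<i> *s v)) / 2"

definition delbar_fun ::
    "(complex ^ 'n::finite \<Rightarrow> complex) \<Rightarrow> complex ^ 'n \<Rightarrow> complex ^ 'n \<Rightarrow> complex" where
  "delbar_fun f x v =
     (frechet_derivative f (at x) v + \<i> * frechet_derivative f (at x) (\<i> *s v)) / 2"

text \<open>These are the usual formula for the exterior derivative of a form evaluated on constant
  vector fields, with the differential of the coefficients replaced by its complex linear,
  respectively antilinear, part. Their sum is the exterior derivative.\<close>

definition del :: "'n::finite form \<Rightarrow> 'n form" where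
  "del \<omega> x vs =
     (\<Sum>i<length vs. (- 1) ^ i * del_fun (\<lambda>y. \<omega> y (take i vs @ drop (Suc i) vs)) x (vs ! i))"

definition delbar :: "'n::finite form \<Rightarrow> 'n form" where
  "delbar \<omega> x vs =
     (\<Sum>i<length vs. (- 1) ^ i * delbar_fun (\<lambda>y. \<omega> y (take i vs @ drop (Suc i) vs)) x (vs ! i))"

text \<open>The normalisation is \<open>d\<^sup>c = \<i> (delbar - del)\<close>.\<close>

definition ddc :: "'n::finite form \<Rightarrow> 'n form" where
  "ddc \<omega> x vs = 2 * \<i> * del (delbar \<omega>) x vs"

text \<open>A current of order zero and dimension m on D: a linear functional on the m-forms with
  continuous coefficients and compact support in D which, on forms supported in a fixed compact
  subset of D, is bounded with respect to the supremum norm. Values on other arguments are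
  irrelevant.\<close>

definition order_zero_current ::
    "(complex ^ 'n::finite) set \<Rightarrow> nat \<Rightarrow> ('n form \<Rightarrow> complex) \<Rightarrow> bool" where
  "order_zero_current D m T \<longleftrightarrow>
     (\<forall>\<omega> \<eta>. continuous_test_form D m \<omega> \<and> continuous_test_form D m \<eta> \<longrightarrow>
        T (\<lambda>x vs. \<omega> x vs + \<eta> x vs) = T \<omega> + T \<eta>) \<and>
     (\<forall>\<omega> c. continuous_test_form D m \<omega> \<longrightarrow> T (\<lambda>x vs. c * \<omega> x vs) = c * T \<omega>) \<and>
     (\<forall>K. compact K \<and> K \<subseteq> D \<longrightarrow>
        (\<exists>C. \<forall>\<omega> B. continuous_test_form D m \<omega> \<and> form_support \<omega> \<subseteq> K \<and>
           (\<forall>x vs. (\<forall>v\<in>set vs. norm v \<le> 1) \<longrightarrow> norm (\<omega> x vs) \<le> B) \<longrightarrow>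
           norm (T \<omega>) \<le> C * B))"

text \<open>The real basis \<open>e\<^sub>1, \<i> e\<^sub>1, e\<^sub>2, \<i> e\<^sub>2, \<dots>\<close>, which is positively oriented.
  Permuting the indices permutes pairs of vectors, so the value of a form on this list does not
  depend on the enumeration chosen.\<close>

definition oriented_basis :: "(complex ^ 'n::finite) list" where
  "oriented_basis =
     concat (map (\<lambda>j. [axis j 1, axis j \<i>]) (SOME js. distinct js \<and> set js = UNIV))"

text \<open>The current of integration of forms of top degree \<open>2 n\<close>.\<close>

definition integration_current :: "'n::finite form \<Rightarrow> complex" where
  "integration_current \<omega> = (LINT x|lborel. \<omega> x oriented_basis)"

text \<open>\<open>bedford_taylor D u k T\<close> says that T is the current \<open>(dd\<^sup>c u)\<^sup>k\<close> on D, for u continuous: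
  it is 1, i.e. the current of integration, for k = 0, and the inductive step is
  \<open>dd\<^sup>c u \<and> T = dd\<^sup>c (u T)\<close>. This is defined as a distribution by duality, and it is
  (for plurisubharmonic u) again a current of order zero, i.e. it extends,
  uniquely by density, to forms with continuous coefficients; this makes the product
  with u in the next step meaningful. There are no signs in the duality, since T has even degree.
  A current of degree \<open>2 k\<close> has dimension \<open>2 (n - k)\<close>; its vanishing on the
  components of bidegree other than \<open>(n - k, n - k)\<close> is automatic.\<close>

inductive bedford_taylor ::
    "(complex ^ 'n::finite) set \<Rightarrow> (complex ^ 'n \<Rightarrow> real) \<Rightarrow> nat \<Rightarrow> ('n form \<Rightarrow> complex) \<Rightarrow> bool"
  for D u where
  zero: "bedford_taylor D u 0 integration_current"
| Suc: "bedford_taylor D u (Suc k) S"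
    if "bedford_taylor D u k T"
      and "Suc k \<le> CARD('n)"
      and "order_zero_current D (2 * (CARD('n) - Suc k)) S"
      and "\<And>\<phi>. test_form D (2 * (CARD('n) - Suc k)) \<phi> \<Longrightarrow>
             S \<phi> = T (\<lambda>x vs. complex_of_real (u x) * ddc \<phi> x vs)"

text \<open>For continuous plurisubharmonic u a current T as below exists (Bedford-Taylor) and is
  determined on continuous test functions, which are the test forms of degree 0; so the
  existential quantifier only names \<open>(dd\<^sup>c u)\<^sup>n\<close>.\<close>

definition monge_ampere_zero ::
    "(complex ^ 'n::finite) set \<Rightarrow> (complex ^ 'n \<Rightarrow> real) \<Rightarrow> bool" where
  "monge_ampere_zero D u \<longleftrightarrow>
     (\<exists>T. bedford_taylor D u CARD('n) T \<and> (\<forall>\<phi>. test_form D 0 \<phi> \<longrightarrow> T \<phi> = 0))"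

definition complex_one_dim_convex :: "(complex ^ 'n::finite) set \<Rightarrow> bool" where
  "complex_one_dim_convex C \<longleftrightarrow>
     convex C \<and> (\<exists>a b. b \<noteq> 0 \<and> affine hull C = {a + z *s b |z::complex. True})"

end

theory Submission
  imports Defs
begin

text \<open>If no complex disc through p lies in the convex set \<open>Z = u\<^sup>-\<^sup>1(0)\<close>, then the directions of the
  face of p in Z form a totally real subspace, so some quadratic form is negative on it and strictly
  plurisubharmonic. Separating the graph of this form over \<open>Z \<inter> \<partial>B\<close>, for a ball B around p, from a
  vertical ray gives a strictly plurisubharmonic quadratic polynomial v with \<open>v < u\<close> on \<open>\<partial>B\<close> and
  \<open>v p > 0 = u p\<close>, which a maximal u does not admit.

  To contradict \<open>(dd\<^sup>c u)\<^sup>n = 0\<close> one tests it against a cutoff \<open>\<phi>\<close> whose \<open>dd\<^sup>c\<close> is supported where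
  \<open>w = max u v\<close> equals u. There u is a uniform limit of mollifications of w, and replacing u by such
  mollifications \<open>h\<^sub>1, \<dots>, h\<^sub>n\<close>, one factor at a time, costs arbitrarily little, since every current
  \<open>(dd\<^sup>c u)\<^sup>k\<close> has order zero. So the integral of \<open>h\<^sub>n dd\<^sup>c h\<^sub>n\<^sub>-\<^sub>1 \<and> \<dots> \<and> dd\<^sup>c h\<^sub>1 \<and> dd\<^sup>c \<phi>\<close>, which by Stokes
  equals that of \<open>\<phi> dd\<^sup>c h\<^sub>n \<and> \<dots> \<and> dd\<^sup>c h\<^sub>1\<close>, can be made arbitrarily small. But the latter integrand is
  nonnegative, and bounded below near p, where \<open>w = v\<close>.\<close>

section \<open>Alternation of functions of lists\<close>

text \<open>The inductive definition of the current offers no wedge product; it only pairs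
  \<open>u\<close> times \<open>ddc\<close> of a test form with the previous current. Forms are
  therefore represented by multilinear coefficients that need not alternate: \<open>alt\<close>
  antisymmetrises them without factorials, so that products on consecutive arguments become wedge
  products. The same recursion dictates the approximation: once \<open>u\<close> has been multiplied
  with \<open>dd\<^sup>c \<phi>\<close>, all later forms vanish where
  \<open>dd\<^sup>c \<phi>\<close> does, so approximants must be close to \<open>u\<close> only on a
  shell and may follow the maximum inside. Total reality enters through one fact: if N has the face
  directions as kernel, then \<open>|N x|\<^sup>2 + |N (\<i> x)|\<^sup>2\<close> is definite, so
  adding a large multiple of \<open>|N x|\<^sup>2\<close> to minus the squared norm makes it
  strictly plurisubharmonic and leaves it unchanged on the face directions. Positivity is linear
  algebra: on the oriented basis the product of n Levi forms, each with its factor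
  \<open>2 * \<i>\<close>, is a positive multiple of their mixed discriminant, and splitting the
  forms into rank-one pieces reduces this to squared moduli of determinants.\<close>

fun alt :: "nat \<Rightarrow> ('a list \<Rightarrow> complex) \<Rightarrow> 'a list \<Rightarrow> complex" where
  "alt 0 c vs = c []"
| "alt (Suc m) c vs =
     (\<Sum>i<length vs. (- 1) ^ i * alt m (\<lambda>ws. c (vs ! i # ws)) (take i vs @ drop (Suc i) vs))"

lemma sum_lessThan_split:
  "(\<Sum>i<a + b. f i) = (\<Sum>i<a. f i) + (\<Sum>i<b. f (a + i))"
  for f :: "nat \<Rightarrow> 'b::comm_monoid_add"
  by (induction b) (auto simp: add.assoc)

lemma alt_append:
  "alt (Suc m) c (xs @ ys) =
     (\<Sum>i<length xs. (- 1) ^ i * alt m (\<lambda>ws. c (xs ! i # ws)) (take i xs @ drop (Suc i) xs @ ys)) +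
     (- 1) ^ length xs *
     (\<Sum>i<length ys. (- 1) ^ i * alt m (\<lambda>ws. c (ys ! i # ws)) (xs @ take i ys @ drop (Suc i) ys))"
  by (simp add: sum_lessThan_split nth_append power_add sum_distrib_left mult.assoc)

text \<open>The entries behind \<open>x\<close> sit one place further than in
  \<open>xs @ ys\<close>, which accounts for the minus sign in front of their sum.\<close>

lemma alt_append_Cons:
  "alt (Suc m) c (xs @ x # ys) =
     (\<Sum>i<length xs. (- 1) ^ i *
        alt m (\<lambda>ws. c (xs ! i # ws)) ((take i xs @ drop (Suc i) xs) @ x # ys)) +
     (- 1) ^ length xs * (alt m (\<lambda>ws. c (x # ws)) (xs @ ys) -
     (\<Sum>i<length ys. (- 1) ^ i *
        alt m (\<lambda>ws. c (ys ! i # ws)) (xs @ x # take i ys @ drop (Suc i) ys)))"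
proof -
  define g where "g = (\<lambda>i. (- 1) ^ i *
      alt m (\<lambda>ws. c ((x # ys) ! i # ws)) (xs @ take i (x # ys) @ drop (Suc i) (x # ys)))"
  have "(\<Sum>i<length (x # ys). g i) = g 0 + (\<Sum>i<length ys. g (Suc i))"
    unfolding list.size by (simp only: add_Suc_right add_0_right sum.lessThan_Suc_shift)
  also have "(\<Sum>i<length ys. g (Suc i)) = - (\<Sum>i<length ys. (- 1) ^ i *
        alt m (\<lambda>ws. c (ys ! i # ws)) (xs @ x # take i ys @ drop (Suc i) ys))"
    unfolding sum_negf[symmetric] by (simp add: g_def)
  finally show ?thesis
    unfolding alt_append g_def[symmetric] by (simp add: g_def)
qed

lemma alt_cong:
  assumes "\<And>ws. length ws = m \<Longrightarrow> c ws = c' ws"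
  shows "alt m c vs = alt m c' vs"
  using assms
proof (induction m arbitrary: c c' vs)
  case (Suc m)
  have "alt m (\<lambda>ws. c (v # ws)) us = alt m (\<lambda>ws. c' (v # ws)) us" for v us
    by (rule Suc.IH) (simp add: Suc.prems)
  then show ?case by simp
qed simp

lemma alt_add: "alt m (\<lambda>ws. f ws + g ws) vs = alt m f vs + alt m g vs"
  by (induction m arbitrary: f g vs) (auto simp: algebra_simps sum.distrib)

lemma alt_cmult: "alt m (\<lambda>ws. k * f ws) vs = k * alt m f vs"
  by (induction m arbitrary: f vs) (auto simp: sum_distrib_left algebra_simps)

lemma alt_zero: "alt m (\<lambda>ws. 0) vs = 0"
  using alt_cmult[of m 0 "\<lambda>_. 0" vs] by simp

lemma alt_map: "alt m c (map f vs) = alt m (\<lambda>ws. c (map f ws)) vs"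
proof (induction m arbitrary: c vs)
  case (Suc m)
  have "alt m c' (take i (map f vs) @ drop (Suc i) (map f vs)) =
      alt m (\<lambda>ws. c' (map f ws)) (take i vs @ drop (Suc i) vs)" for c' i
    using Suc[of c' "take i vs @ drop (Suc i) vs"] by (simp add: take_map drop_map)
  then show ?case by simp
qed simp

declare alt.simps(2) [simp del]

lemma drop_nth_commute:
  assumes "j < i" "i < length vs"
  shows "take j (take i vs @ drop (Suc i) vs) @ drop (Suc j) (take i vs @ drop (Suc i) vs) =
    take (i - 1) (take j vs @ drop (Suc j) vs) @ drop (Suc (i - 1)) (take j vs @ drop (Suc j) vs)"
proof (cases "i = Suc j")
  case True
  then show ?thesis using assms by (intro nth_equalityI) (auto simp: nth_append)
next
  case False
  then show ?thesis using assms by (intro nth_equalityI) (auto simp: nth_append)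
qed

text \<open>The involution of the index set of the double Laplace expansion exchanges the two ways of
  removing a pair of entries from \<open>vs\<close>.\<close>

lemma alt_swap:
  assumes "\<And>a b ws. length ws = m \<Longrightarrow> c' (a # b # ws) = - c (b # a # ws)"
  shows "alt (Suc (Suc m)) c' vs = alt (Suc (Suc m)) c vs"
proof -
  define n where "n = length vs"
  define rm where "rm = (\<lambda>i (ws::'a list). take i ws @ drop (Suc i) ws)"
  define F where "F = (\<lambda>d (i, j). (- 1) ^ i * ((- 1) ^ j *
      alt m (\<lambda>ws. d (vs ! i # rm i vs ! j # ws)) (rm j (rm i vs))))"
  have *: "alt (Suc (Suc m)) d vs = (\<Sum>p\<in>{..<n} \<times> {..<n - 1}. F d p)" for d
  proof -
    have "length (rm i vs) = n - 1" if "i < n" for i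
      using that by (auto simp: rm_def n_def)
    then have "alt (Suc (Suc m)) d vs = (\<Sum>i<n. \<Sum>j<n - 1. F d (i, j))"
      by (auto simp: alt.simps(2) F_def n_def rm_def sum_distrib_left intro!: sum.cong)
    then show ?thesis
      by (simp add: sum.cartesian_product)
  qed
  define \<tau> where "\<tau> = (\<lambda>(i, j). if j < i then (j, i - 1) else (j + 1, i :: nat))"
  have F: "F c' p = F c (\<tau> p)" if p: "p \<in> {..<n} \<times> {..<n - 1}" for p
  proof -
    obtain i j where ij: "p = (i, j)" "i < n" "j < n - 1" using p by auto
    have c': "alt m (\<lambda>ws. c' (a # b # ws)) us = - alt m (\<lambda>ws. c (b # a # ws)) us" for a b us
      using alt_cmult[of m "-1" "\<lambda>ws. c (b # a # ws)" us] assms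
      by (subst alt_cong[of m _ "\<lambda>ws. - 1 * c (b # a # ws)"]) auto
    show ?thesis
    proof (cases "j < i")
      case True
      have 1: "rm i vs ! j = vs ! j" "rm j vs ! (i - 1) = vs ! i"
        using True ij by (auto simp: rm_def nth_append n_def)
      have 2: "rm j (rm i vs) = rm (i - 1) (rm j vs)"
        using drop_nth_commute[of j i vs] True ij by (simp add: rm_def n_def)
      have 3: "(- 1 :: complex) ^ i = - ((- 1) ^ (i - 1))"
        using True by (cases i) auto
      show ?thesis using True by (simp add: ij F_def \<tau>_def c' 1 2 3 del: One_nat_def)
    next
      case False
      have 1: "rm i vs ! j = vs ! Suc j" "rm (Suc j) vs ! i = vs ! i"
        using False ij by (auto simp: rm_def nth_append n_def)
      have 2: "rm j (rm i vs) = rm i (rm (Suc j) vs)"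
        using drop_nth_commute[of i "Suc j" vs] False ij by (simp add: rm_def n_def)
      show ?thesis using False by (simp add: ij F_def \<tau>_def c' 1 2)
    qed
  qed
  have "(\<Sum>p\<in>{..<n} \<times> {..<n - 1}. F c' p) = (\<Sum>p\<in>{..<n} \<times> {..<n - 1}. F c p)"
    by (rule sum.reindex_bij_witness[where i=\<tau> and j=\<tau>])
      (auto simp: \<tau>_def F split: if_splits)
  then show ?thesis by (simp add: *)
qed

text \<open>Replacing \<open>c\<close> by \<open>- c\<close> undoes the sign of a transposition, so
  the alternation equals its own negative. This is how repeated derivatives of the same type
  cancel.\<close>

lemma alt_sym_eq_0:
  assumes "\<And>a b ws. length ws = m \<Longrightarrow> c (a # b # ws) = c (b # a # ws)"
  shows "alt (Suc (Suc m)) c vs = 0"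
proof -
  have "alt (Suc (Suc m)) (\<lambda>ws. - 1 * c ws) vs = alt (Suc (Suc m)) c vs"
    by (rule alt_swap) (use assms in auto)
  then show ?thesis using alt_cmult[of "Suc (Suc m)" "-1" c vs] by simp
qed

lemma alt_Suc_cong:
  assumes "\<And>v us. alt m (\<lambda>ws. c (v # ws)) us = alt m (\<lambda>ws. c' (v # ws)) us"
  shows "alt (Suc m) c vs = alt (Suc m) c' vs"
  using assms by (simp add: alt.simps(2))

text \<open>Factors of degree two commute: exchanging two adjacent blocks is a product of the four
  adjacent transpositions at positions 1-2, 0-1, 2-3 and 1-2 (counting from 0), an even
  permutation.\<close>

lemma alt_swap_blocks:
  assumes "\<And>a b a' b' ws. length ws = m \<Longrightarrow> c' (a # b # a' # b' # ws) = c (a' # b' # a # b # ws)"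
  shows "alt (Suc (Suc (Suc (Suc m)))) c' vs = alt (Suc (Suc (Suc (Suc m)))) c vs"
proof -
  define d1 where "d1 = (\<lambda>ws. - c' (ws!0 # ws!2 # ws!1 # drop 3 ws))"
  have d1: "d1 (a # b # d # ws) = - c' (a # d # b # ws)" for a b d ws
    by (simp add: d1_def numeral_2_eq_2 numeral_3_eq_3)
  have s1: "alt (Suc (Suc (Suc (Suc m)))) c' vs = alt (Suc (Suc (Suc (Suc m)))) d1 vs"
    by (rule alt_Suc_cong, rule alt_swap) (simp add: d1)
  define d2 where "d2 = (\<lambda>ws. - d1 (ws!1 # ws!0 # drop 2 ws))"
  have d2: "d2 (a # b # ws) = - d1 (b # a # ws)" for a b ws
    by (simp add: d2_def)
  have s2: "alt (Suc (Suc (Suc (Suc m)))) d1 vs = alt (Suc (Suc (Suc (Suc m)))) d2 vs"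
    by (rule alt_swap) (simp add: d2)
  define d3 where "d3 = (\<lambda>ws. - d2 (ws!0 # ws!1 # ws!3 # ws!2 # drop 4 ws))"
  have d3: "d3 (a # b # d # e # ws) = - d2 (a # b # e # d # ws)" for a b d e ws
    by (simp add: d3_def eval_nat_numeral)
  have s3: "alt (Suc (Suc (Suc (Suc m)))) d2 vs = alt (Suc (Suc (Suc (Suc m)))) d3 vs"
    by (rule alt_Suc_cong, rule alt_Suc_cong, rule alt_swap) (simp add: d3)
  have s4: "alt (Suc (Suc (Suc (Suc m)))) d3 vs = alt (Suc (Suc (Suc (Suc m)))) c vs"
  proof (rule alt_Suc_cong, rule alt_swap)
    fix v a b and ws :: "'a list" assume "length ws = Suc m"
    then obtain z zs where "ws = z # zs" "length zs = m" by (cases ws) auto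
    then show "d3 (v # a # b # ws) = - c (v # b # a # ws)" by (simp add: d3 d2 d1 assms)
  qed
  show ?thesis using s1 s2 s3 s4 by simp
qed

text \<open>Two complex coefficients let one statement cover additivity, real homogeneity and the
  splitting of a real tangent vector into its holomorphic and antiholomorphic parts.\<close>

lemma alt_slot:
  assumes "\<And>xs ys. length xs + length ys + 1 = m \<Longrightarrow>
    c (xs @ v # ys) = \<alpha> * c (xs @ u # ys) + \<beta> * c (xs @ u' # ys)"
    and "length xs + length ys + 1 = m"
  shows "alt m c (xs @ v # ys) = \<alpha> * alt m c (xs @ u # ys) + \<beta> * alt m c (xs @ u' # ys)"
  using assms
proof (induction m arbitrary: c xs ys)
  case (Suc m)
  have 1: "alt m (\<lambda>ws. c (a # ws)) (xs' @ v # ys') =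
      \<alpha> * alt m (\<lambda>ws. c (a # ws)) (xs' @ u # ys') + \<beta> * alt m (\<lambda>ws. c (a # ws)) (xs' @ u' # ys')"
    if "length xs' + length ys' + 1 = m" for a xs' ys'
  proof (rule Suc.IH)
    show "c (a # xs @ v # ys) = \<alpha> * c (a # xs @ u # ys) + \<beta> * c (a # xs @ u' # ys)"
      if "length xs + length ys + 1 = m" for xs ys
      using Suc.prems(1)[of "a # xs" ys] that by simp
  qed (use that in simp)
  have 2: "alt m (\<lambda>ws. c (v # ws)) us =
      \<alpha> * alt m (\<lambda>ws. c (u # ws)) us + \<beta> * alt m (\<lambda>ws. c (u' # ws)) us" for us
    using Suc.prems(1)[of "[]"]
    by (subst alt_cong[of m _ "\<lambda>ws. \<alpha> * c (u # ws) + \<beta> * c (u' # ws)"]) (auto simp: alt_add alt_cmult)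
  have 3: "(\<Sum>i<length xs. (- 1) ^ i * alt m (\<lambda>ws. c (xs ! i # ws)) ((take i xs @ drop (Suc i) xs) @ v # ys)) =
     \<alpha> * (\<Sum>i<length xs. (- 1) ^ i * alt m (\<lambda>ws. c (xs ! i # ws)) ((take i xs @ drop (Suc i) xs) @ u # ys)) +
     \<beta> * (\<Sum>i<length xs. (- 1) ^ i * alt m (\<lambda>ws. c (xs ! i # ws)) ((take i xs @ drop (Suc i) xs) @ u' # ys))"
    unfolding sum_distrib_left sum.distrib[symmetric]
    by (rule sum.cong[OF refl], subst 1) (use Suc.prems(2) in \<open>auto simp: algebra_simps\<close>)
  have 4: "(\<Sum>i<length ys. (- 1) ^ i * alt m (\<lambda>ws. c (ys ! i # ws)) (xs @ v # take i ys @ drop (Suc i) ys)) =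
     \<alpha> * (\<Sum>i<length ys. (- 1) ^ i * alt m (\<lambda>ws. c (ys ! i # ws)) (xs @ u # take i ys @ drop (Suc i) ys)) +
     \<beta> * (\<Sum>i<length ys. (- 1) ^ i * alt m (\<lambda>ws. c (ys ! i # ws)) (xs @ u' # take i ys @ drop (Suc i) ys))"
    unfolding sum_distrib_left sum.distrib[symmetric]
    by (rule sum.cong[OF refl], subst 1) (use Suc.prems(2) in \<open>auto simp: algebra_simps\<close>)
  show ?case unfolding alt_append_Cons 2 3 4 by (simp add: algebra_simps)
qed simp

text \<open>In the expansion the two terms that start with \<open>a\<close> or \<open>b\<close>
  exchange with opposite signs; all others are covered by induction. The length hypothesis excludes
  the base case, where \<open>alt 0\<close> ignores its list and is not antisymmetric.\<close>

lemma alt_swap_args: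
  assumes "m = length xs + length ys + 2"
  shows "alt m c (xs @ a # b # ys) = - alt m c (xs @ b # a # ys)"
  using assms
proof (induction m arbitrary: c xs ys)
  case (Suc m)
  have e: "alt (Suc m) c (xs @ x # y # ys) =
     (\<Sum>i<length xs. (- 1) ^ i * alt m (\<lambda>ws. c (xs ! i # ws)) ((take i xs @ drop (Suc i) xs) @ x # y # ys)) +
     (- 1) ^ length xs * (alt m (\<lambda>ws. c (x # ws)) (xs @ y # ys) - (alt m (\<lambda>ws. c (y # ws)) (xs @ x # ys) -
     (\<Sum>i<length ys. (- 1) ^ i * alt m (\<lambda>ws. c (ys ! i # ws)) (xs @ x # y # take i ys @ drop (Suc i) ys))))" for x y
  proof -
    define g where "g = (\<lambda>i. (- 1) ^ i *
        alt m (\<lambda>ws. c ((y # ys) ! i # ws)) (xs @ x # take i (y # ys) @ drop (Suc i) (y # ys)))"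
    have "(\<Sum>i<length (y # ys). g i) = g 0 + (\<Sum>i<length ys. g (Suc i))"
      unfolding list.size by (simp only: add_Suc_right add_0_right sum.lessThan_Suc_shift)
    also have "(\<Sum>i<length ys. g (Suc i)) = - (\<Sum>i<length ys. (- 1) ^ i *
          alt m (\<lambda>ws. c (ys ! i # ws)) (xs @ x # y # take i ys @ drop (Suc i) ys))"
      unfolding sum_negf[symmetric] by (simp add: g_def)
    finally show ?thesis
      unfolding alt_append_Cons g_def[symmetric] by (simp add: g_def)
  qed
  have 3: "(\<Sum>i<length xs. (- 1) ^ i * alt m (\<lambda>ws. c (xs ! i # ws)) ((take i xs @ drop (Suc i) xs) @ a # b # ys)) =
     - (\<Sum>i<length xs. (- 1) ^ i * alt m (\<lambda>ws. c (xs ! i # ws)) ((take i xs @ drop (Suc i) xs) @ b # a # ys))"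
    unfolding sum_negf[symmetric]
    by (rule sum.cong[OF refl], subst Suc.IH) (use Suc.prems in auto)
  have 4: "(\<Sum>i<length ys. (- 1) ^ i * alt m (\<lambda>ws. c (ys ! i # ws)) (xs @ a # b # take i ys @ drop (Suc i) ys)) =
     - (\<Sum>i<length ys. (- 1) ^ i * alt m (\<lambda>ws. c (ys ! i # ws)) (xs @ b # a # take i ys @ drop (Suc i) ys))"
    unfolding sum_negf[symmetric]
    by (rule sum.cong[OF refl], subst Suc.IH) (use Suc.prems in auto)
  show ?case unfolding e 3 4 by (simp add: algebra_simps)
qed simp

lemma alt_move:
  assumes "m = length xs + length zs + length ys + 1"
  shows "alt m c (xs @ a # zs @ ys) = (- 1) ^ length zs * alt m c (xs @ zs @ a # ys)"
  using assms
proof (induction zs arbitrary: xs)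
  case (Cons z zs)
  have "alt m c (xs @ a # (z # zs) @ ys) = - alt m c ((xs @ [z]) @ a # zs @ ys)"
    using alt_swap_args[of m xs "zs @ ys" c a z] Cons.prems by simp
  also have "alt m c ((xs @ [z]) @ a # zs @ ys) = (- 1) ^ length zs * alt m c ((xs @ [z]) @ zs @ a # ys)"
    by (rule Cons.IH) (use Cons.prems in simp)
  finally show ?case by simp
qed simp

text \<open>Two equal entries are brought next to each other, where a transposition changes the sign
  and nothing else.\<close>

lemma alt_not_distinct:
  assumes "\<not> distinct vs" "length vs = m"
  shows "alt m c vs = 0"
proof -
  obtain xs ys zs v where vs: "vs = xs @ [v] @ ys @ [v] @ zs"
    using not_distinct_decomp[OF assms(1)] by blast
  have "alt m c (xs @ v # ys @ v # zs) = (- 1) ^ length ys * alt m c (xs @ ys @ v # v # zs)"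
    by (rule alt_move) (use assms vs in simp)
  moreover have "alt m c ((xs @ ys) @ v # v # zs) = - alt m c ((xs @ ys) @ v # v # zs)"
    by (rule alt_swap_args) (use assms vs in simp)
  ultimately show ?thesis by (simp add: vs)
qed

section \<open>Positivity of mixed discriminants\<close>

text \<open>Factors act on consecutive pairs of arguments; the alternation of this product is the
  wedge product of the corresponding two-forms.\<close>

fun hprod :: "('a \<Rightarrow> 'a \<Rightarrow> complex) list \<Rightarrow> 'a list \<Rightarrow> complex" where
  "hprod [] ws = 1"
| "hprod (H # Hs) ws = H (ws ! 0) (ws ! 1) * hprod Hs (drop 2 ws)"

lemma hprod_slot:
  assumes "\<And>H w. H \<in> set Hs \<Longrightarrow> H v w = \<alpha> * H u w + \<beta> * H u' w"
    and "\<And>H w. H \<in> set Hs \<Longrightarrow> H w v = \<alpha> * H w u + \<beta> * H w u'"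
    and "length xs + length ys + 1 = 2 * length Hs"
  shows "hprod Hs (xs @ v # ys) = \<alpha> * hprod Hs (xs @ u # ys) + \<beta> * hprod Hs (xs @ u' # ys)"
  using assms
proof (induction Hs arbitrary: xs)
  case (Cons H Hs)
  have h: "H v w = \<alpha> * H u w + \<beta> * H u' w" "H w v = \<alpha> * H w u + \<beta> * H w u'" for w
    using Cons.prems(1,2) by simp_all
  show ?case
  proof (cases xs)
    case Nil
    with Cons.prems(3) obtain y ys' where "ys = y # ys'" by (cases ys) auto
    then show ?thesis using Nil by (simp add: h algebra_simps)
  next
    case (Cons x xs')
    note xs = this
    show ?thesis
    proof (cases xs')
      case Nil
      then show ?thesis using xs by (simp add: h algebra_simps)
    next
      case (Cons x' xs'')
      have "hprod Hs (xs'' @ v # ys) = \<alpha> * hprod Hs (xs'' @ u # ys) + \<beta> * hprod Hs (xs'' @ u' # ys)"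
        by (rule Cons.IH) (use Cons.prems xs Cons in auto)
      then show ?thesis using xs Cons by (simp add: algebra_simps)
    qed
  qed
qed simp

text \<open>A pair \<open>(v, w)\<close> stands for v plus the conjugate of w in the complexified tangent space, where e and
  \<open>\<i> e\<close> split as \<open>(e, 0) + (0, e)\<close> and \<open>\<i> (e, 0) - \<i> (0, e)\<close>. In the basis of the \<open>(e, 0)\<close> and \<open>(0, e)\<close> the
  two kinds of factors of a product of sesquilinear forms separate.\<close>

definition complexify :: "('a \<Rightarrow> 'a \<Rightarrow> complex) \<Rightarrow> 'a \<times> 'a \<Rightarrow> 'a \<times> 'a \<Rightarrow> complex" where
  "complexify H v w = H (fst v) (snd w)"

lemma hprod_complexify:
  "length ws = 2 * length Hs \<Longrightarrow>
     hprod (map complexify Hs) (map (\<lambda>v. (v, v)) ws) = hprod Hs ws"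
proof (induction Hs arbitrary: ws)
  case (Cons H Hs)
  then obtain a b ws' where ws: "ws = a # b # ws'"
    by (metis Suc_length_conv length_Cons mult_Suc_right add_2_eq_Suc)
  show ?case using Cons by (simp add: ws complexify_def)
qed simp

definition sesquilinear :: "(complex ^ 'n \<Rightarrow> complex ^ 'n \<Rightarrow> complex) \<Rightarrow> bool" where
  "sesquilinear H \<longleftrightarrow>
     (\<forall>u v w. H (u + v) w = H u w + H v w) \<and> (\<forall>c v w. H (c *s v) w = c * H v w) \<and>
     (\<forall>u v w. H w (u + v) = H w u + H w v) \<and> (\<forall>c v w. H w (c *s v) = cnj c * H w v)"

lemma sesquilinear_0:
  assumes "sesquilinear H" shows "H 0 w = 0" "H w 0 = 0"
  using assms unfolding sesquilinear_def
  by (metis mult_zero_left vector_smult_lzero, metis complex_cnj_zero mult_zero_left vector_smult_lzero)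

text \<open>Only the two mixed terms of the expanded pair survive antisymmetry, with coefficients
  \<open>- \<i>\<close> and \<open>\<i>\<close>; reordering the second one doubles the
  first.\<close>

lemma alt_complexify_pair:
  assumes Hs: "\<And>H. H \<in> set Hs \<Longrightarrow> sesquilinear H"
    and len: "length xs + length ys + 2 = 2 * length Hs"
  shows "alt (2 * length Hs) (hprod (map complexify Hs)) (xs @ (e, e) # (\<i> *s e, \<i> *s e) # ys) =
    - 2 * \<i> * alt (2 * length Hs) (hprod (map complexify Hs)) (xs @ (e, 0) # (0, e) # ys)"
proof -
  define c where "c = hprod (map complexify Hs)"
  define m where "m = 2 * length Hs"
  have s1: "H (\<i> *s v) w = \<i> * H v w" and s2: "H v (\<i> *s w) = - \<i> * H v w"
    if "H \<in> set Hs" for H v w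
    using Hs[OF that] unfolding sesquilinear_def by auto
  have 1: "alt m c (xs' @ (e, e) # ys') =
      1 * alt m c (xs' @ (e, 0) # ys') + 1 * alt m c (xs' @ (0, e) # ys')"
    if "length xs' + length ys' + 1 = m" for xs' ys'
    unfolding c_def
    by (rule alt_slot, rule hprod_slot)
      (use that Hs in \<open>auto simp: m_def complexify_def sesquilinear_0\<close>)
  have 2: "alt m c (xs' @ (\<i> *s e, \<i> *s e) # ys') =
      \<i> * alt m c (xs' @ (e, 0) # ys') + (- \<i>) * alt m c (xs' @ (0, e) # ys')"
    if "length xs' + length ys' + 1 = m" for xs' ys'
    unfolding c_def
    by (rule alt_slot, rule hprod_slot)
      (use that in \<open>auto simp: m_def complexify_def sesquilinear_0[OF Hs] s1 s2\<close>)
  have z: "alt m c (xs @ a # a # ys) = 0" for a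
    by (rule alt_not_distinct) (use len in \<open>auto simp: m_def\<close>)
  have 3: "alt m c (xs @ (0, e) # (e, 0) # ys) = - alt m c (xs @ (e, 0) # (0, e) # ys)"
    by (rule alt_swap_args) (use len in \<open>auto simp: m_def\<close>)
  have "alt m c (xs @ (e, e) # (\<i> *s e, \<i> *s e) # ys) =
     alt m c ((xs @ [(e, 0)]) @ (\<i> *s e, \<i> *s e) # ys) + alt m c ((xs @ [(0, e)]) @ (\<i> *s e, \<i> *s e) # ys)"
    using 1[of xs "(\<i> *s e, \<i> *s e) # ys"] len by (simp add: m_def)
  also have "\<dots> = - 2 * \<i> * alt m c (xs @ (e, 0) # (0, e) # ys)"
    using len by (subst 2, simp add: m_def, subst 2, simp add: m_def) (simp add: z 3)
  finally show ?thesis by (simp add: c_def m_def)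
qed

lemma alt_complexify_basis:
  assumes "\<And>H. H \<in> set Hs \<Longrightarrow> sesquilinear H"
    and "length xs + 2 * length es = 2 * length Hs"
  shows "alt (2 * length Hs) (hprod (map complexify Hs))
      (xs @ concat (map (\<lambda>e. [(e, e), (\<i> *s e, \<i> *s e)]) es)) =
    (- 2 * \<i>) ^ length es * alt (2 * length Hs) (hprod (map complexify Hs))
      (xs @ concat (map (\<lambda>e. [(e, 0), (0, e)]) es))"
  using assms(2)
proof (induction es arbitrary: xs)
  case (Cons e es)
  have l: "length (concat (map (\<lambda>e. [(e, e), (\<i> *s e, \<i> *s e)]) es)) = 2 * length es"
    by (induction es) auto
  show ?case
    using alt_complexify_pair[OF assms(1), of Hs xs "concat (map (\<lambda>e. [(e, e), (\<i> *s e, \<i> *s e)]) es)" e]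
      Cons.IH[of "xs @ [(e, 0), (0, e)]"] Cons.prems l
    by simp
qed simp

text \<open>Sorts f, g, f, g, ... into all f followed by all g. The accumulators \<open>as\<close>
  and \<open>bs\<close> hold what is already sorted, so the next \<open>f e\<close> has to pass
  \<open>length bs\<close> entries, one more at each step.\<close>

lemma alt_separate:
  assumes "m = length as + length bs + 2 * length es"
  shows "alt m c (as @ bs @ concat (map (\<lambda>e. [f e, g e]) es)) =
    (- 1) ^ (\<Sum>k<length es. length bs + k) * alt m c (as @ map f es @ bs @ map g es)"
  using assms
proof (induction es arbitrary: as bs)
  case (Cons e es)
  have l: "length (concat (map (\<lambda>e. [f e, g e]) es)) = 2 * length es"
    by (induction es) auto
  have "alt m c (as @ f e # bs @ (g e # concat (map (\<lambda>e. [f e, g e]) es))) =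
      (- 1) ^ length bs * alt m c (as @ bs @ f e # g e # concat (map (\<lambda>e. [f e, g e]) es))"
    by (rule alt_move) (use Cons.prems l in simp)
  then have "alt m c (as @ bs @ f e # g e # concat (map (\<lambda>e. [f e, g e]) es)) =
      (- 1) ^ length bs * alt m c ((as @ [f e]) @ (bs @ [g e]) @ concat (map (\<lambda>e. [f e, g e]) es))"
    by (simp add: power_mult_distrib[symmetric] flip: power_add mult.assoc)
  also have "alt m c ((as @ [f e]) @ (bs @ [g e]) @ concat (map (\<lambda>e. [f e, g e]) es)) =
    (- 1) ^ (\<Sum>k<length es. length (bs @ [g e]) + k) * alt m c ((as @ [f e]) @ map f es @ (bs @ [g e]) @ map g es)"
    by (rule Cons.IH) (use Cons.prems in simp)
  finally show ?case
    by (simp add: sum.lessThan_Suc_shift power_add del: sum.lessThan_Suc)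
qed simp

text \<open>The double Laplace expansion of the mixed discriminant of the matrices
  \<open>H (zs ! i) (ws ! j)\<close>, without the factor 1/n!: n equal forms give n! times their
  determinant.\<close>

fun mixed_disc :: "('a \<Rightarrow> 'a \<Rightarrow> complex) list \<Rightarrow> 'a list \<Rightarrow> 'a list \<Rightarrow> complex" where
  "mixed_disc [] zs ws = 1"
| "mixed_disc (H # Hs) zs ws =
     (\<Sum>i<length zs. \<Sum>j<length ws. (- 1) ^ i * (- 1) ^ j * H (zs ! i) (ws ! j) *
        mixed_disc Hs (take i zs @ drop (Suc i) zs) (take j ws @ drop (Suc j) ws))"

text \<open>A factor \<open>complexify H\<close> sees the first component of its first argument and
  the second component of its second one, so it vanishes unless these come from \<open>zs\<close>
  and \<open>ws\<close> respectively. Choosing an entry of \<open>ws\<close> means passing the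
  entries of \<open>zs\<close> that are left, whence the sign.\<close>

lemma alt_mixed_disc:
  assumes "\<And>H. H \<in> set Hs \<Longrightarrow> sesquilinear H"
    and "length zs = length Hs" "length ws = length Hs"
  shows "alt (2 * length Hs) (hprod (map complexify Hs)) (map (\<lambda>e. (e, 0)) zs @ map (\<lambda>e. (0, e)) ws) =
    (- 1) ^ (\<Sum>k<length Hs. k) * mixed_disc Hs zs ws"
  using assms
proof (induction Hs arbitrary: zs ws)
  case (Cons H Hs)
  let ?c = "hprod (map complexify Hs)"
  let ?m = "length Hs"
  let ?z = "\<lambda>e. (e, 0)" and ?w = "\<lambda>e. (0, e)"
  have H: "sesquilinear H" using Cons.prems by simp
  have c: "hprod (map complexify (H # Hs)) (v # w # us) = H (fst v) (snd w) * ?c us" for v w us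
    by (simp add: complexify_def)
  have c1: "alt (2 * ?m) (\<lambda>us. hprod (map complexify (H # Hs)) (v # w # us)) us =
      H (fst v) (snd w) * alt (2 * ?m) ?c us" for v w us
    by (simp only: c alt_cmult)
  have c2: "alt (Suc (2 * ?m)) (\<lambda>us. hprod (map complexify (H # Hs)) ((0, w) # us)) us = 0" for w us
    by (subst alt_cong[where c'="\<lambda>_. 0"])
      (auto simp: complexify_def sesquilinear_0[OF H] alt_zero nth_Cons')
  have 1: "alt (Suc (2 * ?m)) (\<lambda>us. hprod (map complexify (H # Hs)) (?z z # us))
        (map ?z (take i zs @ drop (Suc i) zs) @ map ?w ws) =
      (\<Sum>j<length ws. (- 1) ^ ?m * (- 1) ^ j * (H z (ws ! j) *
         ((- 1) ^ (\<Sum>k<?m. k) * mixed_disc Hs (take i zs @ drop (Suc i) zs) (take j ws @ drop (Suc j) ws))))"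
    if i: "i < length zs" for z i
  proof -
    have l: "length (map ?z (take i zs @ drop (Suc i) zs)) = ?m"
      using i Cons.prems by simp
    have IH: "alt (2 * ?m) ?c (map ?z (take i zs @ drop (Suc i) zs) @ map ?w (take j ws @ drop (Suc j) ws)) =
        (- 1) ^ (\<Sum>k<?m. k) * mixed_disc Hs (take i zs @ drop (Suc i) zs) (take j ws @ drop (Suc j) ws)"
      if "j < length ws" for j
      by (rule Cons.IH) (use Cons.prems i that in auto)
    show ?thesis
      unfolding alt_append c1 sum_distrib_left
      by (subst sum.neutral, simp add: nth_append sesquilinear_0[OF H] del: map_append,
          unfold l add_0 length_map[of ?w], intro sum.cong refl)
        (use IH in \<open>simp add: take_map drop_map flip: map_append del: length_append length_take length_drop\<close>)
  qed
  have "alt (2 * length (H # Hs)) (hprod (map complexify (H # Hs))) (map ?z zs @ map ?w ws) =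
      (\<Sum>i<length zs. (- 1) ^ i * alt (Suc (2 * ?m)) (\<lambda>us. hprod (map complexify (H # Hs)) (?z (zs ! i) # us))
        (map ?z (take i zs @ drop (Suc i) zs) @ map ?w ws))"
    unfolding list.size mult_Suc_right add_Suc_right add_0_right add_2_eq_Suc
    using c2 by (subst alt_append) (simp add: take_map drop_map del: hprod.simps list.map(2))
  also have "\<dots> = (\<Sum>i<length zs. \<Sum>j<length ws. (- 1) ^ (\<Sum>k<length (H # Hs). k) *
      ((- 1) ^ i * (- 1) ^ j * H (zs ! i) (ws ! j) *
        mixed_disc Hs (take i zs @ drop (Suc i) zs) (take j ws @ drop (Suc j) ws)))"
    by (rule sum.cong[OF refl], subst 1) (auto simp: sum_distrib_left power_add mult_ac)
  finally show ?case by (simp add: sum_distrib_left del: hprod.simps list.map(2))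
qed simp

text \<open>The sorting sign and the sign in \<open>alt_mixed_disc\<close> agree and cancel, and
  each factor \<open>2 * \<i>\<close> of \<open>dd\<^sup>c\<close> meets a \<open>- 2 * \<i>\<close>
  from a pair \<open>e\<close>, \<open>\<i> *s e\<close>, giving 4. No phase remains, so positivity
  can be read off the mixed discriminant.\<close>

lemma alt_hprod_basis:
  assumes "\<And>H. H \<in> set Hs \<Longrightarrow> sesquilinear H" and "length es = length Hs"
  shows "(2 * \<i>) ^ length Hs * alt (2 * length Hs) (hprod Hs) (concat (map (\<lambda>e. [e, \<i> *s e]) es)) =
    4 ^ length Hs * mixed_disc Hs es es"
proof -
  let ?m = "2 * length Hs" and ?c = "hprod (map complexify Hs)"
  have "alt ?m (hprod Hs) (concat (map (\<lambda>e. [e, \<i> *s e]) es)) =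
      alt ?m ?c (map (\<lambda>v. (v, v)) (concat (map (\<lambda>e. [e, \<i> *s e]) es)))"
    unfolding alt_map by (rule alt_cong) (simp add: hprod_complexify)
  also have "map (\<lambda>v. (v, v)) (concat (map (\<lambda>e. [e, \<i> *s e]) es)) =
      [] @ concat (map (\<lambda>e. [(e, e), (\<i> *s e, \<i> *s e)]) es)"
    by (induction es) auto
  also have "alt ?m ?c \<dots> = (- 2 * \<i>) ^ length es * alt ?m ?c ([] @ [] @ concat (map (\<lambda>e. [(e, 0), (0, e)]) es))"
    by (subst alt_complexify_basis) (use assms in auto)
  also have "alt ?m ?c ([] @ [] @ concat (map (\<lambda>e. [(e, 0), (0, e)]) es)) =
      (- 1) ^ (\<Sum>k<length es. k) * alt ?m ?c (map (\<lambda>e. (e, 0)) es @ map (\<lambda>e. (0, e)) es)"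
    by (subst alt_separate) (use assms in auto)
  also have "alt ?m ?c (map (\<lambda>e. (e, 0)) es @ map (\<lambda>e. (0, e)) es) =
      (- 1) ^ (\<Sum>k<length Hs. k) * mixed_disc Hs es es"
    by (rule alt_mixed_disc) (use assms in auto)
  finally have "(2 * \<i>) ^ length Hs * alt ?m (hprod Hs) (concat (map (\<lambda>e. [e, \<i> *s e]) es)) =
     ((2 * \<i>) * (- 2 * \<i>)) ^ length Hs * (((- 1) * (- 1)) ^ (\<Sum>k<length Hs. k) * mixed_disc Hs es es)"
    unfolding power_mult_distrib by (simp add: assms mult_ac)
  then show ?thesis by simp
qed

section \<open>Mixed discriminants of sums of rank-one forms\<close>

definition rank_one :: "('a \<Rightarrow> complex) \<Rightarrow> 'a \<Rightarrow> 'a \<Rightarrow> complex" where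
  "rank_one a v w = a v * cnj (a w)"

fun gprod :: "('a \<Rightarrow> complex) list \<Rightarrow> 'a list \<Rightarrow> complex" where
  "gprod [] ws = 1"
| "gprod (a # as) ws = a (hd ws) * gprod as (tl ws)"

text \<open>For rank-one factors rows and columns separate, leaving a determinant times a conjugate
  determinant; for \<open>zs = ws\<close> this is a squared modulus, the source of all positivity
  here.\<close>

lemma mixed_disc_rank_one:
  "mixed_disc (map rank_one as) zs ws =
     alt (length as) (gprod as) zs * cnj (alt (length as) (gprod as) ws)"
proof (induction as arbitrary: zs ws)
  case (Cons a as)
  show ?case
    by (simp add: Cons alt.simps(2) alt_cmult sum_product rank_one_def[of a] mult.assoc mult.left_commute)
qed simp

lemma mixed_disc_add:
  "mixed_disc (As @ (\<lambda>v w. H v w + H' v w) # Bs) zs ws =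
     mixed_disc (As @ H # Bs) zs ws + mixed_disc (As @ H' # Bs) zs ws"
  by (induction As arbitrary: zs ws) (auto simp: algebra_simps sum.distrib)

lemma mixed_disc_zero: "mixed_disc (As @ (\<lambda>v w. 0) # Bs) zs ws = 0"
  by (induction As arbitrary: zs ws) auto

definition rank_sum :: "('a \<Rightarrow> complex) list \<Rightarrow> 'a \<Rightarrow> 'a \<Rightarrow> complex" where
  "rank_sum bs v w = (\<Sum>b\<leftarrow>bs. rank_one b v w)"

lemma rank_sum_Nil: "rank_sum [] = (\<lambda>v w. 0)"
  by (simp add: rank_sum_def fun_eq_iff)

lemma rank_sum_Cons: "rank_sum (b # bs) = (\<lambda>v w. rank_one b v w + rank_sum bs v w)"
  by (auto simp: rank_sum_def fun_eq_iff)

text \<open>Expands one form after another by additivity; the prefix \<open>as\<close> collects the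
  rank-one terms already chosen.\<close>

lemma mixed_disc_nonneg:
  assumes "\<And>H. H \<in> set Hs \<Longrightarrow> \<exists>bs. H = rank_sum bs"
  shows "Re (mixed_disc (map rank_one as @ Hs) es es) \<ge> 0"
  using assms
proof (induction Hs arbitrary: as)
  case Nil
  show ?case by (simp add: mixed_disc_rank_one complex_mult_cnj)
next
  case (Cons H Hs)
  note IH = Cons.IH and prems = Cons.prems
  obtain bs where H: "H = rank_sum bs" using Cons.prems by auto
  have "Re (mixed_disc (map rank_one as @ rank_sum bs # Hs) es es) \<ge> 0"
  proof (induction bs)
    case Nil
    then show ?case by (simp add: rank_sum_Nil mixed_disc_zero)
  next
    case (Cons b bs)
    have "Re (mixed_disc (map rank_one (as @ [b]) @ Hs) es es) \<ge> 0"
      by (rule IH) (use prems in auto)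
    with Cons show ?case by (simp add: rank_sum_Cons mixed_disc_add)
  qed
  then show ?case by (simp add: H)
qed

text \<open>Keeps one rank-one term of each form; what is discarded is itself a mixed discriminant
  of rank-one sums, hence nonnegative.\<close>

lemma mixed_disc_mono:
  assumes "list_all2 (\<lambda>H b. \<exists>bs. H = rank_sum (b # bs)) Hs cs"
  shows "Re (mixed_disc (map rank_one (as @ cs)) es es) \<le> Re (mixed_disc (map rank_one as @ Hs) es es)"
  using assms
proof (induction Hs cs arbitrary: as rule: list_all2_induct)
  case (Cons H Hs b cs)
  obtain bs where H: "H = rank_sum (b # bs)" using Cons.hyps by auto
  have "\<exists>bs. H' = rank_sum bs" if "H' \<in> set (rank_sum bs # Hs)" for H'
    using that Cons.hyps(2) by (auto simp: list_all2_conv_all_nth in_set_conv_nth)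
  then have "Re (mixed_disc (map rank_one as @ rank_sum bs # Hs) es es) \<ge> 0"
    by (rule mixed_disc_nonneg)
  with Cons.IH[of "as @ [b]"] show ?case
    by (simp add: H rank_sum_Cons mixed_disc_add)
qed simp


lemma gprod_coordinates:
  assumes "distinct js"
  shows "alt (length js) (gprod (map (\<lambda>j v. s * v $ j) js)) (map (\<lambda>j. axis j 1) js) = s ^ length js"
  using assms
proof (induction js)
  case (Cons j js)
  have "alt (length js) (\<lambda>ws. gprod (map (\<lambda>j v. s * v $ j) (j # js)) (x # ws)) us =
      s * x $ j * alt (length js) (gprod (map (\<lambda>j v. s * v $ j) js)) us" for x us
    by (simp add: alt_cmult)
  moreover have "axis (js ! i) 1 $ j = (0::complex)" if "i < length js" for i
    using Cons.prems that by (auto simp: axis_def)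
  ultimately show ?case
    using Cons alt_append_Cons[of "length js" "gprod (map (\<lambda>j v. s * v $ j) (j # js))" "[]" "axis j 1" "map (\<lambda>j. axis j 1) js"]
    by (simp del: gprod.simps) 
qed simp

section \<open>Nonnegative Hermitian forms as sums of rank-one forms\<close>

definition hermitian_nonneg :: "(complex ^ 'n \<Rightarrow> complex ^ 'n \<Rightarrow> complex) \<Rightarrow> bool" where
  "hermitian_nonneg H \<longleftrightarrow> sesquilinear H \<and> (\<forall>v w. H w v = cnj (H v w)) \<and> (\<forall>v. Re (H v v) \<ge> 0)"

lemma hermitian_nonneg_null:
  assumes H: "hermitian_nonneg H" and v: "H v v = 0"
  shows "H v w = 0"
proof (rule ccontr)
  assume nz: "H v w \<noteq> 0"
  \<comment> \<open>Makes \<open>2 * Re (t * H v w)\<close> equal to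
    \<open>- (Re (H w w) + 1)\<close>, so that the form would have real part -1 at
    \<open>t *s v + w\<close>.\<close>
  define t where "t = (- (Re (H w w) + 1) / (2 * (cmod (H v w))\<^sup>2)) *\<^sub>R cnj (H v w)"
  have s: "sesquilinear H" and h: "H w v = cnj (H v w)" and "Re (H (t *s v + w) (t *s v + w)) \<ge> 0"
    using H unfolding hermitian_nonneg_def by blast+
  moreover have "H (t *s v + w) (t *s v + w) = t * H v w + cnj (t * H v w) + H w w"
    using s v h by (simp add: sesquilinear_def algebra_simps)
  moreover have "t * H v w = of_real (- (Re (H w w) + 1) / 2)"
  proof -
    have "t * H v w = of_real (- (Re (H w w) + 1) / (2 * (cmod (H v w))\<^sup>2)) * (H v w * cnj (H v w))"
      by (simp add: t_def scaleR_conv_of_real)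
    also have "H v w * cnj (H v w) = of_real ((cmod (H v w))\<^sup>2)"
      by (simp only: complex_norm_square[symmetric] of_real_power)
    also have "of_real (- (Re (H w w) + 1) / (2 * (cmod (H v w))\<^sup>2)) * of_real ((cmod (H v w))\<^sup>2) =
        (of_real (- (Re (H w w) + 1) / 2) :: complex)"
      unfolding of_real_mult[symmetric] using nz by (intro arg_cong[where f=of_real]) (simp add: field_simps)
    finally show ?thesis .
  qed
  ultimately have "Re (H w w) + 2 * (- (Re (H w w) + 1) / 2) \<ge> 0"
    by simp
  then show False by (simp add: field_simps)
qed

lemma sesquilinear_sum:
  assumes "sesquilinear H"
  shows "H (sum f I) w = (\<Sum>i\<in>I. H (f i) w)" "H w (sum f I) = (\<Sum>i\<in>I. H w (f i))"
  using assms sesquilinear_0[OF assms]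
  by (induction I rule: infinite_finite_induct) (auto simp: sesquilinear_def)

text \<open>Completing the square, as in a Cholesky factorisation: each step removes a rank-one form
  and clears a nonzero diagonal entry without creating new ones. Once all diagonal entries vanish,
  the form is zero by \<open>hermitian_nonneg_null\<close>.\<close>

lemma hermitian_nonneg_rank_sum:
  fixes H :: "complex ^ 'n::finite \<Rightarrow> complex ^ 'n \<Rightarrow> complex"
  assumes "hermitian_nonneg H"
  shows "\<exists>bs. H = rank_sum bs"
  using assms
proof (induction "card {j. H (axis j 1) (axis j 1) \<noteq> 0}" arbitrary: H rule: less_induct)
  case less
  note H = less.prems
  have s: "sesquilinear H" and h: "H w v = cnj (H v w)" for v w
    using H unfolding hermitian_nonneg_def by blast+
  show ?case
  proof (cases "\<exists>j. H (axis j 1) (axis j 1) \<noteq> 0")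
    case False
    have "H v w = 0" for v w
    proof -
      have "v = (\<Sum>j\<in>UNIV. v $ j *s axis j 1)"
        by (simp add: basis_expansion)
      then have "H v w = (\<Sum>j\<in>UNIV. H (v $ j *s axis j 1) w)"
        using sesquilinear_sum(1)[OF s] by metis
      also have "\<dots> = 0"
        using s False hermitian_nonneg_null[OF H] by (simp add: sesquilinear_def)
      finally show ?thesis .
    qed
    then have "H = rank_sum []" by (simp add: rank_sum_Nil fun_eq_iff)
    then show ?thesis by blast
  next
    case True
    then obtain j where j: "H (axis j 1) (axis j 1) \<noteq> 0" by blast
    define e :: "complex ^ 'n" where "e = axis j 1"
    define d where "d = Re (H e e)"
    have Hee: "H e e = of_real d"
      using h[of e e] by (simp add: d_def complex_eq_iff)
    have d: "d > 0"
      using H j Hee unfolding e_def hermitian_nonneg_def d_def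
      by (metis less_eq_real_def of_real_0)
    define a where "a = (\<lambda>v. H v e / of_real (sqrt d))"
    define H' where "H' = (\<lambda>v w. H v w - rank_one a v w)"
    have r: "rank_one a v w = H v e * H e w / of_real d" for v w
      using d h[of w e] by (simp add: rank_one_def a_def flip: of_real_mult)
    \<comment> \<open>The remainder is \<open>H\<close> at the component of \<open>v\<close> that is
      orthogonal to \<open>e\<close> with respect to \<open>H\<close>, so it stays
      nonnegative.\<close>
    have H'v: "H' v v = H (v - (H v e / of_real d) *s e) (v - (H v e / of_real d) *s e)" for v
    proof -
      have "H (v - k *s e) (v - k *s e) = H v v - cnj k * H v e - k * H e v + k * cnj k * H e e" for k
      proof -
        have "v - k *s e = v + (- k) *s e" by simp
        then show ?thesis using s by (simp only: sesquilinear_def) (simp add: algebra_simps)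
      qed
      moreover have "cnj (H v e / of_real d) * H e e = H e v"
        using d by (simp add: Hee h[of e v])
      ultimately show ?thesis
        by (simp add: H'_def r mult.assoc h[of e v])
    qed
    have H': "hermitian_nonneg H'"
      unfolding hermitian_nonneg_def
    proof (intro conjI allI)
      show "sesquilinear H'"
        using s by (simp add: sesquilinear_def H'_def rank_one_def a_def algebra_simps add_divide_distrib)
      show "H' w v = cnj (H' v w)" for v w
        using h[of v w] by (simp add: H'_def rank_one_def)
      show "Re (H' v v) \<ge> 0" for v
        unfolding H'v using H unfolding hermitian_nonneg_def by blast
    qed
    have "{k. H' (axis k 1) (axis k 1) \<noteq> 0} \<subset> {k. H (axis k 1) (axis k 1) \<noteq> 0}"
    proof
      have "H' e e = 0" using d by (simp add: H'_def r Hee)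
      then show "{k. H' (axis k 1) (axis k 1) \<noteq> 0} \<noteq> {k. H (axis k 1) (axis k 1) \<noteq> 0}"
        using j e_def by blast
      show "{k. H' (axis k 1) (axis k 1) \<noteq> 0} \<subseteq> {k. H (axis k 1) (axis k 1) \<noteq> 0}"
        using hermitian_nonneg_null[OF H] by (auto simp: H'_def r)
    qed
    then obtain bs where "H' = rank_sum bs"
      using less.hyps[OF psubset_card_mono H'] by auto
    moreover have "H v w = rank_one a v w + H' v w" for v w by (simp add: H'_def)
    ultimately have "H = rank_sum (a # bs)"
      by (simp add: rank_sum_Cons fun_eq_iff)
    then show ?thesis by blast
  qed
qed

lemma mixed_disc_hermitian_nonneg:
  assumes "\<And>H. H \<in> set Hs \<Longrightarrow> hermitian_nonneg H"
  shows "Re (mixed_disc Hs es es) \<ge> 0"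
  using mixed_disc_nonneg[of Hs "[]"] hermitian_nonneg_rank_sum assms by auto

text \<open>From the k-th form only \<open>\<delta>\<close> times the squared modulus of one
  coordinate is kept, the one given by the k-th entry of \<open>js\<close>. Different forms
  contribute different coordinates, so the remaining determinant is that of a diagonal matrix with
  entries \<open>sqrt \<delta>\<close>.\<close>

lemma mixed_disc_lower_bound:
  fixes js :: "'n::finite list"
  assumes "\<And>H. H \<in> set Hs \<Longrightarrow> hermitian_nonneg H"
    and "\<And>H v. H \<in> set Hs \<Longrightarrow> Re (H v v) \<ge> \<delta> * (norm v)\<^sup>2"
    and "distinct js" "length js = length Hs" "\<delta> \<ge> 0"
  shows "Re (mixed_disc Hs (map (\<lambda>j. axis j 1) js) (map (\<lambda>j. axis j 1) js)) \<ge> \<delta> ^ length Hs"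
proof -
  define b where "b = (\<lambda>j (v :: complex ^ 'n). of_real (sqrt \<delta>) * v $ j)"
  have "\<exists>bs. H = rank_sum (b j # bs)" if "H \<in> set Hs" for H j
  proof -
    have s: "sesquilinear H" and h: "\<And>v w. H w v = cnj (H v w)"
      using assms(1)[OF that] unfolding hermitian_nonneg_def by blast+
    have "hermitian_nonneg (\<lambda>v w. H v w - rank_one (b j) v w)"
      unfolding hermitian_nonneg_def
    proof (intro conjI allI)
      show "sesquilinear (\<lambda>v w. H v w - rank_one (b j) v w)"
        using s by (simp add: sesquilinear_def rank_one_def b_def algebra_simps)
      show "H w v - rank_one (b j) w v = cnj (H v w - rank_one (b j) v w)" for v w
        using h[of w v] by (simp add: rank_one_def)
      fix v
      have "rank_one (b j) v v = of_real (\<delta> * (cmod (v $ j))\<^sup>2)"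
      proof -
        have "rank_one (b j) v v = of_real (sqrt \<delta> * sqrt \<delta>) * (v $ j * cnj (v $ j))"
          by (simp only: rank_one_def b_def of_real_mult complex_cnj_mult complex_cnj_complex_of_real mult_ac)
        also have "\<dots> = of_real (sqrt \<delta> * sqrt \<delta> * (cmod (v $ j))\<^sup>2)"
          by (simp only: complex_norm_square[symmetric] of_real_mult of_real_power)
        finally show ?thesis
          using assms(5) by simp
      qed
      moreover have "\<delta> * (cmod (v $ j))\<^sup>2 \<le> \<delta> * (norm v)\<^sup>2"
        using assms(5) Finite_Cartesian_Product.norm_nth_le[of v j]
        by (intro mult_left_mono power_mono) auto
      ultimately show "0 \<le> Re (H v v - rank_one (b j) v v)"
        using assms(2)[OF that, of v] by simp
    qed
    then obtain bs where "(\<lambda>v w. H v w - rank_one (b j) v w) = rank_sum bs"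
      using hermitian_nonneg_rank_sum by blast
    then have "H v w - rank_one (b j) v w = rank_sum bs v w" for v w by metis
    then have "H v w = rank_one (b j) v w + rank_sum bs v w" for v w
      by (metis add.commute diff_add_cancel)
    then have "H = rank_sum (b j # bs)"
      by (simp add: rank_sum_Cons fun_eq_iff)
    then show ?thesis by blast
  qed
  then have "list_all2 (\<lambda>H c. \<exists>bs. H = rank_sum (c # bs)) Hs (map b js)"
    using assms(4) by (simp add: list_all2_conv_all_nth)
  from mixed_disc_mono[OF this, of "[]" "map (\<lambda>j. axis j 1) js"]
  have "Re (mixed_disc (map rank_one (map b js)) (map (\<lambda>j. axis j 1) js) (map (\<lambda>j. axis j 1) js))
      \<le> Re (mixed_disc Hs (map (\<lambda>j. axis j 1) js) (map (\<lambda>j. axis j 1) js))"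
    by simp
  also have "mixed_disc (map rank_one (map b js)) (map (\<lambda>j. axis j 1) js) (map (\<lambda>j. axis j 1) js) =
      of_real (sqrt \<delta>) ^ length js * cnj (of_real (sqrt \<delta>) ^ length js)"
    using gprod_coordinates[OF assms(3), of "of_real (sqrt \<delta>)"]
    unfolding mixed_disc_rank_one length_map b_def by simp
  also have "\<dots> = of_real (\<delta> ^ length js)"
    using assms(5) by (simp flip: power_mult_distrib of_real_mult)
  finally show ?thesis using assms(4) by simp
qed

section \<open>Smooth functions\<close>

lemma frechet_derivative_eqI:
  "(f has_derivative f') (at x) \<Longrightarrow> frechet_derivative f (at x) = f'"
  using frechet_derivative_at by fastforce

lemma Ck_Suc_imp_Ck: "Ck (Suc k) f \<Longrightarrow> Ck k f"
proof (induction k arbitrary: f)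
  case 0
  then have "f differentiable (at x)" for x by simp
  then show ?case
    by (simp add: continuous_at_imp_continuous_on differentiable_imp_continuous_within)
qed simp

lemma Ck_const: "Ck k (\<lambda>x. c)"
  by (induction k arbitrary: c) (auto simp: frechet_derivative_const)

lemma Ck_add:
  assumes "Ck k f" "Ck k g" shows "Ck k (\<lambda>x. f x + g x)"
  using assms
proof (induction k arbitrary: f g)
  case 0 then show ?case by (auto intro: continuous_intros)
next
  case (Suc k)
  have "frechet_derivative (\<lambda>x. f x + g x) (at x) =
      (\<lambda>v. frechet_derivative f (at x) v + frechet_derivative g (at x) v)" for x
    using Suc.prems by (intro frechet_derivative_eqI has_derivative_add) (auto simp: frechet_derivative_works)
  then show ?case using Suc by (auto intro: differentiable_add)
qed

lemma Ck_sum: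
  assumes "\<And>i. i \<in> I \<Longrightarrow> Ck k (f i)" shows "Ck k (\<lambda>x. \<Sum>i\<in>I. f i x)"
  using assms by (induction I rule: infinite_finite_induct) (auto intro: Ck_const Ck_add)

lemma Ck_linear_comp:
  assumes "bounded_linear L" "Ck k f" shows "Ck k (\<lambda>x. L (f x))"
  using assms(2)
proof (induction k arbitrary: f)
  case 0 then show ?case
    using linear_continuous_on[OF assms(1), of "UNIV"]
    by (auto intro: continuous_on_compose2)
next
  case (Suc k)
  have 1: "((\<lambda>x. L (f x)) has_derivative (\<lambda>v. L (frechet_derivative f (at x) v))) (at x)" for x
    using Suc.prems
    by (intro bounded_linear.has_derivative[OF assms(1)]) (auto simp: frechet_derivative_works)
  then have "frechet_derivative (\<lambda>x. L (f x)) (at x) = (\<lambda>v. L (frechet_derivative f (at x) v))" for x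
    by (rule frechet_derivative_eqI)
  then show ?case using Suc 1 by (auto simp: differentiable_def)
qed

lemma Ck_linear:
  assumes "bounded_linear L" shows "Ck k L"
proof (cases k)
  case 0 then show ?thesis using linear_continuous_on[OF assms] by simp
next
  case (Suc j)
  have "(L has_derivative L) (at x)" for x
    by (rule bounded_linear_imp_has_derivative[OF assms])
  then show ?thesis
    using Suc frechet_derivative_eqI[of L L] by (auto simp: differentiable_def Ck_const)
qed

lemma Ck_mult:
  fixes f g :: "'a::real_normed_vector \<Rightarrow> 'b::real_normed_algebra"
  assumes "Ck k f" "Ck k g" shows "Ck k (\<lambda>x. f x * g x)"
  using assms
proof (induction k arbitrary: f g)
  case 0 then show ?case by (auto intro: continuous_intros)
next
  case (Suc k)
  have "((\<lambda>x. f x * g x) has_derivative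
      (\<lambda>v. f x * frechet_derivative g (at x) v + frechet_derivative f (at x) v * g x)) (at x)" for x
    using Suc.prems by (intro has_derivative_mult) (auto simp: frechet_derivative_works)
  then have "frechet_derivative (\<lambda>x. f x * g x) (at x) =
      (\<lambda>v. f x * frechet_derivative g (at x) v + frechet_derivative f (at x) v * g x)" for x
    by (rule frechet_derivative_eqI)
  then show ?case
    using Suc Ck_Suc_imp_Ck[OF Suc.prems(1)] Ck_Suc_imp_Ck[OF Suc.prems(2)]
    by (auto intro!: differentiable_mult Ck_add)
qed

lemma Ck_compose_real:
  fixes f :: "real \<Rightarrow> real" and g :: "'a::real_normed_vector \<Rightarrow> real"
  assumes "Ck k f" "Ck k g" shows "Ck k (\<lambda>x. f (g x))"
  using assms
proof (induction k arbitrary: f)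
  case 0 then show ?case by (auto intro: continuous_on_compose2)
next
  case (Suc k)
  let ?D = "\<lambda>f x. frechet_derivative f (at x)"
  have 1: "((\<lambda>x. f (g x)) has_derivative (\<lambda>v. ?D f (g x) (?D g x v))) (at x)" for x
    using diff_chain_at[of g "?D g x" x f "?D f (g x)"] Suc.prems
    by (auto simp: frechet_derivative_works o_def)
  \<comment> \<open>A linear map on the reals is multiplication by its value at 1, so the chain rule
    becomes a product and \<open>Ck_mult\<close> applies.\<close>
  have 2: "?D f y t = ?D f y 1 * t" for y t
    using Suc.prems linear_cmul[OF linear_frechet_derivative[of f "at y"], of t 1]
    by (simp add: mult.commute)
  have 3: "?D (\<lambda>x. f (g x)) x v = ?D f (g x) 1 * ?D g x v" for x v
    unfolding frechet_derivative_eqI[OF 1] by (rule 2)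
  have "Ck k (\<lambda>x. ?D f (g x) 1)"
    by (rule Suc.IH) (use Suc.prems Ck_Suc_imp_Ck[OF Suc.prems(2)] in auto)
  then have "Ck k (\<lambda>x. ?D (\<lambda>x. f (g x)) x v)" for v
    unfolding 3 by (rule Ck_mult) (use Suc.prems in simp)
  moreover have "(\<lambda>x. f (g x)) differentiable (at x)" for x
    using 1 unfolding differentiable_def by blast
  ultimately show ?case by simp
qed

lemma Ck_inner_self: "Ck k (\<lambda>x::'a::euclidean_space. x \<bullet> x)"
proof -
  have "(\<lambda>x::'a. x \<bullet> x) = (\<lambda>x. \<Sum>b\<in>Basis. (x \<bullet> b) * (x \<bullet> b))"
    by (rule ext) (rule euclidean_inner)
  moreover have "Ck k (\<lambda>x::'a. \<Sum>b\<in>Basis. (x \<bullet> b) * (x \<bullet> b))"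
    by (intro Ck_sum Ck_mult Ck_linear bounded_linear_inner_left)
  ultimately show ?thesis by (simp only:)
qed

definition smooth :: "('a::real_normed_vector \<Rightarrow> 'b::real_normed_vector) \<Rightarrow> bool" where
  "smooth f \<longleftrightarrow> (\<forall>k. Ck k f)"

lemma smooth_differentiable: "smooth f \<Longrightarrow> f differentiable (at x)"
  unfolding smooth_def using Ck.simps(2) by blast

lemma smooth_frechet_derivative: "smooth f \<Longrightarrow> smooth (\<lambda>x. frechet_derivative f (at x) v)"
  unfolding smooth_def using Ck.simps(2) by blast

lemma smooth_has_derivative:
  "smooth f \<Longrightarrow> (f has_derivative frechet_derivative f (at x)) (at x)"
  using smooth_differentiable frechet_derivative_works by blast

lemma smooth_continuous_on: "smooth f \<Longrightarrow> continuous_on S f"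
  unfolding smooth_def using Ck.simps(1) continuous_on_subset by blast

lemma smooth_const: "smooth (\<lambda>x. c)"
  by (simp add: smooth_def Ck_const)

lemma smooth_add: "smooth f \<Longrightarrow> smooth g \<Longrightarrow> smooth (\<lambda>x. f x + g x)"
  by (simp add: smooth_def Ck_add)

lemma smooth_sum: "(\<And>i. i \<in> I \<Longrightarrow> smooth (f i)) \<Longrightarrow> smooth (\<lambda>x. \<Sum>i\<in>I. f i x)"
  by (simp add: smooth_def Ck_sum)

lemma smooth_mult:
  fixes f g :: "'a::real_normed_vector \<Rightarrow> 'b::real_normed_algebra"
  shows "smooth f \<Longrightarrow> smooth g \<Longrightarrow> smooth (\<lambda>x. f x * g x)"
  by (simp add: smooth_def Ck_mult)

lemma smooth_linear_comp: "bounded_linear L \<Longrightarrow> smooth f \<Longrightarrow> smooth (\<lambda>x. L (f x))"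
  by (simp add: smooth_def Ck_linear_comp)

text \<open>Two applications of the mean value theorem, first in direction \<open>v\<close>, then in
  direction \<open>w\<close>, turn the second difference into a mixed derivative at an intermediate
  point. The quotient is symmetric in \<open>v\<close> and \<open>w\<close>, which yields the
  interchange of derivatives.\<close>

lemma second_derivative_symmetric_aux:
  fixes f :: "'a::real_normed_vector \<Rightarrow> real"
  assumes f: "\<And>y. f differentiable (at y)"
    and fv: "\<And>y. (\<lambda>x. frechet_derivative f (at x) v) differentiable (at y)"
    and c: "continuous_on UNIV (\<lambda>x. frechet_derivative (\<lambda>x. frechet_derivative f (at x) v) (at x) w)"
  shows "((\<lambda>t. (f (x + t *\<^sub>R v + t *\<^sub>R w) - f (x + t *\<^sub>R v) - f (x + t *\<^sub>R w) + f x) / t\<^sup>2)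
     \<longlongrightarrow> frechet_derivative (\<lambda>x. frechet_derivative f (at x) v) (at x) w) (at_right 0)"
proof -
  let ?D = "\<lambda>f x. frechet_derivative f (at x)"
  let ?g = "\<lambda>x. ?D f x v"
  have ex: "\<exists>s s'. 0 < s \<and> s < t \<and> 0 < s' \<and> s' < t \<and>
     (f (x + t *\<^sub>R v + t *\<^sub>R w) - f (x + t *\<^sub>R v) - f (x + t *\<^sub>R w) + f x) / t\<^sup>2 =
       ?D ?g (x + s *\<^sub>R v + s' *\<^sub>R w) w" if t: "t > 0" for t :: real
  proof -
    define p where "p = (\<lambda>s. f (x + s *\<^sub>R v + t *\<^sub>R w) - f (x + s *\<^sub>R v))"
    have d: "((\<lambda>s. f (y + s *\<^sub>R v)) has_real_derivative ?g (y + s *\<^sub>R v)) (at s)" for y s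
    proof -
      have "((\<lambda>s. y + s *\<^sub>R v) has_derivative (\<lambda>h. h *\<^sub>R v)) (at s)"
        by (auto intro!: derivative_eq_intros)
      then have "((\<lambda>s. f (y + s *\<^sub>R v)) has_derivative (\<lambda>h. ?D f (y + s *\<^sub>R v) (h *\<^sub>R v))) (at s)"
        using diff_chain_at[of "\<lambda>s. y + s *\<^sub>R v" "\<lambda>h. h *\<^sub>R v" s f] f
        by (auto simp: frechet_derivative_works o_def)
      moreover have "?D f (y + s *\<^sub>R v) (h *\<^sub>R v) = ?g (y + s *\<^sub>R v) * h" for h
        using linear_frechet_derivative[OF f] by (simp add: linear_cmul)
      ultimately show ?thesis by (simp add: has_field_derivative_def)
    qed
    have dg: "((\<lambda>s. ?g (y + s *\<^sub>R w)) has_real_derivative ?D ?g (y + s *\<^sub>R w) w) (at s)" for y s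
    proof -
      have "((\<lambda>s. y + s *\<^sub>R w) has_derivative (\<lambda>h. h *\<^sub>R w)) (at s)"
        by (auto intro!: derivative_eq_intros)
      then have "((\<lambda>s. ?g (y + s *\<^sub>R w)) has_derivative (\<lambda>h. ?D ?g (y + s *\<^sub>R w) (h *\<^sub>R w))) (at s)"
        using diff_chain_at[of "\<lambda>s. y + s *\<^sub>R w" "\<lambda>h. h *\<^sub>R w" s ?g] fv
        by (auto simp: frechet_derivative_works o_def)
      moreover have "?D ?g (y + s *\<^sub>R w) (h *\<^sub>R w) = ?D ?g (y + s *\<^sub>R w) w * h" for h
        using linear_frechet_derivative[OF fv] by (simp add: linear_cmul)
      ultimately show ?thesis by (simp add: has_field_derivative_def)
    qed
    have "\<exists>s>0. s < t \<and> p t - p 0 = (t - 0) * (?g (x + t *\<^sub>R w + s *\<^sub>R v) - ?g (x + s *\<^sub>R v))"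
      using MVT2[of 0 t p "\<lambda>s. ?g (x + t *\<^sub>R w + s *\<^sub>R v) - ?g (x + s *\<^sub>R v)"] t
        DERIV_diff[OF d[of "x + t *\<^sub>R w"] d[of x]]
      by (simp add: p_def add_ac)
    then obtain s where s: "0 < s" "s < t" "p t - p 0 = t * (?g (x + s *\<^sub>R v + t *\<^sub>R w) - ?g (x + s *\<^sub>R v))"
      by (auto simp: add_ac)
    define G where "G = (\<lambda>r. ?g (x + s *\<^sub>R v + r *\<^sub>R w))"
    have "\<exists>r>0. r < t \<and> G t - G 0 = (t - 0) * ?D ?g (x + s *\<^sub>R v + r *\<^sub>R w) w"
      by (rule MVT2) (use t dg in \<open>auto simp: G_def\<close>)
    then obtain s' where s': "0 < s'" "s' < t"
      "?g (x + s *\<^sub>R v + t *\<^sub>R w) - ?g (x + s *\<^sub>R v + 0 *\<^sub>R w) = (t - 0) * ?D ?g (x + s *\<^sub>R v + s' *\<^sub>R w) w"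
      unfolding G_def by auto
    have "f (x + t *\<^sub>R v + t *\<^sub>R w) - f (x + t *\<^sub>R v) - f (x + t *\<^sub>R w) + f x =
        t\<^sup>2 * ?D ?g (x + s *\<^sub>R v + s' *\<^sub>R w) w"
      using s(3) s'(3) by (simp add: p_def power2_eq_square algebra_simps)
    then show ?thesis using s s' t by (intro exI[of _ s] exI[of _ s']) simp
  qed
  then obtain S S' where S: "\<And>t. t > 0 \<Longrightarrow> 0 < S t \<and> S t < t \<and> 0 < S' t \<and> S' t < t \<and>
     (f (x + t *\<^sub>R v + t *\<^sub>R w) - f (x + t *\<^sub>R v) - f (x + t *\<^sub>R w) + f x) / t\<^sup>2 =
       ?D ?g (x + S t *\<^sub>R v + S' t *\<^sub>R w) w"
    by metis
  have pos: "eventually (\<lambda>t::real. t > 0) (at_right 0)"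
    by (simp add: eventually_at_right_less)
  have lim: "(S \<longlongrightarrow> 0) (at_right 0)" "(S' \<longlongrightarrow> 0) (at_right 0)"
  proof -
    have t: "((\<lambda>t::real. t) \<longlongrightarrow> 0) (at_right 0)" by (rule tendsto_ident_at)
    show "(S \<longlongrightarrow> 0) (at_right 0)"
      by (rule tendsto_sandwich[OF _ _ tendsto_const t])
        (rule eventually_mono[OF pos], use S in force)+
    show "(S' \<longlongrightarrow> 0) (at_right 0)"
      by (rule tendsto_sandwich[OF _ _ tendsto_const t])
        (rule eventually_mono[OF pos], use S in force)+
  qed
  have "((\<lambda>t. x + S t *\<^sub>R v + S' t *\<^sub>R w) \<longlongrightarrow> x + 0 *\<^sub>R v + 0 *\<^sub>R w) (at_right 0)"
    by (intro tendsto_intros lim)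
  then have "((\<lambda>t. ?D ?g (x + S t *\<^sub>R v + S' t *\<^sub>R w) w) \<longlongrightarrow> ?D ?g x w) (at_right 0)"
    using c by (intro isCont_tendsto_compose[where g="\<lambda>y. ?D ?g y w"])
       (auto simp: continuous_on_eq_continuous_at)
  then show ?thesis
    by (rule Lim_transform_eventually) (rule eventually_mono[OF pos], use S in metis)
qed

lemma second_derivative_symmetric_real:
  fixes f :: "'a::real_normed_vector \<Rightarrow> real"
  assumes "smooth f"
  shows "frechet_derivative (\<lambda>x. frechet_derivative f (at x) v) (at x) w =
    frechet_derivative (\<lambda>x. frechet_derivative f (at x) w) (at x) v"
proof -
  have s: "smooth (\<lambda>x. frechet_derivative f (at x) v)" for v
    by (rule smooth_frechet_derivative[OF assms])
  let ?q = "\<lambda>v w t. (f (x + t *\<^sub>R v + t *\<^sub>R w) - f (x + t *\<^sub>R v) - f (x + t *\<^sub>R w) + f x) / t\<^sup>2"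
  have 1: "(?q v w \<longlongrightarrow> frechet_derivative (\<lambda>x. frechet_derivative f (at x) v) (at x) w) (at_right 0)" for v w
    by (intro second_derivative_symmetric_aux smooth_differentiable assms s
        smooth_continuous_on smooth_frechet_derivative)
  have "?q v w = ?q w v" by (auto simp: fun_eq_iff add_ac)
  with 1[of w v] 1[of v w] show ?thesis
    using tendsto_unique[of "at_right (0::real)"] by fastforce
qed

lemma frechet_derivative_linear_comp:
  assumes "bounded_linear L" "f differentiable (at x)"
  shows "frechet_derivative (\<lambda>x. L (f x)) (at x) v = L (frechet_derivative f (at x) v)"
proof -
  have "((\<lambda>x. L (f x)) has_derivative (\<lambda>v. L (frechet_derivative f (at x) v))) (at x)"
    using assms by (intro bounded_linear.has_derivative[OF assms(1)]) (auto simp: frechet_derivative_works)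
  then show ?thesis using frechet_derivative_eqI by metis
qed

lemma second_derivative_symmetric:
  fixes f :: "'a::real_normed_vector \<Rightarrow> 'b::euclidean_space"
  assumes "smooth f"
  shows "frechet_derivative (\<lambda>x. frechet_derivative f (at x) v) (at x) w =
    frechet_derivative (\<lambda>x. frechet_derivative f (at x) w) (at x) v"
proof (rule euclidean_eqI)
  fix b :: 'b
  have L: "bounded_linear (\<lambda>y. y \<bullet> b)" by (rule bounded_linear_inner_left)
  have "frechet_derivative (\<lambda>x. frechet_derivative f (at x) v) (at x) w \<bullet> b =
      frechet_derivative (\<lambda>x. frechet_derivative (\<lambda>x. f x \<bullet> b) (at x) v) (at x) w" for v w
    by (simp add: frechet_derivative_linear_comp[OF L] smooth_differentiable smooth_frechet_derivative assms)
  then show "frechet_derivative (\<lambda>x. frechet_derivative f (at x) v) (at x) w \<bullet> b =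
      frechet_derivative (\<lambda>x. frechet_derivative f (at x) w) (at x) v \<bullet> b"
    using second_derivative_symmetric_real[OF smooth_linear_comp[OF L assms]] by metis
qed

section \<open>Forms and the operator \<open>dd\<^sup>c\<close>\<close>

text \<open>The parameter treats both types of derivative at once: \<open>k = - \<i>\<close> gives
  the complex linear part, \<open>k = \<i>\<close> the antilinear part.\<close>

definition wd :: "complex \<Rightarrow> (complex ^ 'n::finite \<Rightarrow> complex) \<Rightarrow> complex ^ 'n \<Rightarrow> complex ^ 'n \<Rightarrow> complex" where
  "wd k f x v = (frechet_derivative f (at x) v + k * frechet_derivative f (at x) (\<i> *s v)) / 2"

lemma del_fun_wd: "del_fun f = wd (- \<i>) f"
  by (simp add: fun_eq_iff del_fun_def wd_def)

lemma delbar_fun_wd: "delbar_fun f = wd \<i> f"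
  by (simp add: fun_eq_iff delbar_fun_def wd_def)

lemma smooth_wd:
  assumes "smooth f" shows "smooth (\<lambda>x. wd k f x v)"
proof -
  have "smooth (\<lambda>x. (1 / 2) * frechet_derivative f (at x) v + k / 2 * frechet_derivative f (at x) (\<i> *s v))"
    by (intro smooth_add smooth_mult smooth_const smooth_frechet_derivative assms)
  then show ?thesis by (simp add: wd_def add_divide_distrib)
qed

lemma frechet_derivative_add:
  assumes "smooth f" "smooth g"
  shows "frechet_derivative (\<lambda>x. f x + g x) (at x) v =
    frechet_derivative f (at x) v + frechet_derivative g (at x) v"
  by (subst frechet_derivative_eqI[OF has_derivative_add[OF
        smooth_has_derivative[OF assms(1)] smooth_has_derivative[OF assms(2)]]]) simp

lemma frechet_derivative_mult:
  fixes f g :: "'a::real_normed_vector \<Rightarrow> 'b::real_normed_field"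
  assumes "smooth f" "smooth g"
  shows "frechet_derivative (\<lambda>x. f x * g x) (at x) v =
    f x * frechet_derivative g (at x) v + frechet_derivative f (at x) v * g x"
  by (subst frechet_derivative_eqI[OF has_derivative_mult[OF
        smooth_has_derivative[OF assms(1)] smooth_has_derivative[OF assms(2)]]]) simp

lemma frechet_derivative_cmult:
  fixes f :: "'a::real_normed_vector \<Rightarrow> 'b::real_normed_field"
  assumes "smooth f"
  shows "frechet_derivative (\<lambda>x. c * f x) (at x) v = c * frechet_derivative f (at x) v"
  using frechet_derivative_mult[OF smooth_const[of c] assms] by (simp add: frechet_derivative_const)

lemma wd_const [simp]: "wd k (\<lambda>x. c) x v = 0"
  by (simp add: wd_def frechet_derivative_const)

lemma wd_add:
  assumes "smooth f" "smooth g"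
  shows "wd k (\<lambda>x. f x + g x) x v = wd k f x v + wd k g x v"
  using assms by (simp add: wd_def frechet_derivative_add field_simps)

lemma wd_mult:
  assumes "smooth f" "smooth g"
  shows "wd k (\<lambda>x. f x * g x) x v = f x * wd k g x v + wd k f x v * g x"
  using assms by (simp add: wd_def frechet_derivative_mult field_simps)

lemma wd_cmult:
  assumes "smooth f"
  shows "wd k (\<lambda>x. c * f x) x v = c * wd k f x v"
  using wd_mult[OF smooth_const[of c] assms] by simp

lemma linear_wd:
  assumes "smooth f" shows "linear (\<lambda>v. wd k f x v)"
proof -
  have l: "linear (frechet_derivative f (at x))"
    using assms by (intro linear_frechet_derivative smooth_differentiable)
  have a: "frechet_derivative f (at x) (\<i> *s (r *\<^sub>R v)) = r *\<^sub>R frechet_derivative f (at x) (\<i> *s v)" for r v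
  proof -
    have "\<i> *s (r *\<^sub>R v) = r *\<^sub>R (\<i> *s v)"
      by (simp add: vec_eq_iff)
    then show ?thesis using linear_cmul[OF l] by metis
  qed
  show ?thesis
  proof (rule linearI)
    show "wd k f x (v + w) = wd k f x v + wd k f x w" for v w
      using linear_add[OF l] by (simp add: wd_def vector_add_ldistrib field_simps)
    show "wd k f x (r *\<^sub>R v) = r *\<^sub>R wd k f x v" for r v
      unfolding wd_def a linear_cmul[OF l] by (simp add: scaleR_conv_of_real field_simps)
  qed
qed

lemma wd_scale_i:
  assumes "smooth f" "k * k = - 1"
  shows "wd k f x (\<i> *s v) = - k * wd k f x v"
proof -
  have "\<i> *s (\<i> *s v) = - v" by (simp add: vec_eq_iff)
  moreover have "frechet_derivative f (at x) (- v) = - frechet_derivative f (at x) v"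
    using assms by (intro linear_neg linear_frechet_derivative smooth_differentiable)
  moreover have "k * (k * z) = - z" for z using assms(2) by (simp flip: mult.assoc)
  ultimately show ?thesis by (simp add: wd_def ring_distribs)
qed

text \<open>The factor is \<open>c\<close> for \<open>k = - \<i>\<close> and \<open>cnj c\<close>
  for \<open>k = \<i>\<close>; this makes the Levi form sesquilinear.\<close>

lemma wd_scale:
  assumes "smooth f" "k * k = - 1"
  shows "wd k f x (c *s v) = (of_real (Re c) - k * of_real (Im c)) * wd k f x v"
proof -
  have "c *s v = Re c *\<^sub>R v + Im c *\<^sub>R (\<i> *s v)"
  proof -
    have "c * z = Re c *\<^sub>R z + Im c *\<^sub>R (\<i> * z)" for z
      by (simp add: complex_eq_iff)
    then show ?thesis by (simp add: vec_eq_iff)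
  qed
  then have "wd k f x (c *s v) = Re c *\<^sub>R wd k f x v + Im c *\<^sub>R wd k f x (\<i> *s v)"
    using linear_add[OF linear_wd[OF assms(1)]] linear_cmul[OF linear_wd[OF assms(1)]] by metis
  then show ?thesis
    by (simp add: wd_scale_i[OF assms] scaleR_conv_of_real algebra_simps)
qed

lemma wd_commute:
  assumes "smooth f"
  shows "wd k (\<lambda>y. wd l f y w) x v = wd l (\<lambda>y. wd k f y v) x w"
proof -
  let ?D = "\<lambda>f x. frechet_derivative f (at x)"
  have s: "smooth (\<lambda>y. ?D f y u)" for u
    by (rule smooth_frechet_derivative[OF assms])
  have E: "?D (\<lambda>y. wd l f y w) x u = (?D (\<lambda>y. ?D f y w) x u + l * ?D (\<lambda>y. ?D f y (\<i> *s w)) x u) / 2" for u l w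
  proof -
    have "(\<lambda>y. wd l f y w) = (\<lambda>y. (1 / 2) * ?D f y w + l / 2 * ?D f y (\<i> *s w))"
      by (simp add: wd_def fun_eq_iff add_divide_distrib)
    moreover have "?D \<dots> x u = ?D (\<lambda>y. (1 / 2) * ?D f y w) x u + ?D (\<lambda>y. l / 2 * ?D f y (\<i> *s w)) x u"
      by (intro frechet_derivative_add smooth_mult smooth_const s)
    ultimately show ?thesis
      by (simp only: frechet_derivative_cmult[OF s]) (simp add: add_divide_distrib)
  qed
  have W: "wd k (\<lambda>y. wd l f y w) x v =
     (?D (\<lambda>y. ?D f y w) x v + l * ?D (\<lambda>y. ?D f y (\<i> *s w)) x v
      + k * (?D (\<lambda>y. ?D f y w) x (\<i> *s v) + l * ?D (\<lambda>y. ?D f y (\<i> *s w)) x (\<i> *s v))) / 4" for k l v w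
    unfolding wd_def[of k "\<lambda>y. wd l f y w"] E by (simp add: field_simps)
  have sym: "?D (\<lambda>y. ?D f y a) x b = ?D (\<lambda>y. ?D f y b) x a" for a b
    by (rule second_derivative_symmetric[OF assms])
  show ?thesis
    unfolding W sym[of v w] sym[of "\<i> *s v" w] sym[of v "\<i> *s w"] sym[of "\<i> *s v" "\<i> *s w"]
    by (simp add: algebra_simps)
qed

lemma wd_cnj:
  assumes "smooth f"
  shows "cnj (wd k f x v) = wd (cnj k) (\<lambda>x. cnj (f x)) x v"
  using assms
  by (simp add: wd_def frechet_derivative_linear_comp[OF bounded_linear_cnj] smooth_differentiable)

text \<open>Coefficients before alternation: linear in each argument on lists of length
  \<open>m\<close>, but not alternating, so that products and derivatives are plain formulas in the
  entries.\<close>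

definition smooth_form :: "nat \<Rightarrow> 'n::finite form \<Rightarrow> bool" where
  "smooth_form m c \<longleftrightarrow> (\<forall>ws. smooth (\<lambda>x. c x ws)) \<and>
     (\<forall>x xs ys. length xs + length ys + 1 = m \<longrightarrow> linear (\<lambda>v. c x (xs @ v # ys)))"

text \<open>The case distinction is there because \<open>alt m\<close> need not vanish on lists of
  other lengths, whereas \<open>is_form\<close> demands it.\<close>

definition altform :: "nat \<Rightarrow> 'n::finite form \<Rightarrow> 'n form" where
  "altform m c x vs = (if length vs = m then alt m (c x) vs else 0)"

text \<open>The exterior derivative of type \<open>k\<close> before alternation: the new argument
  comes first and serves as the direction of differentiation.\<close>

definition wdf :: "complex \<Rightarrow> 'n::finite form \<Rightarrow> 'n form" where
  "wdf k c x ws = wd k (\<lambda>y. c y (tl ws)) x (hd ws)"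

definition wdiff :: "complex \<Rightarrow> 'n::finite form \<Rightarrow> 'n form" where
  "wdiff k \<omega> x vs =
     (\<Sum>i<length vs. (- 1) ^ i * wd k (\<lambda>y. \<omega> y (take i vs @ drop (Suc i) vs)) x (vs ! i))"

lemma del_wdiff: "del = wdiff (- \<i>)"
  by (simp add: fun_eq_iff del_def wdiff_def del_fun_wd)

lemma delbar_wdiff: "delbar = wdiff \<i>"
  by (simp add: fun_eq_iff delbar_def wdiff_def delbar_fun_wd)

lemma smooth_alt:
  assumes "\<And>ws. smooth (\<lambda>x. c x ws)"
  shows "smooth (\<lambda>x. alt m (c x) vs)"
  using assms
proof (induction m arbitrary: c vs)
  case (Suc m)
  have "smooth (\<lambda>x. alt m (\<lambda>ws. c x (v # ws)) us)" for v us
    by (rule Suc.IH) (rule Suc.prems)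
  then show ?case
    unfolding alt.simps(2) by (intro smooth_sum smooth_mult smooth_const)
qed simp

lemma wd_sum:
  assumes "\<And>i. i \<in> I \<Longrightarrow> smooth (f i)"
  shows "wd k (\<lambda>x. \<Sum>i\<in>I. f i x) x v = (\<Sum>i\<in>I. wd k (f i) x v)"
  using assms by (induction I rule: infinite_finite_induct) (auto simp: wd_add smooth_sum)

lemma wd_alt:
  assumes "\<And>ws. smooth (\<lambda>x. c x ws)"
  shows "wd k (\<lambda>x. alt m (c x) vs) x v = alt m (\<lambda>ws. wd k (\<lambda>y. c y ws) x v) vs"
  using assms
proof (induction m arbitrary: c vs)
  case (Suc m)
  have 1: "wd k (\<lambda>x. alt m (\<lambda>ws. c x (u # ws)) us) x v =
      alt m (\<lambda>ws. wd k (\<lambda>y. c y (u # ws)) x v) us" for u us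
    by (rule Suc.IH) (rule Suc.prems)
  have 2: "smooth (\<lambda>x. alt m (\<lambda>ws. c x (u # ws)) us)" for u us
    by (rule smooth_alt) (rule Suc.prems)
  show ?case
    unfolding alt.simps(2)
    by (subst wd_sum) (auto simp: 1 wd_cmult[OF 2] intro!: smooth_mult smooth_const 2)
qed simp

text \<open>The Laplace expansion of \<open>alt\<close> along the first argument is literally the
  formula for the exterior derivative on constant fields; since \<open>alt\<close> is unnormalised,
  no factorials appear.\<close>

lemma wdiff_altform:
  assumes "smooth_form m c"
  shows "wdiff k (altform m c) = altform (Suc m) (wdf k c)"
proof (intro ext)
  fix x vs
  have s: "smooth (\<lambda>x. c x ws)" for ws using assms by (simp add: smooth_form_def)
  show "wdiff k (altform m c) x vs = altform (Suc m) (wdf k c) x vs"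
  proof (cases "length vs = Suc m")
    case True
    then have "(\<lambda>y. altform m c y (take i vs @ drop (Suc i) vs)) =
        (\<lambda>y. alt m (c y) (take i vs @ drop (Suc i) vs))" if "i < length vs" for i
      using that by (simp add: altform_def fun_eq_iff)
    then show ?thesis
      using True by (simp add: wdiff_def altform_def[of "Suc m"] alt.simps(2) wdf_def wd_alt[OF s])
  next
    case False
    then have "(\<lambda>y. altform m c y (take i vs @ drop (Suc i) vs)) = (\<lambda>y. 0)" if "i < length vs" for i
      using that by (auto simp: altform_def fun_eq_iff)
    then show ?thesis using False by (simp add: wdiff_def altform_def)
  qed
qed

lemma smooth_form_wdf:
  assumes "smooth_form m c"
  shows "smooth_form (Suc m) (wdf k c)"
proof -
  have s: "smooth (\<lambda>x. c x ws)" for ws using assms by (simp add: smooth_form_def)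
  have l: "linear (\<lambda>v. c x (xs @ v # ys))" if "length xs + length ys + 1 = m" for x xs ys
    using assms that by (simp add: smooth_form_def)
  show ?thesis
    unfolding smooth_form_def
  proof (intro conjI allI impI)
    show "smooth (\<lambda>x. wdf k c x ws)" for ws
      unfolding wdf_def by (rule smooth_wd[OF s])
    fix x and xs ys :: "(complex ^ 'a) list"
    assume len: "length xs + length ys + 1 = Suc m"
    show "linear (\<lambda>v. wdf k c x (xs @ v # ys))"
    proof (cases xs)
      case Nil
      then show ?thesis by (simp add: wdf_def linear_wd s)
    next
      case (Cons u us)
      have 1: "c y (us @ (v + w) # ys) = c y (us @ v # ys) + c y (us @ w # ys)" for y v w
        using linear_add[OF l[of us ys y]] len Cons by simp
      have 2: "c y (us @ (r *\<^sub>R v) # ys) = of_real r * c y (us @ v # ys)" for y v r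
        using linear_cmul[OF l[of us ys y]] len Cons by (simp add: scaleR_conv_of_real[where 'a=complex])
      show ?thesis
        by (rule linearI)
          (simp_all add: Cons wdf_def 1 2 wd_add s wd_cmult[OF s] scaleR_conv_of_real[where 'a=complex])
    qed
  qed
qed

lemma smooth_form_mult:
  assumes "smooth h" "smooth_form m c"
  shows "smooth_form m (\<lambda>x ws. h x * c x ws)"
  unfolding smooth_form_def
proof (intro conjI allI impI)
  show "smooth (\<lambda>x. h x * c x ws)" for ws
    using assms by (auto simp: smooth_form_def intro: smooth_mult)
  show "linear (\<lambda>v. h x * c x (xs @ v # ys))" if "length xs + length ys + 1 = m" for x xs ys
    using assms(2) that linear_compose[OF _ linear_times[of "h x"], of "\<lambda>v. c x (xs @ v # ys)"]
    by (simp add: smooth_form_def o_def)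
qed

lemma is_form_altform:
  assumes "\<And>x xs ys. length xs + length ys + 1 = m \<Longrightarrow> linear (\<lambda>v. c x (xs @ v # ys))"
  shows "is_form m (altform m c)"
  unfolding is_form_def
proof (intro conjI allI impI)
  show "altform m c x vs = 0" if "length vs \<noteq> m" for x vs
    using that by (simp add: altform_def)
  show "altform m c x vs = 0" if "\<not> distinct vs" for x vs
    using that by (simp add: altform_def alt_not_distinct)
  fix x and vs :: "(complex ^ 'a) list" and i assume i: "length vs = m \<and> i < m"
  let ?xs = "take i vs" and ?ys = "drop (Suc i) vs"
  have e: "altform m c x (vs[i := v]) = alt m (c x) (?xs @ v # ?ys)" for v
    using i by (simp add: altform_def upd_conv_take_nth_drop)
  have len: "length ?xs + length ?ys + 1 = m" using i by simp
  have 1: "alt m (c x) (?xs @ (v + w) # ?ys) = 1 * alt m (c x) (?xs @ v # ?ys) + 1 * alt m (c x) (?xs @ w # ?ys)" for v w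
    by (rule alt_slot[OF _ len]) (use linear_add[OF assms] in simp)
  have 2: "alt m (c x) (?xs @ (r *\<^sub>R v) # ?ys) = of_real r * alt m (c x) (?xs @ v # ?ys) + 0 * alt m (c x) (?xs @ v # ?ys)" for r v
    by (rule alt_slot[OF _ len]) (use linear_cmul[OF assms] in \<open>simp add: scaleR_conv_of_real[where 'a=complex]\<close>)
  show "linear (\<lambda>v. altform m c x (vs[i := v]))"
    by (rule linearI) (use 1 2 in \<open>simp_all add: e scaleR_conv_of_real\<close>)
qed

lemma altform_cong:
  assumes "\<And>ws. length ws = m \<Longrightarrow> c x ws = c' x ws"
  shows "altform m c x vs = altform m c' x vs"
  using assms by (simp add: altform_def alt_cong[of m "c x" "c' x"])

lemma altform_cmult: "altform m (\<lambda>x ws. h x * c x ws) x vs = h x * altform m c x vs"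
  by (simp add: altform_def alt_cmult)

lemma wdf_wdf: "wdf k (wdf l c) x (v # w # ws) = wd k (\<lambda>y. wd l (\<lambda>z. c z ws) y w) x v"
  by (simp add: wdf_def)

lemma length_Suc_SucE:
  assumes "length ws = Suc (Suc m)"
  obtains v w us where "ws = v # w # us" "length us = m"
  using assms by (metis length_Suc_conv)

definition ddf :: "'n::finite form \<Rightarrow> 'n form" where
  "ddf c = wdf (- \<i>) (wdf \<i> c)"

lemma smooth_form_ddf: "smooth_form m c \<Longrightarrow> smooth_form (Suc (Suc m)) (ddf c)"
  by (simp add: ddf_def smooth_form_wdf)

lemma ddc_altform:
  assumes "smooth_form m c"
  shows "ddc (altform m c) = altform (Suc (Suc m)) (\<lambda>x ws. 2 * \<i> * ddf c x ws)"
proof -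
  have "del (delbar (altform m c)) = altform (Suc (Suc m)) (ddf c)"
    by (simp add: del_wdiff delbar_wdiff ddf_def wdiff_altform smooth_form_wdf assms)
  then show ?thesis
    using altform_cmult[of "Suc (Suc m)" "\<lambda>_. 2 * \<i>" "ddf c"] by (simp add: fun_eq_iff ddc_def)
qed

text \<open>Coefficients are not determined by the form that they represent. This allows passing to
  other coefficients with the same alternation before differentiating.\<close>

lemma altform_ddf_cong:
  assumes "smooth_form m c" "smooth_form m c'" "altform m c = altform m c'"
  shows "altform (Suc (Suc m)) (ddf c) = altform (Suc (Suc m)) (ddf c')"
  using assms wdiff_altform[OF smooth_form_wdf[OF assms(1)], of "- \<i>" \<i>]
    wdiff_altform[OF smooth_form_wdf[OF assms(2)], of "- \<i>" \<i>]
    wdiff_altform[OF assms(1), of \<i>] wdiff_altform[OF assms(2), of \<i>]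
  by (simp add: ddf_def)

text \<open>For \<open>k = - \<i>\<close> two complex linear derivatives meet in the first two
  slots. For \<open>k = \<i>\<close> the first two derivatives are interchanged at the cost of a
  sign, after which two antilinear ones meet.\<close>

lemma altform_wdf_ddf:
  assumes c: "smooth_form m c" and k: "k = - \<i> \<or> k = \<i>"
  shows "altform (Suc (Suc (Suc m))) (wdf k (ddf c)) x vs = 0"
proof -
  have s: "smooth (\<lambda>x. c x ws)" for ws using c by (simp add: smooth_form_def)
  have "alt (Suc (Suc (Suc m))) (wdf k (ddf c) x) vs = 0"
  proof (cases "k = - \<i>")
    case True
    show ?thesis
    proof (rule alt_sym_eq_0)
      fix a b and ws :: "(complex ^ 'a) list" assume "length ws = Suc m"
      then show "wdf k (ddf c) x (a # b # ws) = wdf k (ddf c) x (b # a # ws)"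
        unfolding ddf_def True wdf_wdf by (intro wd_commute) (simp add: wdf_def smooth_wd s)
    qed
  next
    case False
    then have k: "k = \<i>" using k by simp
    let ?c = "\<lambda>ws. - wdf (- \<i>) (wdf \<i> (wdf \<i> c)) x ws"
    have "alt (Suc (Suc (Suc m))) (wdf k (ddf c) x) vs = alt (Suc (Suc (Suc m))) ?c vs"
    proof (rule alt_swap)
      fix a b and ws :: "(complex ^ 'a) list" assume "length ws = Suc m"
      show "wdf k (ddf c) x (a # b # ws) = - (- wdf (- \<i>) (wdf \<i> (wdf \<i> c)) x (b # a # ws))"
        unfolding ddf_def k wdf_wdf minus_minus by (intro wd_commute) (simp add: wdf_def smooth_wd s)
    qed
    moreover have "alt (Suc (Suc m)) (\<lambda>ws. ?c (v # ws)) us = 0" for v us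
    proof (rule alt_sym_eq_0)
      fix a b and ws :: "(complex ^ 'a) list"
      have "(\<lambda>y. wd \<i> (\<lambda>y. wd \<i> (\<lambda>y. c y ws) y b) y a) = (\<lambda>y. wd \<i> (\<lambda>y. wd \<i> (\<lambda>y. c y ws) y a) y b)"
        by (intro ext wd_commute s)
      then show "?c (v # a # b # ws) = ?c (v # b # a # ws)"
        by (simp add: wdf_def)
    qed
    ultimately show ?thesis by (simp add: alt.simps(2)[of "Suc (Suc m)"])
  qed
  then show ?thesis by (simp add: altform_def)
qed

section \<open>The Leibniz rule for \<open>dd\<^sup>c\<close> and products of Levi forms\<close>

definition levi :: "(complex ^ 'n::finite \<Rightarrow> complex) \<Rightarrow> complex ^ 'n \<Rightarrow> complex ^ 'n \<Rightarrow> complex ^ 'n \<Rightarrow> complex" where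
  "levi h x v w = wd (- \<i>) (\<lambda>y. wd \<i> h y w) x v"

lemma smooth_levi: "smooth h \<Longrightarrow> smooth (\<lambda>x. levi h x v w)"
  unfolding levi_def by (intro smooth_wd)

text \<open>Of the four terms of the product rule only the one with both derivatives on
  \<open>h\<close> survives; each of the others contains a derivative of \<open>c\<close>, which
  alternates to zero.\<close>

lemma altform_ddf_mult:
  assumes h: "smooth h" and c: "smooth_form m c"
    and closed: "\<And>k x vs. k = - \<i> \<or> k = \<i> \<Longrightarrow> altform (Suc m) (wdf k c) x vs = 0"
  shows "altform (Suc (Suc m)) (ddf (\<lambda>x ws. h x * c x ws)) =
    altform (Suc (Suc m)) (\<lambda>x ws. levi h x (ws ! 0) (ws ! 1) * c x (drop 2 ws))"
proof (intro ext)
  fix x and vs :: "(complex ^ 'a) list"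
  have s: "smooth (\<lambda>x. c x ws)" for ws using c by (simp add: smooth_form_def)
  show "altform (Suc (Suc m)) (ddf (\<lambda>x ws. h x * c x ws)) x vs =
    altform (Suc (Suc m)) (\<lambda>x ws. levi h x (ws ! 0) (ws ! 1) * c x (drop 2 ws)) x vs"
  proof (cases "length vs = Suc (Suc m)")
    case len: True
    let ?a = "alt (Suc (Suc m))"
    let ?t2 = "\<lambda>ws. wd \<i> h x (ws ! 1) * wdf (- \<i>) c x (hd ws # drop 2 ws)"
    let ?t3 = "\<lambda>ws. wd (- \<i>) h x (hd ws) * wdf \<i> c x (tl ws)"
    let ?t4 = "ddf c x"
    have "?a (ddf (\<lambda>x ws. h x * c x ws) x) vs =
      ?a (\<lambda>ws. levi h x (ws ! 0) (ws ! 1) * c x (drop 2 ws) + (?t2 ws + (?t3 ws + h x * ?t4 ws))) vs"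
    proof (rule alt_cong)
      fix ws :: "(complex ^ 'a) list" assume "length ws = Suc (Suc m)"
      then obtain v w us where ws: "ws = v # w # us" by (rule length_Suc_SucE)
      have "wd \<i> (\<lambda>z. h z * c z us) y w = h y * wd \<i> (\<lambda>z. c z us) y w + wd \<i> h y w * c y us" for y
        by (rule wd_mult) (auto intro: h s)
      then have "ddf (\<lambda>x ws. h x * c x ws) x ws =
         wd (- \<i>) (\<lambda>y. h y * wd \<i> (\<lambda>z. c z us) y w + wd \<i> h y w * c y us) x v"
        by (simp add: ddf_def ws wdf_def)
      also have "\<dots> = wd (- \<i>) (\<lambda>y. h y * wd \<i> (\<lambda>z. c z us) y w) x v + wd (- \<i>) (\<lambda>y. wd \<i> h y w * c y us) x v"
        by (intro wd_add smooth_mult smooth_wd h s)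
      also have "wd (- \<i>) (\<lambda>y. h y * wd \<i> (\<lambda>z. c z us) y w) x v =
          h x * wd (- \<i>) (\<lambda>y. wd \<i> (\<lambda>z. c z us) y w) x v + wd (- \<i>) h x v * wd \<i> (\<lambda>z. c z us) x w"
        by (intro wd_mult smooth_wd h s)
      also have "wd (- \<i>) (\<lambda>y. wd \<i> h y w * c y us) x v =
          wd \<i> h x w * wd (- \<i>) (\<lambda>z. c z us) x v + wd (- \<i>) (\<lambda>y. wd \<i> h y w) x v * c x us"
        by (intro wd_mult smooth_wd h s)
      finally show "ddf (\<lambda>x ws. h x * c x ws) x ws =
          levi h x (ws ! 0) (ws ! 1) * c x (drop 2 ws) + (?t2 ws + (?t3 ws + h x * ?t4 ws))"
        by (simp add: ddf_def ws wdf_def levi_def)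
    qed
    also have "\<dots> = ?a (\<lambda>ws. levi h x (ws ! 0) (ws ! 1) * c x (drop 2 ws)) vs +
        (?a ?t2 vs + (?a ?t3 vs + h x * ?a ?t4 vs))"
      by (simp only: alt_add alt_cmult)
    also have "?a ?t4 vs = 0"
    proof -
      \<comment> \<open>The vanishing form represented by \<open>wdf \<i> c\<close> is
        differentiated once more.\<close>
      have "altform (Suc m) (wdf \<i> c) = altform (Suc m) (\<lambda>x ws. 0)"
        using closed[of \<i>] by (simp add: fun_eq_iff altform_def alt_zero)
      moreover have "smooth_form (Suc m) (\<lambda>x ws. 0)"
        by (simp add: smooth_form_def smooth_const linear_iff)
      ultimately have "altform (Suc (Suc m)) (wdf (- \<i>) (wdf \<i> c)) = altform (Suc (Suc m)) (wdf (- \<i>) (\<lambda>x ws. 0))"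
        using wdiff_altform[of "Suc m" _ "- \<i>"] smooth_form_wdf[OF c] by metis
      moreover have "altform (Suc (Suc m)) (wdf (- \<i>) (\<lambda>x ws. 0)) x vs = 0"
      proof -
        have "wdf (- \<i>) (\<lambda>x ws. 0) = (\<lambda>(x :: complex ^ 'a) ws. 0)" by (simp add: fun_eq_iff wdf_def)
        then show ?thesis by (simp add: altform_def alt_zero)
      qed
      ultimately have "altform (Suc (Suc m)) (wdf (- \<i>) (wdf \<i> c)) x vs = 0" by (simp only:)
      then show ?thesis using len by (simp add: altform_def ddf_def)
    qed
    also have "?a ?t3 vs = 0"
    proof -
      have "alt (Suc m) (\<lambda>ws. ?t3 (v # ws)) us = wd (- \<i>) h x v * alt (Suc m) (wdf \<i> c x) us" for v us
        by (simp add: alt_cmult)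
      moreover have "alt (Suc m) (wdf \<i> c x) us = 0" if "length us = Suc m" for us
        using closed[of \<i> x us] that by (simp add: altform_def)
      ultimately show ?thesis using len by (simp add: alt.simps(2)[of "Suc m"])
    qed
    also have "?a ?t2 vs = 0"
    proof -
      \<comment> \<open>In \<open>?t2\<close> the derivative of \<open>h\<close> takes the second
        argument; a transposition moves it to the front, so that the derivative of \<open>c\<close>
        is alternated over the rest.\<close>
      let ?t = "\<lambda>ws. - (wd \<i> h x (hd ws) * wdf (- \<i>) c x (tl ws))"
      have "?a ?t2 vs = ?a ?t vs"
        by (rule alt_swap) simp
      moreover have "alt (Suc m) (\<lambda>ws. ?t (v # ws)) us = - wd \<i> h x v * alt (Suc m) (wdf (- \<i>) c x) us" for v us
        using alt_cmult[of "Suc m" "- wd \<i> h x v"] by simp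
      moreover have "alt (Suc m) (wdf (- \<i>) c x) us = 0" if "length us = Suc m" for us
        using closed[of "- \<i>" x us] that by (simp add: altform_def)
      ultimately show ?thesis using len by (simp add: alt.simps(2)[of "Suc m"])
    qed
    finally show ?thesis using len by (simp add: altform_def)
  qed (simp add: altform_def)
qed

definition levi_prod :: "(complex ^ 'n::finite \<Rightarrow> complex) list \<Rightarrow> 'n form" where
  "levi_prod hs x = hprod (map (\<lambda>h. levi h x) hs)"

lemma levi_prod_simps:
  "levi_prod [] x ws = 1"
  "levi_prod (h # hs) x ws = levi h x (ws ! 0) (ws ! 1) * levi_prod hs x (drop 2 ws)"
  by (simp_all add: levi_prod_def)

lemma sesquilinear_levi:
  assumes "smooth h" shows "sesquilinear (levi h x)"
proof -
  have s: "smooth (\<lambda>y. wd \<i> h y w)" for w by (rule smooth_wd[OF assms])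
  have 1: "wd \<i> h y (v + w) = wd \<i> h y v + wd \<i> h y w" for y v w
    using linear_add[OF linear_wd[OF assms]] .
  have 2: "wd \<i> h y (c *s v) = cnj c * wd \<i> h y v" for y c v
    using wd_scale[OF assms, of \<i>] by (simp add: complex_eq_iff)
  show ?thesis
    unfolding sesquilinear_def levi_def
  proof (intro conjI allI)
    show "wd (- \<i>) (\<lambda>y. wd \<i> h y w) x (u + v) =
        wd (- \<i>) (\<lambda>y. wd \<i> h y w) x u + wd (- \<i>) (\<lambda>y. wd \<i> h y w) x v" for u v w
      using linear_add[OF linear_wd[OF s]] .
    show "wd (- \<i>) (\<lambda>y. wd \<i> h y w) x (c *s v) = c * wd (- \<i>) (\<lambda>y. wd \<i> h y w) x v" for c v w
      using wd_scale[OF s, of "- \<i>"] by (simp add: complex_eq_iff)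
    show "wd (- \<i>) (\<lambda>y. wd \<i> h y (u + v)) x w =
        wd (- \<i>) (\<lambda>y. wd \<i> h y u) x w + wd (- \<i>) (\<lambda>y. wd \<i> h y v) x w" for u v w
      by (simp add: 1 wd_add s)
    show "wd (- \<i>) (\<lambda>y. wd \<i> h y (c *s v)) x w = cnj c * wd (- \<i>) (\<lambda>y. wd \<i> h y v) x w" for c v w
      by (simp add: 2 wd_cmult s)
  qed
qed

lemma smooth_form_levi_prod:
  assumes "\<And>h. h \<in> set hs \<Longrightarrow> smooth h"
  shows "smooth_form (2 * length hs) (levi_prod hs)"
  unfolding smooth_form_def
proof (intro conjI allI impI)
  show "smooth (\<lambda>x. levi_prod hs x ws)" for ws
    using assms
    by (induction hs arbitrary: ws) (auto simp: levi_prod_simps smooth_const intro!: smooth_mult smooth_levi)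
  fix x and xs ys :: "(complex ^ 'a) list" assume len: "length xs + length ys + 1 = 2 * length hs"
  have q: "sesquilinear (levi h x)" if "h \<in> set hs" for h
    by (rule sesquilinear_levi) (rule assms[OF that])
  have r: "r *\<^sub>R v = of_real r *s v" for r and v :: "complex ^ 'a"
    by (simp add: vec_eq_iff) (simp add: scaleR_conv_of_real)
  have 1: "levi_prod hs x (xs @ (v + w) # ys) =
      1 * levi_prod hs x (xs @ v # ys) + 1 * levi_prod hs x (xs @ w # ys)" for v w
    unfolding levi_prod_def
    by (rule hprod_slot) (use q len in \<open>auto simp: sesquilinear_def\<close>)
  have 2: "levi_prod hs x (xs @ (r *\<^sub>R v) # ys) =
      of_real r * levi_prod hs x (xs @ v # ys) + 0 * levi_prod hs x (xs @ v # ys)" for r v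
    unfolding levi_prod_def r
    by (rule hprod_slot) (use q len in \<open>auto simp: sesquilinear_def\<close>)
  show "linear (\<lambda>v. levi_prod hs x (xs @ v # ys))"
    by (rule linearI) (use 1 2 in \<open>simp_all add: scaleR_conv_of_real\<close>)
qed

lemma levi_prod_Cons:
  "levi_prod (h # hs) = (\<lambda>x ws. levi h x (ws ! 0) (ws ! 1) * levi_prod hs x (drop 2 ws))"
  by (simp add: fun_eq_iff levi_prod_simps)

text \<open>By induction, \<open>levi_prod (h # hs)\<close> has the same alternation as
  \<open>ddf\<close> of \<open>h\<close> times the closed product for \<open>hs\<close>, and such
  forms are closed by \<open>altform_wdf_ddf\<close>.\<close>

lemma altform_wdf_levi_prod:
  assumes "\<And>h. h \<in> set hs \<Longrightarrow> smooth h" and k: "k = - \<i> \<or> k = \<i>"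
  shows "altform (Suc (2 * length hs)) (wdf k (levi_prod hs)) x vs = 0"
  using assms
proof (induction hs arbitrary: k x vs)
  case Nil
  show ?case
    by (simp add: levi_prod_simps wdf_def altform_def alt.simps(2))
next
  case (Cons h hs)
  let ?m = "2 * length hs"
  have h: "smooth h" and hs: "\<And>g. g \<in> set hs \<Longrightarrow> smooth g" using Cons.prems by auto
  let ?d = "\<lambda>x ws. h x * levi_prod hs x ws"
  have d: "smooth_form ?m ?d"
    by (intro smooth_form_mult smooth_form_levi_prod h hs)
  have "altform (Suc (Suc ?m)) (ddf ?d) = altform (Suc (Suc ?m)) (levi_prod (h # hs))"
    unfolding levi_prod_Cons
    by (rule altform_ddf_mult[OF h smooth_form_levi_prod[OF hs]]) (use Cons.IH[OF hs] in auto)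
  then have "wdiff k (altform (Suc (Suc ?m)) (levi_prod (h # hs))) = altform (Suc (Suc (Suc ?m))) (wdf k (ddf ?d))"
    using wdiff_altform[OF smooth_form_ddf[OF d], of k] by simp
  moreover have "smooth_form (Suc (Suc ?m)) (levi_prod (h # hs))"
    using smooth_form_levi_prod[of "h # hs"] Cons.prems by simp
  ultimately have "altform (Suc (Suc (Suc ?m))) (wdf k (levi_prod (h # hs))) = altform (Suc (Suc (Suc ?m))) (wdf k (ddf ?d))"
    by (simp add: wdiff_altform)
  then show ?case
    using altform_wdf_ddf[OF d Cons.prems(2), of x vs] by simp
qed

lemma altform_ddf_levi_prod:
  assumes "\<And>g. g \<in> set hs \<Longrightarrow> smooth g" "smooth h"
  shows "altform (Suc (Suc (2 * length hs))) (ddf (\<lambda>x ws. h x * levi_prod hs x ws)) =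
    altform (Suc (Suc (2 * length hs))) (levi_prod (h # hs))"
  unfolding levi_prod_Cons
  by (rule altform_ddf_mult[OF assms(2) smooth_form_levi_prod[OF assms(1)]])
    (use altform_wdf_levi_prod[OF assms(1)] in auto)

text \<open>One step of the recursion in \<open>bedford_taylor\<close>, with \<open>u\<close>
  replaced by a smooth \<open>h\<close>.\<close>

definition dd_step :: "(complex ^ 'n::finite \<Rightarrow> complex) \<Rightarrow> 'n form \<Rightarrow> 'n form" where
  "dd_step h c = (\<lambda>x ws. h x * (2 * \<i> * ddf c x ws))"

lemma smooth_form_dd_step:
  assumes "smooth h" "smooth_form m c" shows "smooth_form (Suc (Suc m)) (dd_step h c)"
  unfolding dd_step_def
  by (intro smooth_form_mult[OF assms(1)] smooth_form_mult[OF smooth_const] smooth_form_ddf assms)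

lemma ddf_cmult:
  assumes "smooth_form m c"
  shows "ddf (\<lambda>x ws. k * c x ws) x ws = k * ddf c x ws"
proof -
  have s: "smooth (\<lambda>x. c x ws)" for ws using assms by (simp add: smooth_form_def)
  show ?thesis
    by (simp add: ddf_def wdf_def wd_cmult s smooth_wd)
qed

text \<open>At each step the product built so far is closed, so the next function contributes its
  Levi form and nothing else; only the outermost one stays undifferentiated.\<close>

lemma altform_foldr_dd_step:
  assumes "smooth \<phi>" "smooth h" "\<And>g. g \<in> set hs \<Longrightarrow> smooth g"
  shows "altform (Suc (Suc (2 * length hs))) (foldr dd_step (h # hs) (\<lambda>x ws. \<phi> x)) =
    altform (Suc (Suc (2 * length hs))) (\<lambda>x ws. h x * (2 * \<i>) ^ Suc (length hs) * levi_prod (hs @ [\<phi>]) x ws)"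
  using assms(2,3)
proof (induction hs arbitrary: h)
  case Nil
  have "altform 2 (ddf (\<lambda>x ws. \<phi> x)) = altform 2 (levi_prod [\<phi>])"
    using altform_ddf_levi_prod[of "[]" \<phi>] assms(1) by (simp add: levi_prod_simps numeral_2_eq_2)
  then have "altform 2 (\<lambda>x ws. h x * (2 * \<i>) * ddf (\<lambda>x ws. \<phi> x) x ws) =
      altform 2 (\<lambda>x ws. h x * (2 * \<i>) * levi_prod [\<phi>] x ws)"
    by (intro ext) (simp only: altform_cmult)
  then show ?case by (simp add: dd_step_def numeral_2_eq_2 mult.assoc)
next
  case (Cons g gs)
  let ?n = "Suc (Suc (2 * length gs))"
  let ?c = "foldr dd_step (g # gs) (\<lambda>x ws. \<phi> x)"
  let ?p = "levi_prod (gs @ [\<phi>])"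
  let ?e = "\<lambda>x ws. g x * ?p x ws"
  let ?K = "(2 * \<i>) ^ Suc (length gs)"
  have g: "smooth g" and gs: "\<And>g. g \<in> set (gs @ [\<phi>]) \<Longrightarrow> smooth g"
    using Cons.prems assms(1) by auto
  have p: "smooth_form ?n ?e"
    using smooth_form_levi_prod[of "gs @ [\<phi>]"] gs by (intro smooth_form_mult g) auto
  have 0: "smooth_form 0 (\<lambda>x ws. \<phi> x)" using assms(1) by (simp add: smooth_form_def)
  have f: "smooth_form (2 * length fs) (foldr dd_step fs (\<lambda>x ws. \<phi> x))" if "\<And>g. g \<in> set fs \<Longrightarrow> smooth g" for fs
    using that by (induction fs) (auto simp: 0 smooth_form_dd_step)
  have c: "smooth_form ?n ?c"
    using f[of "g # gs"] Cons.prems by simp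
  \<comment> \<open>The induction hypothesis identifies alternations only, hence the detour through
    \<open>altform_ddf_cong\<close>.\<close>
  have "altform ?n ?c = altform ?n (\<lambda>x ws. ?K * ?e x ws)"
    using Cons.IH[of g] Cons.prems by (simp add: mult_ac)
  then have "altform (Suc (Suc ?n)) (ddf ?c) = altform (Suc (Suc ?n)) (ddf (\<lambda>x ws. ?K * ?e x ws))"
    by (intro altform_ddf_cong c smooth_form_mult smooth_const p)
  also have "\<dots> = altform (Suc (Suc ?n)) (\<lambda>x ws. ?K * ddf ?e x ws)"
  proof -
    have "ddf (\<lambda>x ws. ?K * ?e x ws) = (\<lambda>x ws. ?K * ddf ?e x ws)"
      by (intro ext ddf_cmult[OF p])
    then show ?thesis by (simp only:)
  qed
  finally have 1: "altform (Suc (Suc ?n)) (ddf ?c) x vs = ?K * altform (Suc (Suc ?n)) (ddf ?e) x vs" for x vs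
    by (simp only: altform_cmult)
  have 2: "altform (Suc (Suc ?n)) (ddf ?e) = altform (Suc (Suc ?n)) (levi_prod (g # gs @ [\<phi>]))"
    using altform_ddf_levi_prod[of "gs @ [\<phi>]" g] gs g by simp
  have "altform (Suc (Suc ?n)) (\<lambda>x ws. h x * (2 * \<i>) * ddf ?c x ws) =
      altform (Suc (Suc ?n)) (\<lambda>x ws. h x * (2 * \<i> * ?K) * levi_prod (g # gs @ [\<phi>]) x ws)"
    by (intro ext) (simp only: altform_cmult 1 2 mult.assoc)
  then show ?case by (simp add: dd_step_def[of h] mult.assoc)
qed

text \<open>Two-forms commute, so the innermost factor, which will be the cutoff, can be brought to
  the front for the integration by parts.\<close>

lemma alt_hprod_rotate:
  "alt (2 * length Hs + 2) (hprod (Hs @ [G])) vs = alt (2 * length Hs + 2) (hprod (G # Hs)) vs"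
proof (induction Hs arbitrary: vs)
  case (Cons H Hs)
  let ?m = "2 * length Hs"
  have "alt (Suc (Suc (Suc (Suc ?m)))) (hprod (H # Hs @ [G])) vs =
      alt (Suc (Suc (Suc (Suc ?m)))) (hprod (H # G # Hs)) vs"
  proof (rule alt_Suc_cong, rule alt_Suc_cong)
    fix v w us
    show "alt (Suc (Suc ?m)) (\<lambda>ws. hprod (H # Hs @ [G]) (v # w # ws)) us =
        alt (Suc (Suc ?m)) (\<lambda>ws. hprod (H # G # Hs) (v # w # ws)) us"
      using Cons[of us] by (simp add: alt_cmult del: hprod.simps(2)) (simp add: alt_cmult)
  qed
  also have "\<dots> = alt (Suc (Suc (Suc (Suc ?m)))) (hprod (G # H # Hs)) vs"
    by (rule alt_swap_blocks) simp
  finally show ?case by (simp del: hprod.simps(2))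
qed simp

section \<open>Unwinding the Monge-Ampere current\<close>

lemma oriented_basis_eq:
  obtains js :: "'n::finite list" where "distinct js" "length js = CARD('n)"
    "(oriented_basis :: (complex ^ 'n) list) = concat (map (\<lambda>e. [e, \<i> *s e]) (map (\<lambda>j. axis j 1) js))"
proof -
  define js :: "'n list" where "js = (SOME js. distinct js \<and> set js = UNIV)"
  have "\<exists>js :: 'n list. distinct js \<and> set js = UNIV"
    using finite_distinct_list[of "UNIV :: 'n set"] by auto
  then have js: "distinct js \<and> set js = UNIV"
    unfolding js_def by (rule someI_ex)
  have "axis j \<i> = \<i> *s (axis j 1 :: complex ^ 'n)" for j
    by (auto simp: vec_eq_iff axis_def)
  then have "(oriented_basis :: (complex ^ 'n) list) = concat (map (\<lambda>e. [e, \<i> *s e]) (map (\<lambda>j. axis j 1) js))"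
    unfolding oriented_basis_def js_def[symmetric] by (simp add: o_def)
  moreover have "length js = CARD('n)"
    using js distinct_card by metis
  ultimately show ?thesis using that js by blast
qed

lemma norm_oriented_basis:
  assumes "v \<in> set (oriented_basis :: (complex ^ 'n::finite) list)" shows "norm v \<le> 1"
proof -
  obtain js :: "'n list" where js:
    "(oriented_basis :: (complex ^ 'n) list) = concat (map (\<lambda>e. [e, \<i> *s e]) (map (\<lambda>j. axis j 1) js))"
    using oriented_basis_eq by blast
  obtain j where "v = axis j 1 \<or> v = \<i> *s axis j 1"
    using assms[unfolded js] by auto
  moreover have "\<i> *s axis j 1 = (axis j \<i> :: complex ^ 'n)" for j
    by (auto simp: vec_eq_iff axis_def)
  ultimately show ?thesis by auto
qed

lemma integrable_continuous_compact_support: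
  fixes f :: "'a::euclidean_space \<Rightarrow> 'b::{banach, second_countable_topology}"
  assumes "continuous_on UNIV f" "compact K" "\<And>x. x \<notin> K \<Longrightarrow> f x = 0"
  shows "integrable lborel f"
proof -
  have "integrable lborel (\<lambda>x. indicator K x *\<^sub>R f x)"
    by (rule borel_integrable_compact) (use assms continuous_on_subset in blast)+
  moreover have "(\<lambda>x. indicator K x *\<^sub>R f x) = f"
    using assms(3) by (auto simp: indicator_def fun_eq_iff)
  ultimately show ?thesis by simp
qed

lemma bounded_compact_support:
  fixes f :: "'a::topological_space \<Rightarrow> 'b::real_normed_vector"
  assumes "continuous_on K f" "compact K" "\<And>x. x \<notin> K \<Longrightarrow> f x = 0"
  shows "\<exists>B. \<forall>x. norm (f x) \<le> B"
proof -
  have "bounded (f ` K)"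
    by (intro compact_imp_bounded compact_continuous_image assms)
  then obtain b where b: "\<forall>y\<in>f ` K. norm y \<le> b" unfolding bounded_iff by blast
  have "norm (f x) \<le> max b 0" for x
  proof (cases "x \<in> K")
    case True
    then have "norm (f x) \<le> b" using b by blast
    then show ?thesis by linarith
  qed (simp add: assms(3))
  then show ?thesis by blast
qed

lemma form_support_subset:
  assumes "closed K" "\<And>x vs. x \<notin> K \<Longrightarrow> \<omega> x vs = 0"
  shows "form_support \<omega> \<subseteq> K"
  unfolding form_support_def using assms by (intro closure_minimal) auto

lemma eq_0_outside_form_support: "x \<notin> form_support \<omega> \<Longrightarrow> \<omega> x vs = 0"
  unfolding form_support_def using closure_subset[of "{x. \<exists>vs. \<omega> x vs \<noteq> 0}"] by blast

text \<open>The bound on \<open>K\<close> holds with the Lebesgue measure of \<open>K\<close> as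
  constant, because the vectors of \<open>oriented_basis\<close> have norm at most one.\<close>

lemma order_zero_integration_current:
  "order_zero_current D (2 * CARD('n)) (integration_current :: 'n::finite form \<Rightarrow> complex)"
  unfolding order_zero_current_def
proof (intro conjI allI impI)
  have int: "integrable lborel (\<lambda>x. \<omega> x oriented_basis)"
    if "continuous_test_form D (2 * CARD('n)) \<omega>" for \<omega> :: "'n form"
    by (rule integrable_continuous_compact_support[of _ "form_support \<omega>"])
      (use that in \<open>auto simp: continuous_test_form_def eq_0_outside_form_support\<close>)
  show "integration_current (\<lambda>x vs. \<omega> x vs + \<eta> x vs) = integration_current \<omega> + integration_current \<eta>"
    if "continuous_test_form D (2 * CARD('n)) \<omega> \<and> continuous_test_form D (2 * CARD('n)) \<eta>"
    for \<omega> \<eta> :: "'n form"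
    using that by (simp add: integration_current_def int)
  show "integration_current (\<lambda>x vs. c * \<omega> x vs) = c * integration_current \<omega>"
    if "continuous_test_form D (2 * CARD('n)) \<omega>" for \<omega> :: "'n form" and c
    by (simp add: integration_current_def)
  fix K :: "(complex ^ 'n) set" assume K: "compact K \<and> K \<subseteq> D"
  show "\<exists>C. \<forall>\<omega> B. continuous_test_form D (2 * CARD('n)) \<omega> \<and> form_support \<omega> \<subseteq> K \<and>
      (\<forall>x vs. (\<forall>v\<in>set vs. norm v \<le> 1) \<longrightarrow> norm (\<omega> x vs) \<le> B) \<longrightarrow>
      norm (integration_current \<omega>) \<le> C * B"
  proof (intro exI allI impI, elim conjE)
    fix \<omega> :: "'n form" and B
    assume *: "continuous_test_form D (2 * CARD('n)) \<omega>" "form_support \<omega> \<subseteq> K"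
      "\<forall>x vs. (\<forall>v\<in>set vs. norm v \<le> 1) \<longrightarrow> norm (\<omega> x vs) \<le> B"
    have b: "norm (\<omega> x oriented_basis) \<le> B * indicator K x" for x
    proof (cases "x \<in> K")
      case False
      then have "x \<notin> form_support \<omega>" using *(2) by blast
      then show ?thesis using False by (simp add: eq_0_outside_form_support)
    qed (use *(3) norm_oriented_basis in auto)
    have f: "emeasure lborel K < \<infinity>"
      using K emeasure_compact_finite by blast
    have "norm (integration_current \<omega>) \<le> (LINT x|lborel. B * indicator K x)"
      unfolding integration_current_def
      by (rule Bochner_Integration.integral_norm_bound_integral)
        (use int[OF *(1)] b f K in \<open>auto intro!: integrable_mult_right integrable_real_indicator borel_compact\<close>)
    also have "\<dots> = measure lborel K * B"
      using K by (simp add: borel_compact)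
    finally show "norm (integration_current \<omega>) \<le> measure lborel K * B" .
  qed
qed

lemma bedford_taylor_order_zero:
  assumes "bedford_taylor D u k (T :: 'n::finite form \<Rightarrow> complex)"
  shows "order_zero_current D (2 * (CARD('n) - k)) T"
  using assms by cases (auto simp: order_zero_integration_current)

text \<open>Boundedness is given for each fixed list of vectors, but order zero estimates need it
  uniformly on unit vectors. Expanding the arguments one by one in the real basis reduces it to
  finitely many lists, at the cost of a factor of the dimension each time.\<close>

lemma form_bounded:
  fixes \<omega> :: "'n::finite form"
  assumes form: "is_form m \<omega>" and bdd: "\<And>vs. \<exists>M. \<forall>x. norm (\<omega> x vs) \<le> M"
  shows "\<exists>M\<ge>0. \<forall>x vs. (\<forall>v\<in>set vs. norm v \<le> 1) \<longrightarrow> norm (\<omega> x vs) \<le> M"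
proof -
  have "\<exists>M\<ge>0. \<forall>x xs ys. length xs = j \<longrightarrow> (\<forall>v\<in>set xs. norm v \<le> 1) \<longrightarrow> set ys \<subseteq> Basis \<longrightarrow>
      length ys = m - j \<longrightarrow> norm (\<omega> x (xs @ ys)) \<le> M" if "j \<le> m" for j
    using that
  proof (induction j)
    case 0
    obtain M where M: "\<And>vs x. norm (\<omega> x vs) \<le> M vs" using bdd by metis
    let ?L = "{ys :: (complex ^ 'n) list. set ys \<subseteq> Basis \<and> length ys = m}"
    have fin: "finite ?L" by (rule finite_lists_length_eq) simp
    have M0: "0 \<le> M ys" for ys using norm_ge_zero order_trans M by blast
    have "norm (\<omega> x ys) \<le> sum M ?L" if "ys \<in> ?L" for x ys
      using M[of x ys] member_le_sum[OF that _ fin, of M] M0 by force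
    then show ?case
      by (intro exI[of _ "sum M ?L"]) (auto intro: sum_nonneg M0)
  next
    case (Suc j)
    then obtain M where M: "M \<ge> 0" "\<And>x xs ys. length xs = j \<Longrightarrow> (\<forall>v\<in>set xs. norm v \<le> 1) \<Longrightarrow> set ys \<subseteq> Basis \<Longrightarrow>
        length ys = m - j \<Longrightarrow> norm (\<omega> x (xs @ ys)) \<le> M"
      by auto
    show ?case
    proof (intro exI[of _ "of_nat DIM(complex ^ 'n) * M"] conjI allI impI)
      show "0 \<le> of_nat DIM(complex ^ 'n) * M" using M(1) by simp
      fix x and xs ys :: "(complex ^ 'n) list"
      assume *: "length xs = Suc j" "\<forall>v\<in>set xs. norm v \<le> 1" "set ys \<subseteq> Basis" "length ys = m - Suc j"
      then obtain us v where xs: "xs = us @ [v]" "length us = j"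
        by (metis length_Suc_conv_rev)
      have up: "(us @ w # ys)[j := w'] = us @ w' # ys" for w w'
        using xs(2) by (simp add: list_update_append)
      have "length (us @ v # ys) = m" using xs * Suc.prems by simp
      then have "linear (\<lambda>w. \<omega> x ((us @ v # ys)[j := w]))"
        using form Suc.prems unfolding is_form_def by auto
      then have lin: "linear (\<lambda>w. \<omega> x (us @ w # ys))"
        by (simp only: up)
      have "\<omega> x (us @ v # ys) = \<omega> x (us @ (\<Sum>b\<in>Basis. (v \<bullet> b) *\<^sub>R b) # ys)"
        by (simp only: euclidean_representation)
      also have "\<dots> = (\<Sum>b\<in>Basis. (v \<bullet> b) *\<^sub>R \<omega> x (us @ b # ys))"
        by (subst linear_sum[OF lin]) (simp only: linear_cmul[OF lin])
      also have "norm \<dots> \<le> (\<Sum>b\<in>(Basis :: (complex ^ 'n) set). M)"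
      proof (rule sum_norm_le)
        fix b :: "complex ^ 'n" assume b: "b \<in> Basis"
        have "norm (\<omega> x (us @ b # ys)) \<le> M"
          by (rule M(2)) (use xs * b Suc.prems in auto)
        moreover have "\<bar>v \<bullet> b\<bar> \<le> 1"
          using Basis_le_norm[OF b, of v] * xs by auto
        ultimately have "\<bar>v \<bullet> b\<bar> * norm (\<omega> x (us @ b # ys)) \<le> 1 * M"
          by (intro mult_mono) auto
        then show "norm ((v \<bullet> b) *\<^sub>R \<omega> x (us @ b # ys)) \<le> M" by simp
      qed
      finally show "norm (\<omega> x (xs @ ys)) \<le> of_nat DIM(complex ^ 'n) * M"
        by (simp add: xs)
    qed
  qed
  from this[of m] obtain M where M: "M \<ge> 0" "\<And>x xs. length xs = m \<Longrightarrow> (\<forall>v\<in>set xs. norm v \<le> 1) \<Longrightarrow> norm (\<omega> x xs) \<le> M"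
    by fastforce
  have "norm (\<omega> x vs) \<le> M" if "\<forall>v\<in>set vs. norm v \<le> 1" for x vs
    using M that form by (cases "length vs = m") (auto simp: is_form_def)
  then show ?thesis using M by blast
qed

lemma wd_eq_0_open:
  assumes "open S" "x \<in> S" "\<And>y. y \<in> S \<Longrightarrow> f y = 0"
  shows "wd k f x v = 0"
proof -
  have "(f has_derivative (\<lambda>v. 0)) (at x)"
    by (rule has_derivative_transform_within_open[of "\<lambda>_. 0" _ _ _ S]) (use assms in auto)
  then show ?thesis by (simp add: wd_def frechet_derivative_eqI)
qed

lemma ddf_eq_0_open:
  assumes "open S" "x \<in> S" "\<And>y ws. y \<in> S \<Longrightarrow> c y ws = 0"
  shows "ddf c x ws = 0"
proof -
  have "wdf \<i> c y ws = 0" if "y \<in> S" for y ws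
    unfolding wdf_def by (rule wd_eq_0_open[OF assms(1) that]) (rule assms(3))
  then show ?thesis
    unfolding ddf_def wdf_def[of "- \<i>"] by (intro wd_eq_0_open[OF assms(1,2)])
qed

lemma test_form_altform:
  assumes "smooth_form m c" "compact K" "K \<subseteq> D" "\<And>x ws. x \<notin> K \<Longrightarrow> c x ws = 0"
  shows "test_form D m (altform m c)"
  unfolding test_form_def
proof (intro conjI allI)
  have z: "altform m c x vs = 0" if "x \<notin> K" for x vs
  proof -
    have "altform m c x vs = altform m (\<lambda>x ws. 0) x vs"
      by (rule altform_cong) (simp add: assms(4) that)
    then show ?thesis by (simp add: altform_def alt_zero)
  qed
  have K: "form_support (altform m c) \<subseteq> K"
    by (rule form_support_subset) (use assms(2) compact_imp_closed z in auto)
  show "is_form m (altform m c)"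
    by (rule is_form_altform) (use assms(1) in \<open>simp add: smooth_form_def\<close>)
  show "compact (form_support (altform m c))"
    using K assms(2) compact_Int_closed[of K "form_support (altform m c)"]
    by (simp add: form_support_def inf_absorb2)
  show "form_support (altform m c) \<subseteq> D" using K assms(3) by blast
  show "Ck k (\<lambda>x. altform m c x vs)" for vs k
    using assms(1) smooth_alt[of c m vs]
    by (cases "length vs = m") (auto simp: altform_def smooth_form_def smooth_def Ck_const)
qed

text \<open>The function \<open>f\<close>, which will involve \<open>u\<close>, is controlled on
  \<open>D\<close> only; the product is continuous everywhere because \<open>D\<close> and the
  complement of \<open>K\<close> form an open cover.\<close>

lemma continuous_test_form_mult:
  assumes f: "continuous_on D f" and "open D" and \<omega>: "is_form m \<omega>" "\<And>vs. continuous_on UNIV (\<lambda>x. \<omega> x vs)"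
    and K: "compact K" "K \<subseteq> D" "\<And>x ws. x \<notin> K \<Longrightarrow> \<omega> x ws = 0"
  shows "continuous_test_form D m (\<lambda>x vs. f x * \<omega> x vs)"
  unfolding continuous_test_form_def
proof (intro conjI allI)
  have S: "form_support (\<lambda>x vs. f x * \<omega> x vs) \<subseteq> K"
    by (rule form_support_subset) (use K compact_imp_closed in auto)
  show "is_form m (\<lambda>x vs. f x * \<omega> x vs)"
    unfolding is_form_def
  proof (intro conjI allI impI)
    fix x and vs :: "(complex ^ 'a) list" and i assume "length vs = m \<and> i < m"
    then have "linear (\<lambda>v. \<omega> x (vs[i := v]))" using \<omega>(1) by (simp add: is_form_def)
    then show "linear (\<lambda>v. f x * \<omega> x (vs[i := v]))"
      using linear_compose[OF _ linear_times[of "f x"]] by (simp add: o_def)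
  qed (use \<omega>(1) in \<open>auto simp: is_form_def\<close>)
  show "compact (form_support (\<lambda>x vs. f x * \<omega> x vs))"
    using S K(1) compact_Int_closed[of K "form_support (\<lambda>x vs. f x * \<omega> x vs)"]
    by (simp add: form_support_def inf_absorb2)
  show "form_support (\<lambda>x vs. f x * \<omega> x vs) \<subseteq> D" using S K by blast
  fix vs
  have "continuous_on D (\<lambda>x. f x * \<omega> x vs)"
    by (intro continuous_intros f continuous_on_subset[OF \<omega>(2)]) auto
  moreover have "continuous_on (- K) (\<lambda>x. f x * \<omega> x vs)"
    by (rule continuous_on_eq[of _ "\<lambda>_. 0"]) (use K in auto)
  ultimately have "continuous_on (D \<union> - K) (\<lambda>x. f x * \<omega> x vs)"
    using assms(2) K(1) compact_imp_closed by (intro continuous_on_open_Un) auto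
  moreover have "D \<union> - K = UNIV" using K by auto
  ultimately show "continuous_on UNIV (\<lambda>x. f x * \<omega> x vs)" by simp
qed

text \<open>Only the order zero bound for each current \<open>(dd\<^sup>c u)\<^sup>k\<close> separately enters: the
  approximants are chosen one after the other, so no estimate uniform in them is needed.\<close>

lemma bedford_taylor_chain:
  fixes T :: "'n::finite form \<Rightarrow> complex" and H :: "(complex ^ 'n \<Rightarrow> complex) set"
  assumes bt: "bedford_taylor D u k T"
    and D: "open D" and u: "continuous_on D u" and K: "compact K" "K \<subseteq> D"
    and H: "\<And>h. h \<in> H \<Longrightarrow> smooth h"
    and approx: "\<And>\<gamma>. \<gamma> > 0 \<Longrightarrow> \<exists>h\<in>H. \<forall>x\<in>K. norm (h x - of_real (u x)) \<le> \<gamma>"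
    and c: "smooth_form (2 * (CARD('n) - k)) c"
    and K0: "compact K0" "K0 \<subseteq> D" "\<And>x ws. x \<notin> K0 \<Longrightarrow> c x ws = 0"
    and ddf: "\<And>x ws. x \<notin> K \<Longrightarrow> ddf c x ws = 0"
    and small: "norm (T (altform (2 * (CARD('n) - k)) c)) < \<eta>"
  shows "\<exists>hs. length hs = k \<and> set hs \<subseteq> H \<and>
    norm (LINT x|lborel. altform (2 * CARD('n)) (fold dd_step hs c) x oriented_basis) < \<eta>"
  using bt c K0 ddf small
proof (induction arbitrary: c K0 rule: bedford_taylor.induct)
  case zero
  then show ?case by (intro exI[of _ "[]"]) (simp add: integration_current_def)
next
  case (Suc k T S)
  let ?m = "2 * (CARD('n) - Suc k)"
  have m: "2 * (CARD('n) - k) = Suc (Suc ?m)" using Suc.hyps(2) by simp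
  define G where "G = altform (Suc (Suc ?m)) (\<lambda>x ws. 2 * \<i> * ddf c x ws)"
  have sG: "smooth_form (Suc (Suc ?m)) (\<lambda>x ws. 2 * \<i> * ddf c x ws)"
    by (intro smooth_form_mult smooth_const smooth_form_ddf Suc.prems(1))
  have SG: "S (altform ?m c) = T (\<lambda>x vs. complex_of_real (u x) * G x vs)"
  proof -
    have "test_form D ?m (altform ?m c)"
      by (rule test_form_altform[OF Suc.prems(1-3)]) (rule Suc.prems(4))
    from Suc.hyps(4)[OF this] show ?thesis
      by (simp only: ddc_altform[OF Suc.prems(1)] G_def)
  qed
  have T: "order_zero_current D (Suc (Suc ?m)) T"
    using bedford_taylor_order_zero[OF Suc.hyps(1)] m by simp
  have G0: "G x vs = 0" if "x \<notin> K" for x vs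
  proof -
    have "G x vs = altform (Suc (Suc ?m)) (\<lambda>x ws. 0) x vs"
      unfolding G_def by (rule altform_cong) (simp add: Suc.prems(5) that)
    then show ?thesis by (simp add: altform_def alt_zero)
  qed
  have tG: "test_form D (Suc (Suc ?m)) G"
    unfolding G_def by (rule test_form_altform[OF sG K]) (simp add: Suc.prems(5))
  have fG: "is_form (Suc (Suc ?m)) G" and cG: "continuous_on UNIV (\<lambda>x. G x vs)" for vs
  proof -
    show "is_form (Suc (Suc ?m)) G" using tG unfolding test_form_def by blast
    have "Ck 0 (\<lambda>x. G x vs)" using tG unfolding test_form_def by blast
    then show "continuous_on UNIV (\<lambda>x. G x vs)" by simp
  qed
  have "\<exists>M. \<forall>x. norm (G x vs) \<le> M" for vs
  proof -
    have "continuous_on K (\<lambda>x. G x vs)"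
      by (rule continuous_on_subset[OF cG]) simp
    from bounded_compact_support[OF this K(1)] show ?thesis using G0 by blast
  qed
  then obtain M where M: "M \<ge> 0" "\<And>x vs. (\<forall>v\<in>set vs. norm v \<le> 1) \<Longrightarrow> norm (G x vs) \<le> M"
    using form_bounded[OF fG] by blast
  obtain C where C: "\<And>\<omega> B. continuous_test_form D (Suc (Suc ?m)) \<omega> \<Longrightarrow> form_support \<omega> \<subseteq> K \<Longrightarrow>
      (\<And>x vs. (\<forall>v\<in>set vs. norm v \<le> 1) \<Longrightarrow> norm (\<omega> x vs) \<le> B) \<Longrightarrow> norm (T \<omega>) \<le> C * B"
    using T K unfolding order_zero_current_def by meson
  \<comment> \<open>\<open>gap\<close> is what the strict inequality leaves to spend on this
    replacement of \<open>u\<close>; \<open>\<gamma>\<close> is so small that the order zero bound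
    \<open>C * (\<gamma> * M)\<close> stays below it.\<close>
  define gap where "gap = \<eta> - norm (S (altform ?m c))"
  have gap: "gap > 0" using Suc.prems(6) by (simp add: gap_def)
  define \<gamma> where "\<gamma> = gap / (2 * (\<bar>C\<bar> * M + 1))"
  have CM: "\<bar>C\<bar> * M \<ge> 0" using M(1) by simp
  have CM1: "\<bar>C\<bar> * M + 1 > 0" using CM by (rule add_nonneg_pos) simp
  have \<gamma>: "\<gamma> > 0" unfolding \<gamma>_def using gap CM1 by (intro divide_pos_pos mult_pos_pos) simp_all
  obtain h where h: "h \<in> H" "\<And>x. x \<in> K \<Longrightarrow> norm (h x - of_real (u x)) \<le> \<gamma>"
    using approx[OF \<gamma>] by blast
  have sh: "smooth h" by (rule H[OF h(1)])
  have uc: "continuous_on D (\<lambda>x. complex_of_real (u x))"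
    by (intro continuous_intros u)
  have ct: "continuous_test_form D (Suc (Suc ?m)) (\<lambda>x vs. f x * G x vs)" if "continuous_on D f" for f
    by (rule continuous_test_form_mult[OF that D fG cG K]) (rule G0)
  let ?r = "\<lambda>x vs. (h x - of_real (u x)) * G x vs"
  have "norm (T ?r) \<le> C * (\<gamma> * M)"
  proof (rule C)
    show "continuous_test_form D (Suc (Suc ?m)) ?r"
      by (rule ct) (intro continuous_intros uc smooth_continuous_on[OF sh])
    show "form_support ?r \<subseteq> K"
      by (rule form_support_subset) (use K compact_imp_closed G0 in auto)
    show "norm (?r x vs) \<le> \<gamma> * M" if "\<forall>v\<in>set vs. norm v \<le> 1" for x vs
    proof (cases "x \<in> K")
      case True
      then show ?thesis unfolding norm_mult using h(2) M that \<gamma> by (intro mult_mono) auto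
    qed (use G0 M \<gamma> in simp)
  qed
  also have "\<dots> \<le> \<gamma> * (\<bar>C\<bar> * M)"
    using \<gamma> M(1) by (simp add: mult.left_commute mult_left_mono mult_right_mono)
  also have "\<dots> < gap"
  proof -
    have "\<gamma> * (2 * (\<bar>C\<bar> * M + 1)) = gap" unfolding \<gamma>_def using CM1 by simp
    moreover have "\<gamma> * (\<bar>C\<bar> * M) \<ge> 0" using CM \<gamma> by simp
    ultimately show ?thesis using \<gamma> by (simp add: algebra_simps)
  qed
  finally have r: "norm (T ?r) < gap" .
  have e: "altform (Suc (Suc ?m)) (dd_step h c) = (\<lambda>x vs. of_real (u x) * G x vs + ?r x vs)"
    unfolding dd_step_def G_def
    by (intro ext) (simp only: altform_cmult, simp add: algebra_simps)
  have "T (altform (Suc (Suc ?m)) (dd_step h c)) = S (altform ?m c) + T ?r"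
    unfolding e SG
    using T ct[OF uc] ct[of "\<lambda>x. h x - of_real (u x)"] smooth_continuous_on[OF sh] uc
    unfolding order_zero_current_def by (simp add: continuous_on_diff)
  then have small: "norm (T (altform (2 * (CARD('n) - k)) (dd_step h c))) < \<eta>"
    using r norm_triangle_ineq[of "S (altform ?m c)" "T ?r"] by (simp add: m gap_def)
  have v: "dd_step h c x ws = 0" if "x \<notin> K" for x ws
    using Suc.prems(5)[OF that] by (simp add: dd_step_def)
  have "\<exists>hs. length hs = k \<and> set hs \<subseteq> H \<and>
    norm (LINT x|lborel. altform (2 * CARD('n)) (fold dd_step hs (dd_step h c)) x oriented_basis) < \<eta>"
  proof (rule Suc.IH[OF _ K v _ small])
    show "smooth_form (2 * (CARD('n) - k)) (dd_step h c)"
      using smooth_form_dd_step[OF sh Suc.prems(1)] m by simp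
    \<comment> \<open>The new form vanishes on the open set \<open>- K\<close>, hence so do its
      derivatives; the same \<open>K\<close> therefore serves for all steps.\<close>
    show "ddf (dd_step h c) x ws = 0" if "x \<notin> K" for x ws
      by (rule ddf_eq_0_open[of "- K"]) (use K compact_imp_closed v that in auto)
  qed auto
  then obtain hs where "length hs = k" "set hs \<subseteq> H"
    "norm (LINT x|lborel. altform (2 * CARD('n)) (fold dd_step hs (dd_step h c)) x oriented_basis) < \<eta>"
    by blast
  then show ?case using h(1) by (intro exI[of _ "h # hs"]) simp
qed

section \<open>Integration by parts\<close>

lemma integral_lborel_translation:
  fixes f :: "'a::euclidean_space \<Rightarrow> 'b::{banach, second_countable_topology}"
  assumes "continuous_on UNIV f"
  shows "(LINT x|lborel. f (x + a)) = (LINT x|lborel. f x)"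
proof -
  have "f \<in> borel_measurable lborel"
    using borel_measurable_continuous_onI[OF assms] by simp
  then have "(LINT x|distr lborel borel ((+) a). f x) = (LINT x|lborel. f (a + x))"
    by (intro integral_distr) auto
  then show ?thesis by (simp add: lborel_distr_plus add.commute)
qed

lemma frechet_derivative_eq_0_open:
  assumes "open S" "x \<in> S" "\<And>y. y \<in> S \<Longrightarrow> f y = 0"
  shows "frechet_derivative f (at x) = (\<lambda>v. 0)"
proof -
  have "(f has_derivative (\<lambda>v. 0)) (at x)"
    by (rule has_derivative_transform_within_open[of "\<lambda>_. 0" _ _ _ S]) (use assms in auto)
  then show ?thesis by (rule frechet_derivative_eqI)
qed

text \<open>Difference quotients have integral zero by translation invariance, and a Lipschitz bound
  lets them converge dominatedly to the derivative.\<close>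

lemma integral_frechet_derivative_eq_0:
  fixes f :: "'a::euclidean_space \<Rightarrow> 'b::euclidean_space"
  assumes f: "smooth f" and K: "compact K" "\<And>x. x \<notin> K \<Longrightarrow> f x = 0"
  shows "(LINT x|lborel. frechet_derivative f (at x) v) = 0"
proof -
  let ?D = "\<lambda>x. frechet_derivative f (at x)"
  have oK: "open (- K)" using compact_imp_closed[OF K(1)] by blast
  have D0: "?D x v = 0" if "x \<notin> K" for x
    using frechet_derivative_eq_0_open[OF oK, of x f] that K(2) by auto
  have Dc: "continuous_on S (\<lambda>x. ?D x v)" for S
    by (intro smooth_continuous_on smooth_frechet_derivative f)
  have fc: "continuous_on S f" for S by (rule smooth_continuous_on[OF f])
  obtain B where B: "\<And>x. norm (?D x v) \<le> B"
    using bounded_compact_support[OF Dc K(1) D0] by blast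
  obtain R where R: "\<And>x. x \<in> K \<Longrightarrow> norm x \<le> R"
    using compact_imp_bounded[OF K(1)] unfolding bounded_iff by blast
  \<comment> \<open>The increments \<open>t m\<close> are at most 1, so all difference quotients
    vanish outside this ball.\<close>
  let ?L = "cball (0::'a) (R + norm v)"
  have lip: "norm (f (x + t *\<^sub>R v) - f x) \<le> B * t" if "t \<ge> 0" for x t
  proof -
    have "norm (f (x + t *\<^sub>R v) - f (x + 0 *\<^sub>R v)) \<le> B * norm (t - 0)"
    proof (rule differentiable_bound[where S=UNIV and f="\<lambda>s. f (x + s *\<^sub>R v)" and f'="\<lambda>s h. ?D (x + s *\<^sub>R v) (h *\<^sub>R v)"])
      fix s :: real
      have "((\<lambda>s. x + s *\<^sub>R v) has_derivative (\<lambda>h. h *\<^sub>R v)) (at s)"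
        by (auto intro!: derivative_eq_intros)
      then have "((\<lambda>s. f (x + s *\<^sub>R v)) has_derivative (\<lambda>h. ?D (x + s *\<^sub>R v) (h *\<^sub>R v))) (at s)"
        using diff_chain_at[of "\<lambda>s. x + s *\<^sub>R v" "\<lambda>h. h *\<^sub>R v" s f] smooth_has_derivative[OF f]
        by (auto simp: o_def)
      then show "((\<lambda>s. f (x + s *\<^sub>R v)) has_derivative (\<lambda>h. ?D (x + s *\<^sub>R v) (h *\<^sub>R v))) (at s within UNIV)"
        by simp
      have "linear (?D (x + s *\<^sub>R v))"
        by (intro linear_frechet_derivative smooth_differentiable f)
      then have "norm (?D (x + s *\<^sub>R v) (h *\<^sub>R v)) \<le> B * norm h" for h
        using mult_right_mono[OF B[of "x + s *\<^sub>R v"], of "\<bar>h\<bar>"] by (simp add: linear_cmul mult.commute)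
      then show "onorm (\<lambda>h. ?D (x + s *\<^sub>R v) (h *\<^sub>R v)) \<le> B"
        by (rule onorm_le)
    qed auto
    then show ?thesis using that by simp
  qed
  define t where "t = (\<lambda>m. 1 / real (Suc m))"
  define g where "g = (\<lambda>m x. (1 / t m) *\<^sub>R (f (x + t m *\<^sub>R v) - f x))"
  have t: "0 < t m" "t m \<le> 1" for m by (auto simp: t_def)
  have tn: "t m \<noteq> 0" for m using t(1)[of m] by simp
  have t0: "t \<longlonglongrightarrow> 0" unfolding t_def by (rule LIMSEQ_Suc[OF lim_1_over_n])
  have fi: "integrable lborel f"
    by (rule integrable_continuous_compact_support[OF fc K])
  have fsi: "integrable lborel (\<lambda>x. f (x + a))" for a
  proof (rule integrable_continuous_compact_support)
    show "continuous_on UNIV (\<lambda>x. f (x + a))"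
      by (intro continuous_on_compose2[OF fc] continuous_intros) auto
    show "compact ((\<lambda>x. x - a) ` K)"
      by (intro compact_continuous_image continuous_intros K)
    show "f (x + a) = 0" if "x \<notin> (\<lambda>x. x - a) ` K" for x
      using K(2) that by (metis add_diff_cancel_right' image_eqI)
  qed
  have g0: "(LINT x|lborel. g m x) = 0" for m
    unfolding g_def using integral_lborel_translation[OF fc] fi fsi by simp
  have "(\<lambda>m. LINT x|lborel. g m x) \<longlonglongrightarrow> (LINT x|lborel. ?D x v)"
  proof (rule integral_dominated_convergence[where w="\<lambda>x. B * indicator ?L x"])
    show "(\<lambda>x. ?D x v) \<in> borel_measurable lborel"
      using borel_measurable_continuous_onI[OF Dc] by simp
    show "g m \<in> borel_measurable lborel" for m
      unfolding g_def using fi fsi by (intro borel_measurable_integrable) auto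
    show "integrable lborel (\<lambda>x. B * indicator ?L x)"
      using emeasure_compact_finite[of ?L]
      by (intro integrable_mult_right integrable_real_indicator) auto
    show "AE x in lborel. (\<lambda>m. g m x) \<longlonglongrightarrow> ?D x v"
    proof (rule AE_I2)
      fix x
      have "((\<lambda>s. x + s *\<^sub>R v) has_derivative (\<lambda>h. h *\<^sub>R v)) (at 0)"
        by (auto intro!: derivative_eq_intros)
      then have "((\<lambda>s. f (x + s *\<^sub>R v)) has_derivative (\<lambda>h. ?D x (h *\<^sub>R v))) (at 0)"
        using diff_chain_at[of "\<lambda>s. x + s *\<^sub>R v" "\<lambda>h. h *\<^sub>R v" 0 f] smooth_has_derivative[OF f]
        by (auto simp: o_def)
      then have L: "((\<lambda>s. norm (f (x + s *\<^sub>R v) - f x - ?D x (s *\<^sub>R v)) / norm s) \<longlongrightarrow> 0) (at 0)"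
        by (simp add: has_derivative_at)
      have E: "norm (f (x + s *\<^sub>R v) - f x - ?D x (s *\<^sub>R v)) / norm s =
          norm ((1 / s) *\<^sub>R (f (x + s *\<^sub>R v) - f x) - ?D x v)" if "s \<noteq> 0" for s
      proof -
        have "linear (?D x)"
          by (intro linear_frechet_derivative smooth_differentiable f)
        then have "(1 / s) *\<^sub>R (f (x + s *\<^sub>R v) - f x) - ?D x v =
            (1 / s) *\<^sub>R (f (x + s *\<^sub>R v) - f x - ?D x (s *\<^sub>R v))"
          using that by (simp add: linear_cmul scaleR_diff_right)
        then show ?thesis by simp
      qed
      have "((\<lambda>s. norm ((1 / s) *\<^sub>R (f (x + s *\<^sub>R v) - f x) - ?D x v)) \<longlongrightarrow> 0) (at 0)"
      proof (rule Lim_transform_eventually[OF L])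
        have "eventually (\<lambda>s::real. s \<noteq> 0) (at 0)" by (simp add: eventually_at_filter)
        then show "eventually (\<lambda>s. norm (f (x + s *\<^sub>R v) - f x - ?D x (s *\<^sub>R v)) / norm s =
            norm ((1 / s) *\<^sub>R (f (x + s *\<^sub>R v) - f x) - ?D x v)) (at 0)"
          by (rule eventually_mono) (rule E)
      qed
      then have "((\<lambda>s. (1 / s) *\<^sub>R (f (x + s *\<^sub>R v) - f x)) \<longlongrightarrow> ?D x v) (at 0)"
        by (rule LIM_zero_cancel[OF tendsto_norm_zero_cancel])
      then show "(\<lambda>m. g m x) \<longlonglongrightarrow> ?D x v"
        unfolding g_def
        by (rule filterlim_compose[OF _ filterlim_atI[OF t0]]) (simp add: tn)
    qed
    show "AE x in lborel. norm (g m x) \<le> B * indicator ?L x" for m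
    proof (rule AE_I2)
      fix x
      show "norm (g m x) \<le> B * indicator ?L x"
      proof (cases "x \<in> ?L")
        case True
        then show ?thesis
          using lip[of "t m" x] t[of m] by (simp add: g_def divide_le_eq)
      next
        case False
        have "x \<notin> K" using False R[of x] norm_ge_zero[of v] by force
        moreover have "x + t m *\<^sub>R v \<notin> K"
        proof
          assume "x + t m *\<^sub>R v \<in> K"
          then have "norm (x + t m *\<^sub>R v) \<le> R" by (rule R)
          moreover have "norm x \<le> norm (x + t m *\<^sub>R v) + norm (t m *\<^sub>R v)"
            using norm_triangle_ineq4[of "x + t m *\<^sub>R v" "t m *\<^sub>R v"] by simp
          moreover have "norm (t m *\<^sub>R v) \<le> norm v"
            using t[of m] mult_right_mono[of "t m" 1 "norm v"] by simp
          ultimately show False using False by simp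
        qed
        ultimately show ?thesis using K(2) False by (simp add: g_def)
      qed
    qed
  qed
  then show ?thesis
    using LIMSEQ_unique[OF _ tendsto_const[of 0]] by (simp add: g0)
qed

lemma integrable_mult_compact_support:
  fixes f g :: "'a::euclidean_space \<Rightarrow> complex"
  assumes "smooth f" "smooth g" "compact K" "\<And>x. x \<notin> K \<Longrightarrow> g x = 0"
  shows "integrable lborel (\<lambda>x. f x * g x)"
proof (rule integrable_continuous_compact_support[OF _ assms(3)])
  show "continuous_on UNIV (\<lambda>x. f x * g x)"
    by (intro continuous_on_mult smooth_continuous_on assms)
qed (simp add: assms(4))

lemma wd_eq_0_outside:
  assumes "compact K" "\<And>x. x \<notin> K \<Longrightarrow> g x = 0" "x \<notin> K"
  shows "wd k g x v = 0"
proof -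
  have "open (- K)" using compact_imp_closed[OF assms(1)] by blast
  from frechet_derivative_eq_0_open[OF this, of x g] show ?thesis
    using assms(2,3) by (simp add: wd_def)
qed

lemma integral_wd_by_parts:
  assumes f: "smooth f" and g: "smooth g" and K: "compact K" "\<And>x. x \<notin> K \<Longrightarrow> g x = 0"
  shows "(LINT x|lborel. f x * wd k g x v) = - (LINT x|lborel. wd k f x v * g x)"
proof -
  let ?p = "\<lambda>x. f x * g x"
  have p: "smooth ?p" by (intro smooth_mult f g)
  have p0: "?p x = 0" if "x \<notin> K" for x using K(2)[OF that] by simp
  have i: "integrable lborel (\<lambda>x. frechet_derivative ?p (at x) w)" for w
  proof (rule integrable_continuous_compact_support[OF _ K(1)])
    show "continuous_on UNIV (\<lambda>x. frechet_derivative ?p (at x) w)"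
      by (intro smooth_continuous_on smooth_frechet_derivative p)
    show "frechet_derivative ?p (at x) w = 0" if "x \<notin> K" for x
    proof -
      have "open (- K)" using compact_imp_closed[OF K(1)] by blast
      from frechet_derivative_eq_0_open[OF this, of x ?p] show ?thesis
        using p0 that by auto
    qed
  qed
  have "(LINT x|lborel. wd k ?p x v) = 0"
    unfolding wd_def
    using integral_frechet_derivative_eq_0[OF p K(1) p0] i by simp
  moreover have "(LINT x|lborel. wd k ?p x v) =
     (LINT x|lborel. f x * wd k g x v) + (LINT x|lborel. wd k f x v * g x)"
  proof -
    have "integrable lborel (\<lambda>x. f x * wd k g x v)"
      by (rule integrable_mult_compact_support[OF f smooth_wd[OF g] K(1)])
        (rule wd_eq_0_outside[OF K])
    moreover have "integrable lborel (\<lambda>x. wd k f x v * g x)"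
      by (rule integrable_mult_compact_support[OF smooth_wd[OF f] g K])
    ultimately show ?thesis by (simp add: wd_mult[OF f g])
  qed
  ultimately show ?thesis by (simp add: eq_neg_iff_add_eq_0)
qed

text \<open>Two integrations by parts cost two signs, which cancel.\<close>

lemma integral_levi_by_parts:
  assumes h: "smooth h" and g: "smooth g" and K: "compact K" "\<And>x. x \<notin> K \<Longrightarrow> g x = 0"
  shows "(LINT x|lborel. h x * levi g x a b) = (LINT x|lborel. g x * levi h x a b)"
proof -
  have "(LINT x|lborel. h x * levi g x a b) = - (LINT x|lborel. wd (- \<i>) h x a * wd \<i> g x b)"
    unfolding levi_def
    by (rule integral_wd_by_parts[OF h smooth_wd[OF g] K(1)]) (rule wd_eq_0_outside[OF K])
  also have "\<dots> = (LINT x|lborel. wd \<i> (\<lambda>y. wd (- \<i>) h y a) x b * g x)"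
    using integral_wd_by_parts[OF smooth_wd[OF h] g K] by simp
  also have "\<dots> = (LINT x|lborel. g x * levi h x a b)"
    unfolding levi_def wd_commute[OF h, of "- \<i>"] by (simp add: mult.commute)
  finally show ?thesis .
qed

lemma alt_Suc_Suc:
  "alt (Suc (Suc m)) c vs = (\<Sum>i<length vs. (- 1) ^ i *
     (\<Sum>j<length (take i vs @ drop (Suc i) vs). (- 1) ^ j *
       alt m (\<lambda>ws. c (vs ! i # (take i vs @ drop (Suc i) vs) ! j # ws))
         (take j (take i vs @ drop (Suc i) vs) @ drop (Suc j) (take i vs @ drop (Suc i) vs))))"
  by (simp only: alt.simps(2))

text \<open>Expanding the alternation over its first two arguments turns everything else, including
  \<open>\<phi>\<close>, into one scalar function of compact support, so Stokes reduces to
  \<open>integral_levi_by_parts\<close> for each term.\<close>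

lemma integral_alt_ddf:
  assumes h: "smooth h" and \<phi>: "smooth \<phi>" and K: "compact K" "\<And>x. x \<notin> K \<Longrightarrow> \<phi> x = 0"
    and c: "smooth_form m c"
  shows "(LINT x|lborel. h x * alt (Suc (Suc m)) (ddf (\<lambda>x ws. \<phi> x * c x ws) x) vs) =
    (LINT x|lborel. \<phi> x * alt (Suc (Suc m)) (\<lambda>ws. levi h x (ws ! 0) (ws ! 1) * c x (drop 2 ws)) vs)"
proof -
  have s: "smooth (\<lambda>x. c x ws)" for ws using c by (simp add: smooth_form_def)
  have sa: "smooth (\<lambda>x. alt m (c x) us)" for us by (rule smooth_alt[OF s])
  define g where "g = (\<lambda>us x. \<phi> x * alt m (c x) us)"
  have g: "smooth (g us)" for us unfolding g_def by (intro smooth_mult \<phi> sa)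
  have g0: "g us x = 0" if "x \<notin> K" for us x using K(2)[OF that] by (simp add: g_def)
  have 1: "alt m (\<lambda>ws. ddf (\<lambda>x ws. \<phi> x * c x ws) x (a # b # ws)) us = levi (g us) x a b" for a b us x
  proof -
    have sp: "smooth (\<lambda>x. \<phi> x * c x ws)" for ws by (intro smooth_mult \<phi> s)
    have "(\<lambda>y. wd \<i> (g us) y b) = (\<lambda>y. alt m (\<lambda>ws. wd \<i> (\<lambda>z. \<phi> z * c z ws) y b) us)"
      unfolding g_def alt_cmult[symmetric] by (rule ext) (rule wd_alt[OF sp])
    then have "levi (g us) x a b = wd (- \<i>) (\<lambda>y. alt m (\<lambda>ws. wd \<i> (\<lambda>z. \<phi> z * c z ws) y b) us) x a"
      unfolding levi_def by (simp only:)
    also have "\<dots> = alt m (\<lambda>ws. wd (- \<i>) (\<lambda>y. wd \<i> (\<lambda>z. \<phi> z * c z ws) y b) x a) us"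
      by (rule wd_alt[OF smooth_wd[OF sp]])
    finally show ?thesis by (simp add: ddf_def wdf_def)
  qed
  have 2: "alt m (\<lambda>ws. levi h x ((a # b # ws) ! 0) ((a # b # ws) ! 1) * c x (drop 2 (a # b # ws))) us =
      levi h x a b * alt m (c x) us" for a b us x
    by (simp add: alt_cmult)
  have i1: "integrable lborel (\<lambda>x. h x * levi (g us) x a b)" for us a b
    by (rule integrable_mult_compact_support[OF h smooth_levi[OF g] K(1)])
      (unfold levi_def, intro wd_eq_0_outside[OF K(1)] g0)
  have i2: "integrable lborel (\<lambda>x. g us x * levi h x a b)" for us a b
    using integrable_mult_compact_support[OF smooth_levi[OF h] g K(1) g0] by (simp add: mult.commute)
  define rm where "rm = (\<lambda>i (ws :: (complex ^ 'a) list). take i ws @ drop (Suc i) ws)"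
  have "(LINT x|lborel. h x * alt (Suc (Suc m)) (ddf (\<lambda>x ws. \<phi> x * c x ws) x) vs) =
     (LINT x|lborel. (\<Sum>i<length vs. \<Sum>j<length (rm i vs). (- 1) ^ i * (- 1) ^ j *
         (h x * levi (g (rm j (rm i vs))) x (vs ! i) (rm i vs ! j))))"
    unfolding alt_Suc_Suc 1 by (simp add: rm_def sum_distrib_left mult_ac)
  also have "\<dots> = (\<Sum>i<length vs. \<Sum>j<length (rm i vs). (- 1) ^ i * (- 1) ^ j *
         (LINT x|lborel. h x * levi (g (rm j (rm i vs))) x (vs ! i) (rm i vs ! j)))"
    by (simp add: Bochner_Integration.integral_sum i1)
  also have "\<dots> = (\<Sum>i<length vs. \<Sum>j<length (rm i vs). (- 1) ^ i * (- 1) ^ j *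
         (LINT x|lborel. g (rm j (rm i vs)) x * levi h x (vs ! i) (rm i vs ! j)))"
  proof -
    have "(LINT x|lborel. h x * levi (g us) x a b) = (LINT x|lborel. g us x * levi h x a b)" for us a b
      by (rule integral_levi_by_parts[OF h g K(1)]) (rule g0)
    then show ?thesis by (simp only:)
  qed
  also have "\<dots> = (LINT x|lborel. (\<Sum>i<length vs. \<Sum>j<length (rm i vs). (- 1) ^ i * (- 1) ^ j *
         (g (rm j (rm i vs)) x * levi h x (vs ! i) (rm i vs ! j))))"
    by (simp add: Bochner_Integration.integral_sum i2)
  also have "\<dots> = (LINT x|lborel. \<phi> x * alt (Suc (Suc m)) (\<lambda>ws. levi h x (ws ! 0) (ws ! 1) * c x (drop 2 ws)) vs)"
    unfolding alt_Suc_Suc 2 by (simp add: rm_def g_def sum_distrib_left mult_ac)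
  finally show ?thesis .
qed


lemma hermitian_nonneg_leviI:
  assumes h: "smooth h" and real: "\<And>x. cnj (h x) = h x" and nn: "\<And>v. Re (levi h x v v) \<ge> 0"
  shows "hermitian_nonneg (levi h x)"
  unfolding hermitian_nonneg_def
proof (intro conjI allI)
  show "sesquilinear (levi h x)" by (rule sesquilinear_levi[OF h])
  show "0 \<le> Re (levi h x v v)" for v by (rule nn)
  fix v w
  have "cnj (levi h x v w) = wd \<i> (\<lambda>y. cnj (wd \<i> h y w)) x v"
    unfolding levi_def using wd_cnj[OF smooth_wd[OF h], of "- \<i>"] by simp
  also have "(\<lambda>y. cnj (wd \<i> h y w)) = (\<lambda>y. wd (- \<i>) h y w)"
    using wd_cnj[OF h, of \<i>] by (simp add: real)
  also have "wd \<i> (\<lambda>y. wd (- \<i>) h y w) x v = levi h x w v"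
    unfolding levi_def by (rule wd_commute[OF h])
  finally show "levi h x w v = cnj (levi h x v w)" by simp
qed

text \<open>\<open>fold\<close> puts the first entry of \<open>hs\<close> next to
  \<open>\<phi>\<close>, so the last entry is outermost, hence the reversals. The factor of
  \<open>\<phi>\<close> is rotated to the front and rewritten as \<open>ddf\<close> of
  \<open>\<phi>\<close> times the closed rest, from which both derivatives are moved onto the
  outermost function.\<close>

lemma integral_dd_chain:
  fixes \<phi> :: "complex ^ 'n::finite \<Rightarrow> complex"
  assumes hs: "length hs = CARD('n)" "\<And>h. h \<in> set hs \<Longrightarrow> smooth h"
    and \<phi>: "smooth \<phi>" and K: "compact K" "\<And>x. x \<notin> K \<Longrightarrow> \<phi> x = 0"
    and es: "length es = CARD('n)"
  shows "(LINT x|lborel. altform (2 * CARD('n)) (fold dd_step hs (\<lambda>x ws. \<phi> x)) x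
       (concat (map (\<lambda>e. [e, \<i> *s e]) es))) =
    (LINT x|lborel. \<phi> x * (4 ^ CARD('n) * mixed_disc (map (\<lambda>h. levi h x) (rev hs)) es es))"
proof -
  let ?b = "concat (map (\<lambda>e. [e, \<i> *s e]) es)"
  have "rev hs \<noteq> []" using hs(1) by auto
  then obtain h gs where r: "rev hs = h # gs" by (cases "rev hs") auto
  have "set (rev hs) = set hs" by simp
  then have sh: "smooth h" and sg: "\<And>g. g \<in> set gs \<Longrightarrow> smooth g"
    using hs(2) r by auto
  have n: "CARD('n) = Suc (length gs)"
    using hs(1) r by (metis length_Cons length_rev)
  let ?m = "2 * length gs"
  have lb: "length ?b = Suc (Suc ?m)"
  proof -
    have "length (concat (map (\<lambda>e. [e, \<i> *s e]) es)) = 2 * length es" for es :: "(complex ^ 'n) list"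
      by (induction es) auto
    then show ?thesis using es n by simp
  qed
  let ?C = "(2 * \<i>) ^ Suc (length gs) :: complex"
  have e1: "altform (2 * CARD('n)) (fold dd_step hs (\<lambda>x ws. \<phi> x)) x ?b =
      ?C * (h x * alt (Suc (Suc ?m)) (ddf (\<lambda>x ws. \<phi> x * levi_prod gs x ws) x) ?b)" for x
  proof -
    have "fold dd_step hs (\<lambda>x ws. \<phi> x) = foldr dd_step (h # gs) (\<lambda>x ws. \<phi> x)"
      by (simp only: r[symmetric] foldr_conv_fold rev_rev_ident)
    then have "altform (2 * CARD('n)) (fold dd_step hs (\<lambda>x ws. \<phi> x)) x ?b =
        altform (Suc (Suc ?m)) (\<lambda>x ws. h x * ?C * levi_prod (gs @ [\<phi>]) x ws) x ?b"
      using altform_foldr_dd_step[OF \<phi> sh sg] n by simp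
    also have "\<dots> = h x * ?C * altform (Suc (Suc ?m)) (levi_prod (gs @ [\<phi>])) x ?b"
      by (rule altform_cmult)
    also have "altform (Suc (Suc ?m)) (levi_prod (gs @ [\<phi>])) x ?b = altform (Suc (Suc ?m)) (levi_prod (\<phi> # gs)) x ?b"
      using alt_hprod_rotate[of "map (\<lambda>h. levi h x) gs" "levi \<phi> x" ?b]
      by (simp add: altform_def levi_prod_def[abs_def] del: hprod.simps)
    also have "\<dots> = altform (Suc (Suc ?m)) (ddf (\<lambda>x ws. \<phi> x * levi_prod gs x ws)) x ?b"
      using altform_ddf_levi_prod[OF sg \<phi>] by simp
    finally show ?thesis using lb by (simp add: altform_def)
  qed
  have e2: "\<phi> x * alt (Suc (Suc ?m)) (\<lambda>ws. levi h x (ws ! 0) (ws ! 1) * levi_prod gs x (drop 2 ws)) ?b * ?C =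
      \<phi> x * (4 ^ CARD('n) * mixed_disc (map (\<lambda>h. levi h x) (rev hs)) es es)" for x
  proof -
    let ?H = "map (\<lambda>h. levi h x) (h # gs)"
    have "?C * alt (2 * length ?H) (hprod ?H) ?b = 4 ^ length ?H * mixed_disc ?H es es"
      using alt_hprod_basis[of ?H es] sesquilinear_levi sh sg es n by auto
    moreover have "(\<lambda>ws. levi h x (ws ! 0) (ws ! 1) * levi_prod gs x (drop 2 ws)) = hprod ?H"
      by (simp add: fun_eq_iff levi_prod_def)
    ultimately show ?thesis by (simp add: r n mult_ac del: hprod.simps mixed_disc.simps power_Suc)
  qed
  have "(LINT x|lborel. altform (2 * CARD('n)) (fold dd_step hs (\<lambda>x ws. \<phi> x)) x ?b) =
      (LINT x|lborel. h x * alt (Suc (Suc ?m)) (ddf (\<lambda>x ws. \<phi> x * levi_prod gs x ws) x) ?b) * ?C"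
    unfolding e1 by simp
  also have "\<dots> = (LINT x|lborel. \<phi> x * alt (Suc (Suc ?m))
      (\<lambda>ws. levi h x (ws ! 0) (ws ! 1) * levi_prod gs x (drop 2 ws)) ?b) * ?C"
    using integral_alt_ddf[OF sh \<phi> K smooth_form_levi_prod[OF sg]] by simp
  also have "\<dots> = (LINT x|lborel. \<phi> x * alt (Suc (Suc ?m))
      (\<lambda>ws. levi h x (ws ! 0) (ws ! 1) * levi_prod gs x (drop 2 ws)) ?b * ?C)"
    by simp
  finally show ?thesis by (simp only: e2)
qed

text \<open>The real part of the integrand is at least the stated power of
  \<open>4 * \<delta>\<close> on \<open>N\<close>, nonnegative on \<open>K\<close> and zero
  elsewhere, so nothing can cancel.\<close>

lemma integral_dd_chain_lower_bound:
  fixes \<phi> :: "complex ^ 'n::finite \<Rightarrow> real"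
  assumes hs: "length hs = CARD('n)" "\<And>h. h \<in> set hs \<Longrightarrow> smooth h" "\<And>h x. h \<in> set hs \<Longrightarrow> cnj (h x) = h x"
    and \<phi>: "smooth (\<lambda>x. complex_of_real (\<phi> x))" "\<And>x. \<phi> x \<ge> 0"
    and K: "compact K" "\<And>x. x \<notin> K \<Longrightarrow> \<phi> x = 0"
    and psh: "\<And>h x v. h \<in> set hs \<Longrightarrow> x \<in> K \<Longrightarrow> Re (levi h x v v) \<ge> 0"
    and N: "compact N" "N \<subseteq> K" "\<And>x. x \<in> N \<Longrightarrow> \<phi> x = 1"
    and strict: "\<And>h x v. h \<in> set hs \<Longrightarrow> x \<in> N \<Longrightarrow> Re (levi h x v v) \<ge> \<delta> * (norm v)\<^sup>2"
    and \<delta>: "\<delta> \<ge> 0"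
  shows "norm (LINT x|lborel. altform (2 * CARD('n)) (fold dd_step hs (\<lambda>x ws. of_real (\<phi> x))) x oriented_basis)
    \<ge> (4 * \<delta>) ^ CARD('n) * measure lborel N"
proof -
  obtain js :: "'n list" where js: "distinct js" "length js = CARD('n)"
    "(oriented_basis :: (complex ^ 'n) list) = concat (map (\<lambda>e. [e, \<i> *s e]) (map (\<lambda>j. axis j 1) js))"
    using oriented_basis_eq by blast
  let ?es = "map (\<lambda>j. axis j 1) js :: (complex ^ 'n) list"
  let ?M = "\<lambda>x. mixed_disc (map (\<lambda>h. levi h x) (rev hs)) ?es ?es"
  let ?I = "LINT x|lborel. of_real (\<phi> x) * (4 ^ CARD('n) * ?M x)"
  have I: "(LINT x|lborel. altform (2 * CARD('n)) (fold dd_step hs (\<lambda>x ws. of_real (\<phi> x))) x oriented_basis) = ?I"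
    unfolding js(3) by (rule integral_dd_chain[OF hs(1,2) \<phi>(1) K(1)]) (use K(2) js(2) in auto)
  have sM: "smooth (\<lambda>x. mixed_disc (map (\<lambda>h. levi h x) gs) zs ws)"
    if "\<And>h. h \<in> set gs \<Longrightarrow> smooth h" for gs and zs ws :: "(complex ^ 'n) list"
    using that
    by (induction gs arbitrary: zs ws) (auto intro!: smooth_sum smooth_mult smooth_const smooth_levi)
  have sM: "smooth ?M" by (rule sM) (use hs(2) in auto)
  have int: "integrable lborel (\<lambda>x. of_real (\<phi> x) * (4 ^ CARD('n) * ?M x))"
    using integrable_mult_compact_support[OF smooth_mult[OF smooth_const sM] \<phi>(1) K(1), of "4 ^ CARD('n)"] K(2)
    by (simp add: mult.commute)
  have herm: "hermitian_nonneg H" if "H \<in> set (map (\<lambda>h. levi h x) (rev hs))" "x \<in> K" for H x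
    using that hs psh by (auto intro!: hermitian_nonneg_leviI)
  have "(4 * \<delta>) ^ CARD('n) * measure lborel N = (LINT x|lborel. (4 * \<delta>) ^ CARD('n) * indicator N x)"
    using N(1) by (simp add: borel_compact)
  also have "\<dots> \<le> (LINT x|lborel. Re (of_real (\<phi> x) * (4 ^ CARD('n) * ?M x)))"
  proof (rule integral_mono)
    show "integrable lborel (\<lambda>x. (4 * \<delta>) ^ CARD('n) * indicator N x)"
      using N(1) emeasure_compact_finite[of N]
      by (intro integrable_mult_right integrable_real_indicator) (auto simp: borel_compact)
    show "integrable lborel (\<lambda>x. Re (of_real (\<phi> x) * (4 ^ CARD('n) * ?M x)))"
      by (rule integrable_Re[OF int])
    fix x :: "complex ^ 'n"
    have R: "Re (of_real (\<phi> x) * (4 ^ CARD('n) * ?M x)) = \<phi> x * (4 ^ CARD('n) * Re (?M x))"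
    proof -
      have "(4 :: complex) ^ CARD('n) = of_real (4 ^ CARD('n))" by simp
      then show ?thesis by (simp only: Re_complex_of_real Im_complex_of_real times_complex.sel) simp
    qed
    have "Re (?M x) \<ge> 0" if "x \<in> K"
      by (rule mixed_disc_hermitian_nonneg) (rule herm[OF _ that])
    moreover have "Re (?M x) \<ge> \<delta> ^ CARD('n)" if "x \<in> N"
    proof -
      have "Re (?M x) \<ge> \<delta> ^ length (map (\<lambda>h. levi h x) (rev hs))"
        by (rule mixed_disc_lower_bound) (use herm[of _ x] strict js hs(1) \<delta> N that in auto)
      then show ?thesis using hs(1) by simp
    qed
    ultimately show "(4 * \<delta>) ^ CARD('n) * indicator N x \<le> Re (of_real (\<phi> x) * (4 ^ CARD('n) * ?M x))"
      unfolding R using \<phi>(2)[of x] N(2,3) K(2)[of x]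
      by (cases "x \<in> N"; cases "x \<in> K") (auto simp: power_mult_distrib)
  qed
  also have "\<dots> = Re ?I"
    by (rule integral_Re[OF int])
  also have "\<dots> \<le> norm ?I" by (rule complex_Re_le_cmod)
  finally show ?thesis unfolding I .
qed

section \<open>Mollifiers\<close>

text \<open>Polynomials in \<open>1 / t\<close> times \<open>exp (- (1 / t))\<close> form a family
  closed under differentiation, which makes smoothness of the classical flat function a single
  induction.\<close>

definition flat :: "real poly \<Rightarrow> real \<Rightarrow> real" where
  "flat q t = (if t > 0 then poly q (1 / t) * exp (- (1 / t)) else 0)"

lemma poly_times_exp_tendsto_0: "((\<lambda>s. poly q s * exp (- s)) \<longlongrightarrow> (0::real)) at_top"
proof -
  have "((\<lambda>s. \<Sum>i\<le>degree q. coeff q i * (s ^ i / exp s)) \<longlongrightarrow> (\<Sum>i\<le>degree q. coeff q i * 0)) at_top"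
    by (intro tendsto_sum tendsto_mult tendsto_const tendsto_power_div_exp_0)
  moreover have "(\<Sum>i\<le>degree q. coeff q i * (s ^ i / exp s)) = poly q s * exp (- s)" for s
    by (simp add: poly_altdef exp_minus sum_distrib_right divide_inverse mult.assoc)
  ultimately show ?thesis by simp
qed

lemma flat_tendsto_0: "(flat q \<longlongrightarrow> 0) (at 0)"
proof -
  have "((\<lambda>t. poly q (inverse t) * exp (- inverse t)) \<longlongrightarrow> 0) (at_right 0)"
    by (rule filterlim_compose[OF poly_times_exp_tendsto_0 filterlim_inverse_at_top_right])
  then have "(flat q \<longlongrightarrow> 0) (at_right 0)"
    by (rule Lim_transform_eventually)
      (auto simp: flat_def eventually_at_right_field inverse_eq_divide intro!: exI[of _ 1])
  moreover have "(flat q \<longlongrightarrow> 0) (at_left 0)"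
    by (rule Lim_transform_eventually[OF tendsto_const])
      (auto simp: flat_def eventually_at_left_field intro!: exI[of _ "-1"])
  ultimately show ?thesis by (simp add: filterlim_at_split)
qed

lemma flat_DERIV: "(flat q has_real_derivative flat (monom 1 2 * (q - pderiv q)) t) (at t)"
proof -
  consider "t > 0" | "t < 0" | "t = 0" by linarith
  then show ?thesis
  proof cases
    case 1
    have "((\<lambda>t. poly q (1 / t) * exp (- (1 / t))) has_real_derivative
        poly (pderiv q) (1 / t) * (- (1 / t\<^sup>2)) * exp (- (1 / t)) +
        exp (- (1 / t)) * (1 / t\<^sup>2) * poly q (1 / t)) (at t)"
      using 1 by (auto intro!: derivative_eq_intros DERIV_chain2[OF poly_DERIV] simp: power2_eq_square)
    moreover have "poly (pderiv q) (1 / t) * (- (1 / t\<^sup>2)) * exp (- (1 / t)) +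
        exp (- (1 / t)) * (1 / t\<^sup>2) * poly q (1 / t) = flat (monom 1 2 * (q - pderiv q)) t"
      using 1 by (simp add: flat_def poly_monom power_divide algebra_simps)
    ultimately have "((\<lambda>t. poly q (1 / t) * exp (- (1 / t))) has_real_derivative
        flat (monom 1 2 * (q - pderiv q)) t) (at t)" by simp
    then show ?thesis
      by (rule has_field_derivative_transform_within_open[where S="{0<..}"])
        (use 1 in \<open>auto simp: flat_def\<close>)
  next
    case 2
    have "((\<lambda>t. 0) has_real_derivative flat (monom 1 2 * (q - pderiv q)) t) (at t)"
      using 2 by (simp add: flat_def)
    then show ?thesis
      by (rule has_field_derivative_transform_within_open[where S="{..<0}"])
        (use 2 in \<open>auto simp: flat_def\<close>)
  next
    case 3
    \<comment> \<open>At 0 the difference quotient of \<open>flat q\<close> is again in the family,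
      with \<open>q\<close> multiplied by the variable.\<close>
    have "((\<lambda>h. flat (monom 1 1 * q) h) \<longlongrightarrow> 0) (at 0)" by (rule flat_tendsto_0)
    moreover have "flat (monom 1 1 * q) h = (flat q (0 + h) - flat q 0) / h" for h
      by (simp add: flat_def poly_monom)
    ultimately show ?thesis using 3 by (simp add: DERIV_def flat_def)
  qed
qed

lemma Ck_flat: "Ck k (flat q)"
proof (induction k arbitrary: q)
  case 0
  then show ?case
    using flat_DERIV by (auto intro!: continuous_at_imp_continuous_on DERIV_isCont)
next
  case (Suc k)
  have d: "(flat q has_derivative (\<lambda>v. v * flat (monom 1 2 * (q - pderiv q)) x)) (at x)" for x
    using flat_DERIV[of q x] by (simp add: has_field_derivative_def mult_commute_abs)
  have "Ck k (\<lambda>x. v * flat (monom 1 2 * (q - pderiv q)) x)" for v :: real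
    by (rule Ck_mult[OF Ck_const Suc.IH])
  then show ?case
    using d by (auto simp: differentiable_def frechet_derivative_eqI[OF d])
qed

text \<open>The standard bump \<open>exp (- 1 / (1 - |x|\<^sup>2 / \<epsilon>\<^sup>2))\<close> on
  the ball of radius \<open>\<epsilon>\<close>, extended by zero and not yet normalised.\<close>

definition bump :: "real \<Rightarrow> 'a::euclidean_space \<Rightarrow> real" where
  "bump \<epsilon> x = flat 1 (1 - (1 / \<epsilon>\<^sup>2) * (x \<bullet> x))"

lemma smooth_bump: "smooth (bump \<epsilon> :: 'a::euclidean_space \<Rightarrow> real)"
  unfolding smooth_def bump_def
proof
  fix k
  have "Ck k (\<lambda>x::'a. 1 + (- (1 / \<epsilon>\<^sup>2)) * (x \<bullet> x))"
    by (intro Ck_add Ck_mult Ck_const Ck_inner_self)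
  then show "Ck k (\<lambda>x::'a. flat 1 (1 - (1 / \<epsilon>\<^sup>2) * (x \<bullet> x)))"
    using Ck_compose_real[OF Ck_flat] by simp
qed

lemma bump_nonneg: "bump \<epsilon> x \<ge> 0"
  by (simp add: bump_def flat_def)

lemma bump_pos: "\<epsilon> > 0 \<Longrightarrow> norm x < \<epsilon> \<Longrightarrow> bump \<epsilon> x > 0"
  using power_strict_mono[of "norm x" \<epsilon> 2]
  by (simp add: bump_def flat_def dot_square_norm)

lemma bump_eq_0: "\<epsilon> > 0 \<Longrightarrow> norm x \<ge> \<epsilon> \<Longrightarrow> bump \<epsilon> x = 0"
  using power_mono[of \<epsilon> "norm x" 2]
  by (simp add: bump_def flat_def dot_square_norm not_less)

lemma norm_ge_outside_box:
  fixes x :: "'a::euclidean_space"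
  assumes "x \<notin> cbox (- (\<epsilon> *\<^sub>R One)) (\<epsilon> *\<^sub>R One)"
  shows "norm x \<ge> \<epsilon>"
proof -
  obtain i where i: "i \<in> Basis" "\<not> (- \<epsilon> \<le> x \<bullet> i \<and> x \<bullet> i \<le> \<epsilon>)"
    using assms by (auto simp: mem_box)
  then have "\<epsilon> \<le> \<bar>x \<bullet> i\<bar>" by linarith
  then show ?thesis using Basis_le_norm[OF i(1), of x] by linarith
qed

text \<open>The mass is measured on a box containing the ball, where continuous functions are
  integrable and integrals can be interchanged.\<close>

lemma mollifier:
  assumes "\<epsilon> > 0"
  obtains \<rho> :: "'a::euclidean_space \<Rightarrow> real" where
    "smooth \<rho>" "\<And>x. \<rho> x \<ge> 0" "\<And>x. norm x \<ge> \<epsilon> \<Longrightarrow> \<rho> x = 0"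
    "(\<rho> has_integral 1) (cbox (- (\<epsilon> *\<^sub>R One)) (\<epsilon> *\<^sub>R One))"
proof -
  let ?B = "cbox (- (\<epsilon> *\<^sub>R One)) (\<epsilon> *\<^sub>R One) :: 'a set"
  let ?I = "integral ?B (bump \<epsilon>)"
  have c: "continuous_on S (bump \<epsilon> :: 'a \<Rightarrow> real)" for S by (rule smooth_continuous_on[OF smooth_bump])
  have hi: "(bump \<epsilon> has_integral ?I) ?B"
    by (intro integrable_integral integrable_continuous c)
  have "?I \<noteq> 0"
  proof
    assume "?I = 0"
    then have "(bump \<epsilon> has_integral 0) ?B" using hi by simp
    moreover have "box (- (\<epsilon> *\<^sub>R One)) (\<epsilon> *\<^sub>R One :: 'a) \<noteq> {}" using assms by (simp add: box_ne_empty)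
    moreover have "(0::'a) \<in> ?B" using assms by (simp add: mem_box)
    ultimately have "bump \<epsilon> (0::'a) = 0"
      using has_integral_0_cbox_imp_0[OF c bump_nonneg] by blast
    then show False using bump_pos[OF assms, of "0::'a"] assms by simp
  qed
  moreover have "?I \<ge> 0" by (rule integral_nonneg) (use hi bump_nonneg in auto)
  ultimately have I: "?I > 0" by simp
  show ?thesis
  proof (rule that)
    show "smooth (\<lambda>x::'a. (1 / ?I) * bump \<epsilon> x)"
      by (intro smooth_mult smooth_const smooth_bump)
    show "(1 / ?I) * bump \<epsilon> x \<ge> 0" for x :: 'a using I bump_nonneg[of \<epsilon> x] by simp
    show "(1 / ?I) * bump \<epsilon> x = 0" if "norm x \<ge> \<epsilon>" for x :: 'a
      using bump_eq_0[OF assms that] by simp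
    show "((\<lambda>x. (1 / ?I) * bump \<epsilon> x) has_integral 1) ?B"
      using has_integral_mult_right[OF hi, of "1 / ?I"] I by simp
  qed
qed

text \<open>A fixed box keeps the domain of integration independent of \<open>x\<close>, so that
  derivatives pass under the integral everywhere. This is the usual convolution only at points where
  the box contains the shifted support of the kernel, see \<open>conv_eq\<close>.\<close>

definition conv :: "'a::euclidean_space \<Rightarrow> ('a \<Rightarrow> real) \<Rightarrow> ('a \<Rightarrow> real) \<Rightarrow> 'a \<Rightarrow> real" where
  "conv b \<rho> w x = integral (cbox (- b) b) (\<lambda>y. \<rho> (x - y) * w y)"

text \<open>All derivatives fall on the kernel, so continuity of \<open>w\<close> is enough.\<close>

lemma Ck_conv:
  fixes w \<rho> :: "'a::euclidean_space \<Rightarrow> real"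
  assumes w: "continuous_on UNIV w" and "Ck k \<rho>"
  shows "Ck k (conv b \<rho> w)"
  using assms(2)
proof (induction k arbitrary: \<rho>)
  case 0
  have \<rho>: "continuous_on S \<rho>" for S using 0 continuous_on_subset by auto
  have w': "continuous_on S w" for S using w continuous_on_subset by blast
  have "continuous_on UNIV (\<lambda>x. integral (cbox (- b) b) (\<lambda>y. \<rho> (x - y) * w y))"
    by (rule integral_continuous_on_param)
      (auto simp: split_beta intro!: continuous_intros continuous_on_compose2[OF \<rho>[of UNIV]] continuous_on_compose2[OF w'[of UNIV]])
  then show ?case by (simp add: conv_def[abs_def])
next
  case (Suc k)
  have w': "continuous_on S w" for S using w continuous_on_subset by blast
  have d: "(\<rho> has_derivative frechet_derivative \<rho> (at x)) (at x)" for x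
    using Suc.prems by (simp add: frechet_derivative_works)
  have "continuous_on UNIV \<rho>" using Ck_Suc_imp_Ck[of 0 \<rho>] Suc.prems
    by (auto intro!: continuous_at_imp_continuous_on differentiable_imp_continuous_within)
  then have \<rho>: "continuous_on S \<rho>" for S using continuous_on_subset by blast
  have "Ck 0 (\<lambda>x. frechet_derivative \<rho> (at x) v)" for v
  proof -
    have "Ck j f \<Longrightarrow> Ck 0 f" for j and f :: "'a \<Rightarrow> real" by (induction j) (use Ck_Suc_imp_Ck in blast)+
    then show ?thesis using Suc.prems by (auto simp del: Ck.simps(1))
  qed
  then have dc: "continuous_on UNIV (\<lambda>x. frechet_derivative \<rho> (at x) v)" for v by simp
  \<comment> \<open>The rule for differentiating under the integral wants the derivative as a
    bounded linear map that depends continuously on both variables.\<close>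
  define F where "F = (\<lambda>x y. Blinfun (\<lambda>v. frechet_derivative \<rho> (at (x - y)) v * w y))"
  have bl: "bounded_linear (\<lambda>v. frechet_derivative \<rho> (at (x - y)) v * w y)" for x y
    by (rule bounded_linear_mult_const) (rule has_derivative_bounded_linear[OF d])
  have F: "blinfun_apply (F x y) = (\<lambda>v. frechet_derivative \<rho> (at (x - y)) v * w y)" for x y
    unfolding F_def by (rule bounded_linear_Blinfun_apply[OF bl])
  have Fc: "continuous_on (UNIV \<times> cbox (- b) b) (\<lambda>(x, y). F x y)"
    by (rule continuous_on_blinfun_componentwise)
      (auto simp: split_beta F intro!: continuous_intros continuous_on_compose2[OF dc] continuous_on_compose2[OF w'[of UNIV]])
  have D1: "((\<lambda>x. integral (cbox (- b) b) (\<lambda>y. \<rho> (x - y) * w y)) has_derivative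
      blinfun_apply (integral (cbox (- b) b) (F x))) (at x within UNIV)" for x
  proof (rule leibniz_rule[OF _ _ Fc])
    fix x y :: 'a
    have "((\<lambda>x. x - y) has_derivative (\<lambda>v. v)) (at x)" by (auto intro!: derivative_eq_intros)
    then have "((\<lambda>x. \<rho> (x - y)) has_derivative frechet_derivative \<rho> (at (x - y))) (at x)"
      using diff_chain_at[OF _ d, of "\<lambda>x. x - y" "\<lambda>v. v"] by (simp add: o_def)
    then have "((\<lambda>x. \<rho> (x - y) * w y) has_derivative (\<lambda>v. frechet_derivative \<rho> (at (x - y)) v * w y)) (at x)"
      by (rule has_derivative_mult_left)
    then show "((\<lambda>x. \<rho> (x - y) * w y) has_derivative blinfun_apply (F x y)) (at x within UNIV)"
      by (simp add: F)
    show "(\<lambda>y. \<rho> (x - y) * w y) integrable_on cbox (- b) b"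
      by (intro integrable_continuous continuous_intros w' continuous_on_compose2[OF \<rho>[of UNIV]]) auto
  qed auto
  have "blinfun_apply (integral (cbox (- b) b) (F x)) v =
      conv b (\<lambda>x. frechet_derivative \<rho> (at x) v) w x" for x v
  proof -
    have "continuous_on (cbox (- b) b) (\<lambda>y. case (x, y) of (x, y) \<Rightarrow> F x y)"
      by (rule continuous_on_compose2[OF Fc continuous_on_Pair[OF continuous_on_const continuous_on_id]]) auto
    then have "continuous_on (cbox (- b) b) (F x)" by simp
    then show ?thesis
      by (simp add: conv_def blinfun_apply_integral integrable_continuous F)
  qed
  have D2: "conv b \<rho> w = (\<lambda>x. integral (cbox (- b) b) (\<lambda>y. \<rho> (x - y) * w y))"
    by (simp add: conv_def fun_eq_iff)
  have D: "(conv b \<rho> w has_derivative (\<lambda>v. conv b (\<lambda>x. frechet_derivative \<rho> (at x) v) w x)) (at x)" for x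
  proof -
    have "blinfun_apply (integral (cbox (- b) b) (F x)) = (\<lambda>v. conv b (\<lambda>x. frechet_derivative \<rho> (at x) v) w x)"
      by (rule ext) fact
    then show ?thesis using D1[of x] unfolding D2 by simp
  qed
  have "Ck k (conv b (\<lambda>x. frechet_derivative \<rho> (at x) v) w)" for v
    by (rule Suc.IH) (use Suc.prems in simp)
  then show ?case
    using D by (auto simp: differentiable_def frechet_derivative_eqI[OF D])
qed

lemma smooth_conv: "continuous_on UNIV w \<Longrightarrow> smooth \<rho> \<Longrightarrow> smooth (conv b \<rho> w)"
  by (simp add: smooth_def Ck_conv)

lemma conv_eq:
  fixes w :: "'a::euclidean_space \<Rightarrow> real"
  assumes w: "continuous_on UNIV w" and \<rho>: "smooth \<rho>" "\<And>x. norm x \<ge> \<epsilon> \<Longrightarrow> \<rho> x = 0"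
    and sub: "\<And>z. z \<in> cbox (- (\<epsilon> *\<^sub>R One)) (\<epsilon> *\<^sub>R One) \<Longrightarrow> x - z \<in> cbox (- b) b"
  shows "conv b \<rho> w x = integral (cbox (- (\<epsilon> *\<^sub>R One)) (\<epsilon> *\<^sub>R One)) (\<lambda>z. \<rho> z * w (x - z))"
proof -
  let ?B = "cbox (- (\<epsilon> *\<^sub>R One)) (\<epsilon> *\<^sub>R One) :: 'a set"
  let ?g = "\<lambda>z. \<rho> z * w (x - z)"
  have "?g integrable_on ?B"
    by (intro integrable_continuous continuous_intros smooth_continuous_on \<rho> continuous_on_compose2[OF w]) auto
  then have "(?g has_integral integral ?B ?g) ?B" by (rule integrable_integral)
  from has_integral_affinity[OF this, of "-1" x]
  have "((\<lambda>y. \<rho> (x - y) * w y) has_integral integral ?B ?g) ((\<lambda>z. x - z) ` ?B)"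
    by simp
  then have "((\<lambda>y. \<rho> (x - y) * w y) has_integral integral ?B ?g) (cbox (- b) b)"
  proof (rule has_integral_on_superset)
    fix y assume "y \<notin> (\<lambda>z. x - z) ` ?B"
    then have "x - y \<notin> ?B" by (metis (no_types, lifting) diff_diff_eq2 add_diff_cancel_left' image_eqI)
    then have "norm (x - y) \<ge> \<epsilon>" by (rule norm_ge_outside_box)
    then show "\<rho> (x - y) * w y = 0" by (simp add: \<rho>(2))
  qed (use sub in auto)
  then show ?thesis unfolding conv_def by (rule integral_unique)
qed

section \<open>Mollified plurisubharmonic functions\<close>

text \<open>The constant \<open>c\<close> is free: it will be \<open>u x\<close> for the
  approximation of \<open>u\<close>, and 1 with \<open>\<gamma> = 0\<close> where the cutoff is
  constant.\<close>

lemma conv_approx: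
  fixes w :: "'a::euclidean_space \<Rightarrow> real"
  assumes w: "continuous_on UNIV w" and \<rho>: "smooth \<rho>" "\<And>x. \<rho> x \<ge> 0" "\<And>x. norm x \<ge> \<epsilon> \<Longrightarrow> \<rho> x = 0"
    and \<rho>1: "(\<rho> has_integral 1) (cbox (- (\<epsilon> *\<^sub>R One)) (\<epsilon> *\<^sub>R One))"
    and sub: "\<And>z. z \<in> cbox (- (\<epsilon> *\<^sub>R One)) (\<epsilon> *\<^sub>R One) \<Longrightarrow> x - z \<in> cbox (- b) b"
    and close: "\<And>z. norm z \<le> \<epsilon> \<Longrightarrow> \<bar>w (x - z) - c\<bar> \<le> \<gamma>"
  shows "\<bar>conv b \<rho> w x - c\<bar> \<le> \<gamma>"
proof -
  let ?B = "cbox (- (\<epsilon> *\<^sub>R One)) (\<epsilon> *\<^sub>R One) :: 'a set"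
  have "(\<lambda>z. \<rho> z * w (x - z)) integrable_on ?B"
    by (intro integrable_continuous continuous_intros smooth_continuous_on \<rho> continuous_on_compose2[OF w]) auto
  then have "((\<lambda>z. \<rho> z * w (x - z)) has_integral conv b \<rho> w x) ?B"
    using conv_eq[OF w \<rho>(1,3) sub] by (simp add: has_integral_iff)
  from has_integral_diff[OF this has_integral_mult_left[OF \<rho>1, of c]]
  have 1: "((\<lambda>z. \<rho> z * (w (x - z) - c)) has_integral conv b \<rho> w x - c) ?B"
    by (simp add: algebra_simps)
  have g: "((\<lambda>z. \<rho> z * \<gamma>) has_integral \<gamma>) ?B"
    using has_integral_mult_left[OF \<rho>1, of \<gamma>] by simp
  have b: "\<bar>\<rho> z * (w (x - z) - c)\<bar> \<le> \<rho> z * \<gamma>" for z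
  proof (cases "norm z \<le> \<epsilon>")
    case True
    then show ?thesis using close[OF True] \<rho>(2)[of z] by (simp add: abs_mult mult_left_mono)
  next
    case False
    then show ?thesis using \<rho>(3)[of z] by simp
  qed
  have "norm (integral ?B (\<lambda>z. \<rho> z * (w (x - z) - c))) \<le> integral ?B (\<lambda>z. \<rho> z * \<gamma>)"
    by (rule integral_norm_bound_integral) (use 1 g b in auto)
  then show ?thesis unfolding integral_unique[OF 1] integral_unique[OF g] by simp
qed

definition submean_excess :: "(complex ^ 'n::finite) set \<Rightarrow> real \<Rightarrow> (complex ^ 'n \<Rightarrow> real) \<Rightarrow> bool" where
  "submean_excess U \<kappa> w \<longleftrightarrow> (\<forall>a b. (\<forall>z::complex. norm z \<le> 1 \<longrightarrow> a + z *s b \<in> U) \<longrightarrow>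
     2 * pi * (w a + \<kappa> * (norm b)\<^sup>2) \<le> integral {0..2 * pi} (\<lambda>t. w (a + cis t *s b)))"

lemma norm_cscale: "norm (c *s v) = cmod c * norm (v :: complex ^ 'n::finite)"
  by (simp add: norm_vec_def norm_mult L2_set_right_distrib)

lemma continuous_cis_path: "continuous_on S (\<lambda>t. x + cis t *s (b :: complex ^ 'n::finite))"
proof -
  have "cis t *s b = cos t *\<^sub>R b + sin t *\<^sub>R (\<i> *s b)" for t
    by (simp add: vec_eq_iff complex_eq_iff)
  then show ?thesis by (simp add: continuous_intros)
qed

text \<open>By Fubini the circle mean of the convolution is a weighted average of circle means of
  translates of \<open>w\<close>, each of which has the excess because its disc stays in
  \<open>U\<close>.\<close>

lemma conv_submean:
  fixes w :: "complex ^ 'n::finite \<Rightarrow> real"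
  assumes w: "continuous_on UNIV w" and \<rho>: "smooth \<rho>" "\<And>x. \<rho> x \<ge> 0" "\<And>x. norm x \<ge> \<epsilon> \<Longrightarrow> \<rho> x = 0"
    and \<rho>1: "(\<rho> has_integral 1) (cbox (- (\<epsilon> *\<^sub>R One)) (\<epsilon> *\<^sub>R One))"
    and ex: "submean_excess U \<kappa> w"
    and U: "\<And>y. norm (y - x) \<le> \<epsilon> + norm c \<Longrightarrow> y \<in> U"
    and sub: "\<And>y z. norm (y - x) \<le> norm c \<Longrightarrow> z \<in> cbox (- (\<epsilon> *\<^sub>R One)) (\<epsilon> *\<^sub>R One) \<Longrightarrow> y - z \<in> cbox (- b) b"
  shows "2 * pi * (conv b \<rho> w x + \<kappa> * (norm c)\<^sup>2) \<le> integral {0..2 * pi} (\<lambda>t. conv b \<rho> w (x + cis t *s c))"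
proof -
  let ?B = "cbox (- (\<epsilon> *\<^sub>R One)) (\<epsilon> *\<^sub>R One) :: (complex ^ 'n) set"
  let ?T = "cbox 0 (2 * pi) :: real set"
  have nc: "norm (cis t *s c) = norm c" for t by (simp add: norm_cscale)
  have e: "conv b \<rho> w (x + cis t *s c) = integral ?B (\<lambda>z. \<rho> z * w (x + cis t *s c - z))" for t
    by (rule conv_eq[OF w \<rho>(1,3)]) (use sub nc in auto)
  have e0: "conv b \<rho> w x = integral ?B (\<lambda>z. \<rho> z * w (x - z))"
    by (rule conv_eq[OF w \<rho>(1,3)]) (use sub in auto)
  have i0: "(\<lambda>z. \<rho> z * w (x - z)) integrable_on ?B"
    by (intro integrable_continuous continuous_intros smooth_continuous_on \<rho> continuous_on_compose2[OF w]) auto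
  have "continuous_on (?T \<times> ?B) (\<lambda>p. w (x + cis (fst p) *s c - snd p))"
    by (intro continuous_on_compose2[OF w] continuous_on_diff continuous_on_snd continuous_on_id
        continuous_on_compose2[OF continuous_cis_path[of UNIV x c]] continuous_on_fst) auto
  moreover have "continuous_on (?T \<times> ?B) (\<lambda>p. \<rho> (snd p))"
    by (intro continuous_on_compose2[OF smooth_continuous_on[OF \<rho>(1), of UNIV]] continuous_on_snd continuous_on_id) auto
  ultimately have cont: "continuous_on (?T \<times> ?B) (\<lambda>(t, z). \<rho> z * w (x + cis t *s c - z))"
    by (simp add: split_beta continuous_on_mult)
  have "integral ?T (\<lambda>t. conv b \<rho> w (x + cis t *s c)) =
      integral ?T (\<lambda>t. integral ?B (\<lambda>z. \<rho> z * w (x + cis t *s c - z)))"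
    by (simp only: e)
  also have "\<dots> = integral ?B (\<lambda>z. integral ?T (\<lambda>t. \<rho> z * w (x + cis t *s c - z)))"
    by (rule integral_swap_continuous) (use cont in \<open>simp add: cbox_Pair_eq\<close>)
  also have "\<dots> \<ge> integral ?B (\<lambda>z. 2 * pi * (\<rho> z * w (x - z)) + 2 * pi * (\<kappa> * (norm c)\<^sup>2) * \<rho> z)"
  proof (rule integral_le)
    show "(\<lambda>z. 2 * pi * (\<rho> z * w (x - z)) + 2 * pi * (\<kappa> * (norm c)\<^sup>2) * \<rho> z) integrable_on ?B"
      by (intro integrable_continuous continuous_intros smooth_continuous_on \<rho> continuous_on_compose2[OF w]) auto
    show "(\<lambda>z. integral ?T (\<lambda>t. \<rho> z * w (x + cis t *s c - z))) integrable_on ?B"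
    proof (intro integrable_continuous integral_continuous_on_param)
      have "continuous_on (?B \<times> ?T) (\<lambda>p. w (x + cis (snd p) *s c - fst p))"
        by (intro continuous_on_compose2[OF w] continuous_on_diff continuous_on_snd continuous_on_id
            continuous_on_compose2[OF continuous_cis_path[of UNIV x c]] continuous_on_fst) auto
      moreover have "continuous_on (?B \<times> ?T) (\<lambda>p. \<rho> (fst p))"
        by (intro continuous_on_compose2[OF smooth_continuous_on[OF \<rho>(1), of UNIV]] continuous_on_fst continuous_on_id) auto
      ultimately show "continuous_on (?B \<times> ?T) (\<lambda>(z, t). \<rho> z * w (x + cis t *s c - z))"
        by (simp add: split_beta continuous_on_mult)
    qed
    fix z assume "z \<in> ?B"
    show "2 * pi * (\<rho> z * w (x - z)) + 2 * pi * (\<kappa> * (norm c)\<^sup>2) * \<rho> z \<le>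
        integral ?T (\<lambda>t. \<rho> z * w (x + cis t *s c - z))"
    proof (cases "norm z \<ge> \<epsilon>")
      case True
      then show ?thesis using \<rho>(3) by simp
    next
      case False
      have "\<forall>\<zeta>::complex. norm \<zeta> \<le> 1 \<longrightarrow> (x - z) + \<zeta> *s c \<in> U"
      proof (intro allI impI U)
        fix \<zeta> :: complex assume \<zeta>: "norm \<zeta> \<le> 1"
        have "norm (x - z + \<zeta> *s c - x) \<le> norm z + norm (\<zeta> *s c)"
          using norm_triangle_ineq4[of "\<zeta> *s c" z] by (simp add: algebra_simps)
        also have "norm (\<zeta> *s c) \<le> norm c"
          using mult_right_mono[OF \<zeta>, of "norm c"] by (simp add: norm_cscale)
        finally show "norm (x - z + \<zeta> *s c - x) \<le> \<epsilon> + norm c" using False by simp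
      qed
      then have "2 * pi * (w (x - z) + \<kappa> * (norm c)\<^sup>2) \<le> integral {0..2 * pi} (\<lambda>t. w (x - z + cis t *s c))"
        using ex unfolding submean_excess_def by blast
      then have "\<rho> z * (2 * pi * (w (x - z) + \<kappa> * (norm c)\<^sup>2)) \<le> \<rho> z * integral ?T (\<lambda>t. w (x + cis t *s c - z))"
        by (intro mult_left_mono \<rho>) (simp add: algebra_simps)
      then show ?thesis by (simp add: algebra_simps)
    qed
  qed
  also have "integral ?B (\<lambda>z. 2 * pi * (\<rho> z * w (x - z)) + 2 * pi * (\<kappa> * (norm c)\<^sup>2) * \<rho> z) =
      2 * pi * conv b \<rho> w x + 2 * pi * (\<kappa> * (norm c)\<^sup>2)"
    unfolding e0
    using has_integral_add[OF has_integral_mult_right[OF integrable_integral[OF i0], of "2 * pi"]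
        has_integral_mult_right[OF \<rho>1, of "2 * pi * (\<kappa> * (norm c)\<^sup>2)"]]
    by (simp add: has_integral_iff)
  finally show ?thesis by (simp add: algebra_simps)
qed

text \<open>This is a quarter of the Laplacian along the complex line of direction \<open>b\<close>;
  the mixed terms drop out.\<close>

lemma levi_diag:
  fixes h :: "complex ^ 'n::finite \<Rightarrow> real"
  assumes h: "smooth h"
  shows "Re (levi (\<lambda>x. of_real (h x)) x b b) =
    (frechet_derivative (\<lambda>y. frechet_derivative h (at y) b) (at x) b +
     frechet_derivative (\<lambda>y. frechet_derivative h (at y) (\<i> *s b)) (at x) (\<i> *s b)) / 4"
proof -
  let ?h = "\<lambda>x. complex_of_real (h x)"
  let ?D = "\<lambda>f x. frechet_derivative f (at x)"
  have sh: "smooth ?h" by (rule smooth_linear_comp[OF bounded_linear_of_real h])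
  have D1: "?D ?h y v = of_real (?D h y v)" for y v
    by (rule frechet_derivative_linear_comp[OF bounded_linear_of_real smooth_differentiable[OF h]])
  have D2: "?D (\<lambda>y. complex_of_real (?D h y v)) x u = of_real (?D (\<lambda>y. ?D h y v) x u)" for u v
    by (rule frechet_derivative_linear_comp[OF bounded_linear_of_real
          smooth_differentiable[OF smooth_frechet_derivative[OF h]]])
  have s: "smooth (\<lambda>y. complex_of_real (?D h y v))" for v
    by (rule smooth_linear_comp[OF bounded_linear_of_real smooth_frechet_derivative[OF h]])
  have "(\<lambda>y. wd \<i> ?h y b) = (\<lambda>y. (1 / 2) * complex_of_real (?D h y b) + \<i> / 2 * complex_of_real (?D h y (\<i> *s b)))"
    by (simp add: fun_eq_iff wd_def D1 add_divide_distrib)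
  then have E: "?D (\<lambda>y. wd \<i> ?h y b) x u =
      (1 / 2) * of_real (?D (\<lambda>y. ?D h y b) x u) + \<i> / 2 * of_real (?D (\<lambda>y. ?D h y (\<i> *s b)) x u)" for u
    by (simp only: frechet_derivative_add[OF smooth_mult[OF smooth_const s] smooth_mult[OF smooth_const s]]
        frechet_derivative_cmult[OF s] D2)
  show ?thesis
    unfolding levi_def wd_def[of "- \<i>"] E
    using second_derivative_symmetric[OF h, of b x "\<i> *s b"] by (simp add: field_simps)
qed

text \<open>Second-order Taylor expansion on small circles: linear and mixed terms have mean zero
  and the pure ones mean one half, so dividing the excess by the squared radius compares
  \<open>\<kappa>\<close> with a quarter of the Laplacian. Continuity of the second derivatives
  controls the remainder.\<close>

lemma levi_lower_bound:
  fixes h :: "complex ^ 'n::finite \<Rightarrow> real"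
  assumes h: "smooth h" and r0: "r0 > 0"
    and sm: "\<And>r. 0 < r \<Longrightarrow> r < r0 \<Longrightarrow>
      2 * pi * (h x + \<kappa> * (norm (of_real r *s b))\<^sup>2) \<le> integral {0..2 * pi} (\<lambda>t. h (x + cis t *s (of_real r *s b)))"
  shows "Re (levi (\<lambda>x. of_real (h x)) x b b) \<ge> \<kappa> * (norm b)\<^sup>2"
proof -
  let ?D = "\<lambda>f x. frechet_derivative f (at x)"
  let ?D2 = "\<lambda>u v y. ?D (\<lambda>y. ?D h y u) y v"
  define c where "c = \<i> *s b"
  define A where "A = ?D2 b b" define B where "B = ?D2 b c" define C where "C = ?D2 c c"
  have sD: "smooth (\<lambda>y. ?D h y v)" for v by (rule smooth_frechet_derivative[OF h])
  have cont: "continuous_on UNIV (?D2 u v)" for u v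
    by (intro smooth_continuous_on smooth_frechet_derivative h)
  have lin: "linear (?D h y)" "linear (?D (\<lambda>y. ?D h y v) y)" for y v
    by (intro linear_frechet_derivative smooth_differentiable h sD)+
  \<comment> \<open>The displacement to the point at angle \<open>t\<close> of the circle, before
    scaling by the radius, in real coordinates of the complex line.\<close>
  define V where "V = (\<lambda>t. cos t *\<^sub>R b + sin t *\<^sub>R c)"
  have V: "cis t *s (of_real r *s b) = r *\<^sub>R V t" for t r
    by (simp add: V_def c_def vec_eq_iff complex_eq_iff algebra_simps)
  have D2V: "?D2 (V t) (V t) y = (cos t)\<^sup>2 * A y + 2 * (sin t * cos t) * B y + (sin t)\<^sup>2 * C y" for t y
  proof -
    have "?D h y (V t) = cos t * ?D h y b + sin t * ?D h y c" for y
      unfolding V_def using linear_add[OF lin(1)] linear_cmul[OF lin(1)] by simp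
    then have "?D2 (V t) (V t) y = ?D (\<lambda>y. cos t * ?D h y b + sin t * ?D h y c) y (V t)" by (simp only:)
    also have "\<dots> = cos t * ?D2 b (V t) y + sin t * ?D2 c (V t) y"
      by (simp only: frechet_derivative_add[OF smooth_mult[OF smooth_const sD] smooth_mult[OF smooth_const sD]]
          frechet_derivative_cmult[OF sD])
    finally have 1: "?D2 (V t) (V t) y = cos t * ?D2 b (V t) y + sin t * ?D2 c (V t) y" .
    have 2: "?D2 u (V t) y = cos t * ?D2 u b y + sin t * ?D2 u c y" for u
      unfolding V_def using linear_add[OF lin(2)] linear_cmul[OF lin(2)] by simp
    show ?thesis
      unfolding 1 2[of b] 2[of c]
      using second_derivative_symmetric[OF h, of b y c]
      by (simp add: A_def B_def C_def power2_eq_square algebra_simps)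
  qed
  have taylor: "\<exists>s. 0 < s \<and> s < r \<and> h (x + r *\<^sub>R V t) = h x + r * ?D h x (V t) + r\<^sup>2 / 2 * ?D2 (V t) (V t) (x + s *\<^sub>R V t)"
    if rp: "r > 0" for r t
  proof -
    define diff where "diff = (\<lambda>(m::nat) s. if m = 0 then h (x + s *\<^sub>R V t) else if m = 1 then ?D h (x + s *\<^sub>R V t) (V t)
        else ?D2 (V t) (V t) (x + s *\<^sub>R V t))"
    have path: "((\<lambda>s. x + s *\<^sub>R V t) has_derivative (\<lambda>k. k *\<^sub>R V t)) (at s)" for s
      by (auto intro!: derivative_eq_intros)
    have d: "((\<lambda>s. f (x + s *\<^sub>R V t)) has_real_derivative ?D f (x + s *\<^sub>R V t) (V t)) (at s)"
      if f: "smooth f" for f :: "complex ^ 'n \<Rightarrow> real" and s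
    proof -
      have "((\<lambda>s. f (x + s *\<^sub>R V t)) has_derivative (\<lambda>k. ?D f (x + s *\<^sub>R V t) (k *\<^sub>R V t))) (at s)"
        using diff_chain_at[OF path smooth_has_derivative[OF f]] by (simp add: o_def)
      moreover have "linear (?D f (x + s *\<^sub>R V t))"
        by (intro linear_frechet_derivative smooth_differentiable f)
      ultimately show ?thesis
        by (simp add: has_field_derivative_def linear_cmul mult_commute_abs)
    qed
    have "\<forall>m s. m < 2 \<and> 0 \<le> s \<and> s \<le> r \<longrightarrow> DERIV (diff m) s :> diff (Suc m) s"
      using d[OF h] d[OF sD] by (auto simp: diff_def less_2_cases_iff)
    then obtain s where "0 < s" "s < r" "h (x + r *\<^sub>R V t) =
        (\<Sum>m<2. (diff m 0 / fact m) * r ^ m) + (diff 2 s / fact 2) * r ^ 2"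
      using Maclaurin[OF rp, of 2 diff "\<lambda>s. h (x + s *\<^sub>R V t)"] by (auto simp: diff_def)
    then show ?thesis
      by (intro exI[of _ s]) (auto simp: diff_def numeral_2_eq_2)
  qed
  have nV: "norm (V t) \<le> norm b" for t
    using V[of t 1] by (simp add: norm_cscale flip: V[of _ 1, simplified])
  have key: "\<kappa> * (norm b)\<^sup>2 \<le> (A x + C x) / 4 + 2 * \<eta>" if \<eta>: "\<eta> > 0" for \<eta>
  proof -
    have "\<exists>d>0. \<forall>y. dist y x < d \<longrightarrow> dist (?D2 u v y) (?D2 u v x) < \<eta>" for u v
      using cont[of u v] \<eta> unfolding continuous_on_iff by simp
    then obtain d where d: "\<And>u v. d u v > 0" "\<And>u v y. dist y x < d u v \<Longrightarrow> \<bar>?D2 u v y - ?D2 u v x\<bar> < \<eta>"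
      unfolding dist_real_def by metis
    define dd where "dd = min (d b b) (min (d b c) (d c c))"
    have dd: "dd > 0" using d(1) by (simp add: dd_def)
    define r where "r = min (r0 / 2) (dd / (2 * (norm b + 1)))"
    have r: "0 < r" "r < r0" using r0 dd by (auto simp: r_def min_def add_nonneg_pos divide_simps)
    have rb: "s * norm b < dd" if "0 < s" "s < r" for s
    proof -
      have "s * norm b \<le> r * (norm b + 1)"
        using that by (intro mult_mono) auto
      also have "\<dots> \<le> (dd / (2 * (norm b + 1))) * (norm b + 1)"
        by (intro mult_right_mono) (auto simp: r_def)
      also have "\<dots> = dd / 2"
      proof -
        have "norm b + 1 \<noteq> 0" using norm_ge_zero[of b] by linarith
        then show ?thesis by (simp add: field_simps)
      qed
      also have "\<dots> < dd" using dd by simp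
      finally show ?thesis .
    qed
    define P where "P = ?D h x b" define Q where "Q = ?D h x c"
    \<comment> \<open>The pure second derivatives contribute at most \<open>\<eta>\<close> each to
      the error, the mixed one at most \<open>2 * \<eta>\<close>.\<close>
    have up: "h (x + r *\<^sub>R V t) \<le> h x + r * (cos t * P + sin t * Q) +
        r\<^sup>2 / 2 * ((cos t)\<^sup>2 * A x + 2 * (sin t * cos t) * B x + (sin t)\<^sup>2 * C x + 4 * \<eta>)" for t
    proof -
      obtain s where s: "0 < s" "s < r"
        "h (x + r *\<^sub>R V t) = h x + r * ?D h x (V t) + r\<^sup>2 / 2 * ?D2 (V t) (V t) (x + s *\<^sub>R V t)"
        using taylor[OF r(1)] by blast
      let ?y = "x + s *\<^sub>R V t"
      have "dist ?y x \<le> s * norm b"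
        using mult_left_mono[OF nV[of t], of s] s by (simp add: dist_norm)
      then have "dist ?y x < dd" using rb[OF s(1,2)] by simp
      then have abc: "\<bar>A ?y - A x\<bar> < \<eta>" "\<bar>B ?y - B x\<bar> < \<eta>" "\<bar>C ?y - C x\<bar> < \<eta>"
        using d(2) by (auto simp: A_def B_def C_def dd_def)
      have c1: "(cos t)\<^sup>2 \<le> 1" "(sin t)\<^sup>2 \<le> 1" by (simp_all add: abs_square_le_1)
      have sc: "\<bar>sin t * cos t\<bar> \<le> 1"
        using mult_mono[of "\<bar>sin t\<bar>" 1 "\<bar>cos t\<bar>" 1] by (simp add: abs_mult)
      have "(cos t)\<^sup>2 * (A ?y - A x) \<le> 1 * \<eta>"
        using abc(1) c1 \<eta> by (intro order_trans[OF mult_left_mono[of _ \<eta>] mult_right_mono]) auto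
      moreover have "(sin t)\<^sup>2 * (C ?y - C x) \<le> 1 * \<eta>"
        using abc(3) c1 \<eta> by (intro order_trans[OF mult_left_mono[of _ \<eta>] mult_right_mono]) auto
      moreover have "(sin t * cos t) * (B ?y - B x) \<le> 1 * \<eta>"
      proof -
        have "(sin t * cos t) * (B ?y - B x) \<le> \<bar>sin t * cos t\<bar> * \<bar>B ?y - B x\<bar>"
          by (metis abs_ge_self abs_mult)
        also have "\<dots> \<le> 1 * \<eta>" using sc abc(2) \<eta> by (intro mult_mono) auto
        finally show ?thesis .
      qed
      ultimately have "?D2 (V t) (V t) ?y \<le> (cos t)\<^sup>2 * A x + 2 * (sin t * cos t) * B x + (sin t)\<^sup>2 * C x + 4 * \<eta>"
        unfolding D2V by (simp add: algebra_simps)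
      moreover have "?D h x (V t) = cos t * P + sin t * Q"
        unfolding V_def P_def Q_def using linear_add[OF lin(1)] linear_cmul[OF lin(1)] by simp
      ultimately show ?thesis unfolding s(3) by (simp add: mult_left_mono)
    qed
    let ?U = "\<lambda>t. h x + r * (cos t * P + sin t * Q) +
        r\<^sup>2 / 2 * ((cos t)\<^sup>2 * A x + 2 * (sin t * cos t) * B x + (sin t)\<^sup>2 * C x + 4 * \<eta>)"
    let ?F = "\<lambda>t. h x * t + r * (sin t * P - cos t * Q) +
        r\<^sup>2 / 2 * ((t + sin t * cos t) / 2 * A x + (sin t)\<^sup>2 * B x + (t - sin t * cos t) / 2 * C x + 4 * \<eta> * t)"
    have F: "(?U has_integral ?F (2 * pi) - ?F 0) {0..2 * pi}"
    proof (rule fundamental_theorem_of_calculus)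
      fix t :: real
      have sc: "(sin t)\<^sup>2 = 1 - (cos t)\<^sup>2" by (simp add: sin_squared_eq)
      have "(?F has_real_derivative (h x + r * (cos t * P + sin t * Q) +
        r\<^sup>2 / 2 * ((1 + (cos t * cos t - sin t * sin t)) / 2 * A x + 2 * (sin t * cos t) * B x + (1 - (cos t * cos t - sin t * sin t)) / 2 * C x + 4 * \<eta>))) (at t)"
        by (auto intro!: derivative_eq_intros simp: field_simps)
      also have "(1 + (cos t * cos t - sin t * sin t)) / 2 = (cos t)\<^sup>2"
        using sc by (simp add: power2_eq_square)
      also have "(1 - (cos t * cos t - sin t * sin t)) / 2 = (sin t)\<^sup>2"
        using sc by (simp add: power2_eq_square)
      finally show "(?F has_vector_derivative ?U t) (at t within {0..2 * pi})"
        by (simp add: has_real_derivative_iff_has_vector_derivative has_vector_derivative_at_within)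
    qed simp
    have F0: "?F (2 * pi) - ?F 0 = 2 * pi * h x + r\<^sup>2 / 2 * (pi * A x + pi * C x + 8 * pi * \<eta>)"
      by (simp add: algebra_simps)
    have "2 * pi * (h x + \<kappa> * (norm (of_real r *s b))\<^sup>2) \<le> integral {0..2 * pi} (\<lambda>t. h (x + r *\<^sub>R V t))"
      using sm[OF r] by (simp only: V)
    also have "\<dots> \<le> integral {0..2 * pi} ?U"
    proof (rule integral_le)
      have "continuous_on {0..2 * pi} (\<lambda>t. h (x + r *\<^sub>R V t))"
        unfolding V_def
        by (intro continuous_on_compose2[OF smooth_continuous_on[OF h, of UNIV]] continuous_intros) auto
      then show "(\<lambda>t. h (x + r *\<^sub>R V t)) integrable_on {0..2 * pi}"
        by (rule integrable_continuous_real)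
      show "?U integrable_on {0..2 * pi}" using F by blast
    qed (rule up)
    also have "\<dots> = 2 * pi * h x + r\<^sup>2 / 2 * (pi * A x + pi * C x + 8 * pi * \<eta>)"
      using integral_unique[OF F] F0 by simp
    finally have "2 * pi * (\<kappa> * (r\<^sup>2 * (norm b)\<^sup>2)) \<le> r\<^sup>2 / 2 * (pi * A x + pi * C x + 8 * pi * \<eta>)"
      using r by (simp add: norm_cscale power_mult_distrib algebra_simps)
    then have "(2 * pi * r\<^sup>2) * (\<kappa> * (norm b)\<^sup>2) \<le> (2 * pi * r\<^sup>2) * ((A x + C x) / 4 + 2 * \<eta>)"
      by (simp add: field_simps)
    then show ?thesis using r by simp
  qed
  have "\<kappa> * (norm b)\<^sup>2 \<le> (A x + C x) / 4"
  proof (rule field_le_epsilon)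
    fix e :: real assume "e > 0"
    then show "\<kappa> * (norm b)\<^sup>2 \<le> (A x + C x) / 4 + e" using key[of "e / 2"] by simp
  qed
  then show ?thesis
    unfolding levi_diag[OF h] by (simp add: A_def C_def c_def)
qed

text \<open>\<open>\<sigma>\<close> is the radius reserved for the circles, on top of the
  \<open>\<epsilon>\<close> used up by the kernel.\<close>

lemma conv_levi:
  fixes w :: "complex ^ 'n::finite \<Rightarrow> real"
  assumes w: "continuous_on UNIV w" and \<rho>: "smooth \<rho>" "\<And>x. \<rho> x \<ge> 0" "\<And>x. norm x \<ge> \<epsilon> \<Longrightarrow> \<rho> x = 0"
    and \<rho>1: "(\<rho> has_integral 1) (cbox (- (\<epsilon> *\<^sub>R One)) (\<epsilon> *\<^sub>R One))"
    and ex: "submean_excess U \<kappa> w" and \<sigma>: "\<sigma> > 0"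
    and U: "\<And>y. norm (y - x) \<le> \<epsilon> + \<sigma> \<Longrightarrow> y \<in> U"
    and sub: "\<And>y z. norm (y - x) \<le> \<sigma> \<Longrightarrow> z \<in> cbox (- (\<epsilon> *\<^sub>R One)) (\<epsilon> *\<^sub>R One) \<Longrightarrow> y - z \<in> cbox (- b) b"
  shows "Re (levi (\<lambda>x. of_real (conv b \<rho> w x)) x v v) \<ge> \<kappa> * (norm v)\<^sup>2"
proof (rule levi_lower_bound[OF smooth_conv[OF w \<rho>(1)]])
  show "\<sigma> / (norm v + 1) > 0" using \<sigma> by (simp add: add_nonneg_pos)
  fix r assume r: "0 < r" "r < \<sigma> / (norm v + 1)"
  have p: "norm v + 1 > 0" using norm_ge_zero[of v] by linarith
  have "r * norm v \<le> r * (norm v + 1)" using r by (intro mult_left_mono) auto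
  also have "\<dots> \<le> \<sigma>" using r p by (simp add: field_simps)
  finally have n: "norm (complex_of_real r *s v) \<le> \<sigma>" using r by (simp add: norm_cscale)
  show "2 * pi * (conv b \<rho> w x + \<kappa> * (norm (complex_of_real r *s v))\<^sup>2) \<le>
      integral {0..2 * pi} (\<lambda>t. conv b \<rho> w (x + cis t *s (complex_of_real r *s v)))"
    by (rule conv_submean[OF w \<rho> \<rho>1 ex]) (use U sub n in auto)
qed

section \<open>The peak function\<close>

lemma cscale_Re_Im: "z *s v = Re z *\<^sub>R v + Im z *\<^sub>R (\<i> *s (v :: complex ^ 'n::finite))"
  by (simp add: vec_eq_iff complex_eq_iff)

text \<open>The hull of the four points contains a disc: \<open>p + z *s b\<close> is the midpoint
  of the points displaced by twice the real and twice the imaginary part of \<open>z\<close>, so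
  \<open>cmod z \<le> e / 2\<close> suffices.\<close>

lemma complex_disc_in_convex:
  fixes Z :: "(complex ^ 'n::finite) set"
  assumes Z: "convex Z" and e: "e > 0" and b: "b \<noteq> 0"
    and pts: "p + e *\<^sub>R b \<in> Z" "p - e *\<^sub>R b \<in> Z" "p + e *\<^sub>R (\<i> *s b) \<in> Z" "p - e *\<^sub>R (\<i> *s b) \<in> Z"
  shows "\<exists>C. complex_one_dim_convex C \<and> C \<subseteq> Z \<and> p \<in> rel_interior C"
proof -
  have seg: "p + t *\<^sub>R v \<in> Z" if "p + e *\<^sub>R v \<in> Z" "p - e *\<^sub>R v \<in> Z" "\<bar>t\<bar> \<le> e" for t v
  proof -
    define \<mu> where "\<mu> = (e + t) / (2 * e)"
    have "0 \<le> \<mu>" "0 \<le> 1 - \<mu>" using that(3) e by (auto simp: \<mu>_def field_simps abs_le_iff)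
    then have "\<mu> *\<^sub>R (p + e *\<^sub>R v) + (1 - \<mu>) *\<^sub>R (p - e *\<^sub>R v) \<in> Z"
      by (intro convexD[OF Z] that) auto
    moreover have "\<mu> *\<^sub>R (p + e *\<^sub>R v) + (1 - \<mu>) *\<^sub>R (p - e *\<^sub>R v) = p + ((2 * \<mu> - 1) * e) *\<^sub>R v"
      by (simp add: algebra_simps scaleR_left_distrib[symmetric] flip: scaleR_add_left)
    moreover have "(2 * \<mu> - 1) * e = t" using e by (simp add: \<mu>_def field_simps)
    ultimately show ?thesis by simp
  qed
  define L where "L = {p + z *s b |z. True}"
  define C where "C = {p + z *s b |z. cmod z \<le> e / 2}"
  have CZ: "C \<subseteq> Z"
  proof
    fix y assume "y \<in> C"
    then obtain z where z: "y = p + z *s b" "cmod z \<le> e / 2" by (auto simp: C_def)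
    have "p + (2 * Re z) *\<^sub>R b \<in> Z" "p + (2 * Im z) *\<^sub>R (\<i> *s b) \<in> Z"
      using abs_Re_le_cmod[of z] abs_Im_le_cmod[of z] z(2)
        seg[OF pts(1,2), of "2 * Re z"] seg[OF pts(3,4), of "2 * Im z"] by auto
    then have "(1/2) *\<^sub>R (p + (2 * Re z) *\<^sub>R b) + (1/2) *\<^sub>R (p + (2 * Im z) *\<^sub>R (\<i> *s b)) \<in> Z"
      by (intro convexD[OF Z]) auto
    moreover have "(1/2) *\<^sub>R (p + (2 * Re z) *\<^sub>R b) + (1/2) *\<^sub>R (p + (2 * Im z) *\<^sub>R (\<i> *s b)) = y"
    proof -
      have "(1/2) *\<^sub>R p + (1/2) *\<^sub>R p = p" by (simp flip: scaleR_add_left)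
      then show ?thesis unfolding z(1) cscale_Re_Im[of z] by (simp add: scaleR_add_right algebra_simps)
    qed
    ultimately show "y \<in> Z" by simp
  qed
  have comb: "u *\<^sub>R (p + z *s b) + v *\<^sub>R (p + z' *s b) = p + (of_real u * z + of_real v * z') *s b"
    if "u + v = 1" for u v z z'
  proof -
    have "u *\<^sub>R p + v *\<^sub>R p = p" using that by (simp flip: scaleR_add_left)
    moreover have "u *\<^sub>R (z *s b) = (of_real u * z) *s b" for u z
      by (simp add: vec_eq_iff) (simp add: scaleR_conv_of_real)
    ultimately show ?thesis
      by (simp add: scaleR_add_right vec.scale_left_distrib algebra_simps)
  qed
  have convC: "convex C"
    unfolding convex_def
  proof (intro ballI allI impI)
    fix x y :: "complex ^ 'n" and u v :: real
    assume xy: "x \<in> C" "y \<in> C" and uv: "0 \<le> u" "0 \<le> v" "u + v = 1"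
    obtain z z' where z: "x = p + z *s b" "cmod z \<le> e / 2" "y = p + z' *s b" "cmod z' \<le> e / 2"
      using xy by (auto simp: C_def)
    have "cmod (of_real u * z + of_real v * z') \<le> u * cmod z + v * cmod z'"
      using norm_triangle_ineq[of "of_real u * z" "of_real v * z'"] uv by (simp add: norm_mult)
    also have "\<dots> \<le> u * (e / 2) + v * (e / 2)"
      using z uv by (intro add_mono mult_left_mono) auto
    also have "\<dots> = e / 2" using uv(3) by (simp flip: distrib_right)
    finally show "u *\<^sub>R x + v *\<^sub>R y \<in> C"
      unfolding z comb[OF uv(3)] C_def by blast
  qed
  have affL: "affine L"
    unfolding affine_def
  proof (intro ballI allI impI)
    fix x y :: "complex ^ 'n" and u v :: real
    assume xy: "x \<in> L" "y \<in> L" and uv: "u + v = 1"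
    obtain z z' where z: "x = p + z *s b" "y = p + z' *s b"
      using xy by (auto simp: L_def)
    show "u *\<^sub>R x + v *\<^sub>R y \<in> L" unfolding z comb[OF uv] L_def by blast
  qed
  have hull: "affine hull C = L"
  proof
    show "affine hull C \<subseteq> L"
      by (rule hull_minimal[of C L affine, OF _ affL]) (auto simp: C_def L_def)
    show "L \<subseteq> affine hull C"
    proof
      fix y assume "y \<in> L"
      then obtain z where y: "y = p + z *s b" by (auto simp: L_def)
      \<comment> \<open>Shrinks \<open>z\<close> into the disc; the affine combination with the
        centre below scales it back.\<close>
      define t where "t = e / 2 / (cmod z + 1)"
      have z1: "cmod z + 1 > 0" using norm_ge_zero[of z] by linarith
      have t: "t > 0" using e z1 by (simp add: t_def)
      have "cmod (of_real t * z) \<le> e / 2"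
      proof -
        have "cmod (of_real t * z) = t * cmod z" using t by (simp add: norm_mult)
        also have "\<dots> \<le> t * (cmod z + 1)" using t by (intro mult_left_mono) auto
        also have "\<dots> = e / 2"
          unfolding t_def using z1 by (intro iffD1[OF nonzero_eq_divide_eq _] refl) simp
        finally show ?thesis .
      qed
      then have "p + (of_real t * z) *s b \<in> affine hull C"
        by (intro hull_inc) (auto simp: C_def)
      moreover have "p + 0 *s b \<in> affine hull C"
        by (intro hull_inc) (use e in \<open>auto simp: C_def intro!: exI[of _ 0]\<close>)
      ultimately have "(1 - 1 / t) *\<^sub>R (p + 0 *s b) + (1 / t) *\<^sub>R (p + (of_real t * z) *s b) \<in> affine hull C"
        by (intro mem_affine affine_affine_hull) auto
      moreover have "(1 - 1 / t) *\<^sub>R (p + 0 *s b) + (1 / t) *\<^sub>R (p + (of_real t * z) *s b) = y"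
        using t by (subst comb) (auto simp: y)
      ultimately show "y \<in> affine hull C" by simp
    qed
  qed
  have "p \<in> C" using e by (auto simp: C_def intro!: exI[of _ 0])
  moreover have "ball p (e / 2 * norm b) \<inter> L \<subseteq> C"
  proof
    fix y assume "y \<in> ball p (e / 2 * norm b) \<inter> L"
    then obtain z where y: "y = p + z *s b" "y \<in> ball p (e / 2 * norm b)"
      by (auto simp: L_def)
    then have "norm (z *s b) < e / 2 * norm b" by (simp add: dist_norm)
    then have "cmod z \<le> e / 2" using b by (simp add: norm_cscale)
    then show "y \<in> C" using y by (auto simp: C_def)
  qed
  ultimately have "p \<in> rel_interior C"
    unfolding mem_rel_interior_ball hull using e b by (intro conjI exI[of _ "e / 2 * norm b"]) auto
  moreover have "complex_one_dim_convex C"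
    unfolding complex_one_dim_convex_def hull L_def using convC b by blast
  ultimately show ?thesis using CZ by blast
qed

section \<open>Circle means of quadratic polynomials\<close>

lemma has_integral_trig_quadratic:
  "((\<lambda>t. \<alpha> + cos t * \<beta> + sin t * \<gamma> + (cos t)\<^sup>2 * A + 2 * (sin t * cos t) * B + (sin t)\<^sup>2 * C)
     has_integral 2 * pi * \<alpha> + pi * A + pi * C) {0..2 * pi}"
proof -
  let ?F = "\<lambda>t. \<alpha> * t + sin t * \<beta> - cos t * \<gamma> + (t + sin t * cos t) / 2 * A + (sin t)\<^sup>2 * B + (t - sin t * cos t) / 2 * C"
  have "((\<lambda>t. \<alpha> + cos t * \<beta> + sin t * \<gamma> + (cos t)\<^sup>2 * A + 2 * (sin t * cos t) * B + (sin t)\<^sup>2 * C)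
     has_integral ?F (2 * pi) - ?F 0) {0..2 * pi}"
  proof (rule fundamental_theorem_of_calculus)
    fix t :: real
    have sc: "(sin t)\<^sup>2 = 1 - (cos t)\<^sup>2" by (simp add: sin_squared_eq)
    have "(?F has_real_derivative (\<alpha> + cos t * \<beta> + sin t * \<gamma> +
        (1 + (cos t * cos t - sin t * sin t)) / 2 * A + 2 * (sin t * cos t) * B +
        (1 - (cos t * cos t - sin t * sin t)) / 2 * C)) (at t)"
      by (auto intro!: derivative_eq_intros simp: field_simps)
    also have "(1 + (cos t * cos t - sin t * sin t)) / 2 = (cos t)\<^sup>2"
      using sc by (simp add: power2_eq_square)
    also have "(1 - (cos t * cos t - sin t * sin t)) / 2 = (sin t)\<^sup>2"
      using sc by (simp add: power2_eq_square)
    finally show "(?F has_vector_derivative (\<alpha> + cos t * \<beta> + sin t * \<gamma> + (cos t)\<^sup>2 * A +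
        2 * (sin t * cos t) * B + (sin t)\<^sup>2 * C)) (at t within {0..2 * pi})"
      by (simp add: has_real_derivative_iff_has_vector_derivative has_vector_derivative_at_within)
  qed simp
  then show ?thesis by (simp add: algebra_simps)
qed

text \<open>On a circle the polynomial is trigonometric, and its mean exceeds the value at the
  centre by half of \<open>G b b + G (\<i> *s b) (\<i> *s b)\<close>. So \<open>G\<close> may well
  be negative in some directions.\<close>

lemma submean_excess_quadratic:
  fixes G :: "complex ^ 'n::finite \<Rightarrow> complex ^ 'n \<Rightarrow> real"
  assumes add: "\<And>x y z. G (x + y) z = G x z + G y z" and scale: "\<And>r x y. G (r *\<^sub>R x) y = r * G x y"
    and sym: "\<And>x y. G x y = G y x"
    and pos: "\<And>b. G b b + G (\<i> *s b) (\<i> *s b) \<ge> 2 * \<delta> * (norm b)\<^sup>2"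
  shows "submean_excess UNIV \<delta> (\<lambda>x. inner l (x - p) + G (x - p) (x - p) + k)"
  unfolding submean_excess_def
proof (intro allI impI)
  fix a b :: "complex ^ 'n"
  define c where "c = \<i> *s b"
  define y where "y = a - p"
  have path: "a + cis t *s b - p = y + cos t *\<^sub>R b + sin t *\<^sub>R c" for t
    unfolding cscale_Re_Im[of "cis t"] by (simp add: y_def c_def)
  have add': "G z (x + y) = G z x + G z y" and scale': "G y (r *\<^sub>R x) = r * G y x" for x y z r
    using add sym scale by metis+
  let ?f = "\<lambda>x. inner l (x - p) + G (x - p) (x - p) + k"
  have e: "?f (a + cis t *s b) = ?f a + cos t * (inner l b + 2 * G y b) + sin t * (inner l c + 2 * G y c) +
      (cos t)\<^sup>2 * G b b + 2 * (sin t * cos t) * G b c + (sin t)\<^sup>2 * G c c" for t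
    unfolding path y_def[symmetric]
    by (simp add: add add' scale scale' inner_add_right power2_eq_square sym[of b y] sym[of c y] sym[of c b] algebra_simps)
  have "integral {0..2 * pi} (\<lambda>t. ?f (a + cis t *s b)) = 2 * pi * ?f a + pi * G b b + pi * G c c"
    unfolding e by (rule integral_unique[OF has_integral_trig_quadratic])
  moreover have "pi * (2 * \<delta> * (norm b)\<^sup>2) \<le> pi * (G b b + G c c)"
    using pos[of b] by (intro mult_left_mono) (auto simp: c_def)
  ultimately show "2 * pi * (?f a + \<delta> * (norm b)\<^sup>2) \<le> integral {0..2 * pi} (\<lambda>t. ?f (a + cis t *s b))"
    by (simp add: algebra_simps)
qed

text \<open>For convex \<open>Z\<close> and \<open>p\<close> in \<open>Z\<close>: the direction
  space of the smallest face of \<open>Z\<close> containing \<open>p\<close>.\<close>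

definition face_directions :: "'a::real_vector set \<Rightarrow> 'a \<Rightarrow> 'a set" where
  "face_directions Z p = {v. \<exists>e>0. p + e *\<^sub>R v \<in> Z \<and> p - e *\<^sub>R v \<in> Z}"

lemma convex_toward:
  fixes Z :: "'a::real_vector set"
  assumes "convex Z" "p \<in> Z" "p + k *\<^sub>R v \<in> Z" "0 \<le> e" "e \<le> k"
  shows "p + e *\<^sub>R v \<in> Z"
proof (cases "k = 0")
  case True then show ?thesis using assms by simp
next
  case False
  then have k: "k > 0" using assms by simp
  have "(1 - e / k) *\<^sub>R p + (e / k) *\<^sub>R (p + k *\<^sub>R v) \<in> Z"
    by (rule convexD[OF assms(1-3)]) (use assms k in \<open>auto simp: field_simps\<close>)
  moreover have "(1 - e / k) *\<^sub>R p + (e / k) *\<^sub>R (p + k *\<^sub>R v) = p + e *\<^sub>R v"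
    using k by (simp add: algebra_simps)
  ultimately show ?thesis by simp
qed

lemma face_directionsI:
  fixes Z :: "'a::real_vector set"
  assumes "convex Z" "p \<in> Z" "p + k *\<^sub>R v \<in> Z" "p - k' *\<^sub>R v \<in> Z" "k > 0" "k' > 0"
  shows "v \<in> face_directions Z p"
proof -
  have "p + min k k' *\<^sub>R v \<in> Z" by (rule convex_toward[OF assms(1-3)]) (use assms in auto)
  moreover have "p + min k k' *\<^sub>R (- v) \<in> Z"
    by (rule convex_toward[OF assms(1,2), of k']) (use assms in auto)
  ultimately show ?thesis
    unfolding face_directions_def using assms by (auto intro!: exI[of _ "min k k'"])
qed

lemma subspace_face_directions:
  fixes Z :: "'a::real_vector set"
  assumes Z: "convex Z" and p: "p \<in> Z"
  shows "subspace (face_directions Z p)"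
proof (rule subspaceI)
  show "0 \<in> face_directions Z p"
    using p by (auto simp: face_directions_def intro!: exI[of _ 1])
  fix v assume v: "v \<in> face_directions Z p"
  then obtain e where e: "e > 0" "p + e *\<^sub>R v \<in> Z" "p - e *\<^sub>R v \<in> Z"
    by (auto simp: face_directions_def)
  show "c *\<^sub>R v \<in> face_directions Z p" for c
  proof (cases "c = 0")
    case True
    then show ?thesis using p by (auto simp: face_directions_def intro!: exI[of _ 1])
  next
    case False
    have "(e / \<bar>c\<bar>) * c = e \<or> (e / \<bar>c\<bar>) * c = - e" using False by (auto simp: abs_if)
    then show ?thesis
      using e False unfolding face_directions_def by (auto intro!: exI[of _ "e / \<bar>c\<bar>"])
  qed
  fix w assume "w \<in> face_directions Z p"
  then obtain f where f: "f > 0" "p + f *\<^sub>R w \<in> Z" "p - f *\<^sub>R w \<in> Z"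
    by (auto simp: face_directions_def)
  define k where "k = min e f"
  have k: "k > 0" using e f by (simp add: k_def)
  have 1: "p + k *\<^sub>R v \<in> Z" "p + k *\<^sub>R w \<in> Z"
    using convex_toward[OF Z p e(2), of k] convex_toward[OF Z p f(2), of k] k by (auto simp: k_def)
  have 2: "p + k *\<^sub>R (- v) \<in> Z" "p + k *\<^sub>R (- w) \<in> Z"
    using convex_toward[OF Z p, of e "- v" k] convex_toward[OF Z p, of f "- w" k] k e f by (auto simp: k_def)
  have half: "(1 / 2) *\<^sub>R p + (1 / 2) *\<^sub>R p = p" by (simp flip: scaleR_add_left)
  have m: "p + (k / 2) *\<^sub>R (x + y) \<in> Z" if "p + k *\<^sub>R x \<in> Z" "p + k *\<^sub>R y \<in> Z" for x y
  proof -
    have "(1 / 2) *\<^sub>R (p + k *\<^sub>R x) + (1 / 2) *\<^sub>R (p + k *\<^sub>R y) \<in> Z"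
      by (rule convexD[OF Z that]) auto
    moreover have "(1 / 2) *\<^sub>R (p + k *\<^sub>R x) + (1 / 2) *\<^sub>R (p + k *\<^sub>R y) =
        ((1 / 2) *\<^sub>R p + (1 / 2) *\<^sub>R p) + (k / 2) *\<^sub>R (x + y)"
      by (simp add: scaleR_add_right)
    ultimately show ?thesis using half by simp
  qed
  have "p + (k / 2) *\<^sub>R (- v + - w) \<in> Z" by (rule m[OF 2])
  then have "p - (k / 2) *\<^sub>R (v + w) \<in> Z" by (simp add: scaleR_diff_right scaleR_add_right algebra_simps)
  then show "v + w \<in> face_directions Z p"
    unfolding face_directions_def using m[OF 1] k by (auto intro!: exI[of _ "k / 2"])
qed

text \<open>Extremality of the face: walking from \<open>p\<close> away from the combination and
  then averaging with \<open>p + y\<close> cancels \<open>y\<close> and leaves a point of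
  \<open>Z\<close> on the far side of \<open>p\<close> from \<open>p + x\<close>.\<close>

lemma face_directions_face:
  fixes Z :: "'a::real_vector set"
  assumes Z: "convex Z" and p: "p \<in> Z" and x: "p + x \<in> Z" "p + y \<in> Z"
    and l: "\<nu> > 0" "\<mu> \<ge> 0" "\<nu> + \<mu> = 1" and v: "\<nu> *\<^sub>R x + \<mu> *\<^sub>R y \<in> face_directions Z p"
  shows "x \<in> face_directions Z p"
proof -
  obtain e where e: "e > 0" "p - e *\<^sub>R (\<nu> *\<^sub>R x + \<mu> *\<^sub>R y) \<in> Z"
    using v by (auto simp: face_directions_def)
  \<comment> \<open>Chosen so that the weights \<open>\<beta> * (e * \<mu>)\<close> and
    \<open>\<beta>\<close> add up to 1 while the terms in \<open>y\<close> cancel.\<close>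
  define \<beta> where "\<beta> = 1 / (1 + e * \<mu>)"
  have pos: "1 + e * \<mu> > 0" using e l by (intro add_pos_nonneg) auto
  have \<beta>: "\<beta> > 0" "\<beta> * (e * \<mu>) + \<beta> = 1" using pos by (auto simp: \<beta>_def field_simps)
  have "(\<beta> * (e * \<mu>)) *\<^sub>R (p + y) + \<beta> *\<^sub>R (p - e *\<^sub>R (\<nu> *\<^sub>R x + \<mu> *\<^sub>R y)) \<in> Z"
    by (rule convexD[OF Z x(2) e(2)]) (use \<beta> e l in auto)
  moreover have "(\<beta> * (e * \<mu>)) *\<^sub>R (p + y) + \<beta> *\<^sub>R (p - e *\<^sub>R (\<nu> *\<^sub>R x + \<mu> *\<^sub>R y)) =
      (\<beta> * (e * \<mu>) + \<beta>) *\<^sub>R p - (\<beta> * (e * \<nu>)) *\<^sub>R x"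
    by (simp add: scaleR_add_right scaleR_diff_right scaleR_add_left mult_ac)
  ultimately have "p - (\<beta> * (e * \<nu>)) *\<^sub>R x \<in> Z" using \<beta>(2) by simp
  then show ?thesis
    by (intro face_directionsI[OF Z p, of 1 x "\<beta> * (e * \<nu>)"]) (use x \<beta> e l in auto)
qed

text \<open>The quadratic form \<open>- |x|\<^sup>2 + A |N x|\<^sup>2\<close>, where N has kernel V.\<close>

lemma totally_real_quadratic:
  fixes V :: "(complex ^ 'n::finite) set"
  assumes V: "subspace V" and tr: "\<And>b. b \<in> V \<Longrightarrow> \<i> *s b \<in> V \<Longrightarrow> b = 0"
  obtains G :: "complex ^ 'n \<Rightarrow> complex ^ 'n \<Rightarrow> real" where
    "\<And>x y z. G (x + y) z = G x z + G y z" "\<And>r x y. G (r *\<^sub>R x) y = r * G x y" "\<And>x y. G x y = G y x"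
    "\<And>b. G b b + G (\<i> *s b) (\<i> *s b) \<ge> (norm b)\<^sup>2" "\<And>x. x \<in> V \<Longrightarrow> G x x = - (norm x)\<^sup>2"
    "continuous_on UNIV (\<lambda>x. G x x)"
proof -
  obtain B where B: "B \<subseteq> orthogonal_comp V" "independent B" "orthogonal_comp V \<subseteq> span B"
    "card B = dim (orthogonal_comp V)"
    by (rule basis_exists)
  have fB: "finite B" using B(2) independent_imp_finite by blast
  define N where "N = (\<lambda>x. \<Sum>b\<in>B. (inner b x)\<^sup>2)"
  have N0: "N x = 0 \<longleftrightarrow> x \<in> V" for x
  proof
    assume "N x = 0"
    then have "\<And>b. b \<in> B \<Longrightarrow> orthogonal x b"
      using fB by (simp add: N_def sum_nonneg_eq_0_iff orthogonal_def inner_commute)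
    then have "orthogonal x y" if "y \<in> orthogonal_comp V" for y
      using orthogonal_to_span B(3) that by blast
    then have "x \<in> orthogonal_comp (orthogonal_comp V)"
      by (simp add: orthogonal_comp_def orthogonal_commute)
    then show "x \<in> V" using orthogonal_comp_self[OF V] by simp
  next
    assume "x \<in> V"
    then have "inner b x = 0" if "b \<in> B" for b
      using B(1) that by (auto simp: orthogonal_comp_def orthogonal_def inner_commute)
    then show "N x = 0" by (simp add: N_def)
  qed
  have N_nn: "N x \<ge> 0" for x by (simp add: N_def sum_nonneg)
  have Ns: "N (r *\<^sub>R x) = r\<^sup>2 * N x" for r x
    by (simp add: N_def power_mult_distrib sum_distrib_left)
  have Nc: "continuous_on S N" for S
    unfolding N_def by (intro continuous_intros)
  have ic: "continuous_on S (\<lambda>x :: complex ^ 'n. \<i> *s x)" for S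
    unfolding vector_scalar_mult_def by (intro continuous_intros)
  \<comment> \<open>Positive off the origin exactly because \<open>V\<close> is totally real:
    \<open>g x = 0\<close> puts both \<open>x\<close> and \<open>\<i> *s x\<close> into
    \<open>V\<close>.\<close>
  define g where "g = (\<lambda>x. N x + N (\<i> *s x))"
  have gc: "continuous_on S g" for S
    unfolding g_def by (intro continuous_intros Nc continuous_on_compose2[OF Nc[of UNIV] ic]) auto
  have gs: "g (r *\<^sub>R x) = r\<^sup>2 * g x" for r x
  proof -
    have "\<i> *s (r *\<^sub>R x) = r *\<^sub>R (\<i> *s x)" by (simp add: vec_eq_iff)
    then show ?thesis by (simp add: g_def Ns algebra_simps)
  qed
  have gpos: "g x > 0" if "x \<noteq> 0" for x
  proof -
    have "g x \<noteq> 0"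
      using tr[of x] N0[of x] N0[of "\<i> *s x"] N_nn[of x] N_nn[of "\<i> *s x"] that by (auto simp: g_def)
    then show ?thesis using N_nn[of x] N_nn[of "\<i> *s x"] by (simp add: g_def)
  qed
  have "\<exists>x\<in>sphere 0 1. \<forall>y\<in>sphere 0 1. g x \<le> g (y :: complex ^ 'n)"
  proof (rule continuous_attains_inf[OF _ _ gc])
    obtain j :: 'n where True by blast
    have "axis j 1 \<in> sphere (0 :: complex ^ 'n) 1" by simp
    then show "sphere (0 :: complex ^ 'n) 1 \<noteq> {}" by blast
  qed simp
  then obtain x0 where x0: "norm (x0 :: complex ^ 'n) = 1" "\<And>y. norm y = 1 \<Longrightarrow> g x0 \<le> g y" by auto
  define m where "m = g x0"
  have m: "m > 0" unfolding m_def using x0(1) by (intro gpos) auto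
  have gm: "m * (norm x)\<^sup>2 \<le> g x" for x
  proof (cases "x = 0")
    case False
    have "m \<le> g ((1 / norm x) *\<^sub>R x)" unfolding m_def using False by (intro x0(2)) simp
    then show ?thesis using False by (simp add: gs field_simps power2_eq_square)
  qed (use N_nn in \<open>simp add: g_def\<close>)
  \<comment> \<open>Summed over \<open>b\<close> and \<open>\<i> *s b\<close>, the negative part
    gives \<open>- 2 * (norm b)\<^sup>2\<close>, while
    \<open>g b \<ge> m * (norm b)\<^sup>2\<close>; the factor \<open>3 / m\<close> leaves one
    squared norm.\<close>
  define G where "G = (\<lambda>x y. - inner x y + (3 / m) * (\<Sum>b\<in>B. inner b x * inner b y))"
  have Gx: "G x x = - (norm x)\<^sup>2 + (3 / m) * N x" for x
    unfolding G_def N_def dot_square_norm by (simp add: power2_eq_square)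
  show ?thesis
  proof (rule that)
    show "G (x + y) z = G x z + G y z" for x y z
      by (simp add: G_def inner_add_left inner_add_right sum.distrib add_divide_distrib algebra_simps)
    show "G (r *\<^sub>R x) y = r * G x y" for r x y
      by (simp add: G_def sum_distrib_left algebra_simps)
    show "G x y = G y x" for x y
      by (simp add: G_def inner_commute mult.commute)
    show "G x x = - (norm x)\<^sup>2" if "x \<in> V" for x
      using N0[of x] that by (simp add: Gx)
    show "continuous_on UNIV (\<lambda>x. G x x)"
      unfolding Gx by (intro continuous_intros Nc)
    fix b :: "complex ^ 'n"
    have "norm (\<i> *s b) = norm b" by (simp add: norm_cscale)
    then have "G b b + G (\<i> *s b) (\<i> *s b) = - 2 * (norm b)\<^sup>2 + (3 / m) * g b"
      by (simp add: Gx g_def algebra_simps)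
    moreover have "(3 / m) * g b \<ge> (3 / m) * (m * (norm b)\<^sup>2)"
      using m by (intro mult_left_mono gm) auto
    ultimately show "(norm b)\<^sup>2 \<le> G b b + G (\<i> *s b) (\<i> *s b)" using m by simp
  qed
qed

text \<open>The hull of the graph has to miss the whole ray over \<open>p\<close>, although
  \<open>G\<close> may be positive off the face. The face property settles this: a convex
  combination of points of \<open>Z - p\<close> is a face direction only if all terms of positive
  weight are, and there \<open>G\<close> is negative on the sphere.\<close>

lemma psh_peak_function:
  fixes Z :: "(complex ^ 'n::finite) set"
  assumes Z: "convex Z" and p: "p \<in> Z" and r: "r > 0" and X: "compact (Z \<inter> sphere p r)"
    and tr: "\<And>b. b \<in> face_directions Z p \<Longrightarrow> \<i> *s b \<in> face_directions Z p \<Longrightarrow> b = 0"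
  obtains \<psi> :: "complex ^ 'n \<Rightarrow> real" and \<delta> where "\<delta> > 0" "continuous_on UNIV \<psi>"
    "submean_excess UNIV \<delta> \<psi>" "\<psi> p > 0" "\<And>x. x \<in> Z \<inter> sphere p r \<Longrightarrow> \<psi> x < 0"
proof -
  let ?V = "face_directions Z p" and ?X = "Z \<inter> sphere p r"
  obtain G :: "complex ^ 'n \<Rightarrow> complex ^ 'n \<Rightarrow> real" where
    G: "\<And>x y z. G (x + y) z = G x z + G y z" "\<And>r x y. G (r *\<^sub>R x) y = r * G x y" "\<And>x y. G x y = G y x"
      "\<And>b. G b b + G (\<i> *s b) (\<i> *s b) \<ge> (norm b)\<^sup>2" "\<And>x. x \<in> ?V \<Longrightarrow> G x x = - (norm x)\<^sup>2"
      "continuous_on UNIV (\<lambda>x. G x x)"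
    using totally_real_quadratic[OF subspace_face_directions[OF Z p] tr] by blast
  have "\<exists>l s \<beta>. s \<ge> 0 \<and> \<beta> < 0 \<and> (\<forall>x\<in>?X. inner l (x - p) + s * G (x - p) (x - p) < \<beta>)"
  proof (cases "?X = {}")
    case True
    then show ?thesis by (intro exI[of _ 0] exI[of _ "-1"]) auto
  next
    case False
    define q where "q = (\<lambda>x. (x - p, G (x - p) (x - p)))"
    \<comment> \<open>Heights are free away from the face directions and negative over them;
      convexity of this set is the face property.\<close>
    define M where "M = {(y, t). p + y \<in> Z \<and> (y \<in> ?V \<longrightarrow> t < (0::real))}"
    define R where "R = {(0 :: complex ^ 'n)} \<times> {0 :: real..}"
    have qc: "compact (q ` ?X)"
      unfolding q_def
      by (intro compact_continuous_image X continuous_on_Pair continuous_intros continuous_on_compose2[OF G(6)]) auto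
    have qM: "q ` ?X \<subseteq> M"
    proof
      fix a assume "a \<in> q ` ?X"
      then obtain x where x: "a = q x" "x \<in> Z" "norm (x - p) = r"
        by (auto simp: dist_norm norm_minus_commute)
      then show "a \<in> M" using r G(5)[of "x - p"] by (auto simp: q_def M_def)
    qed
    have "convex M"
      unfolding convex_def
    proof (intro ballI allI impI)
      fix a b and u v :: real assume ab: "a \<in> M" "b \<in> M" and uv: "0 \<le> u" "0 \<le> v" "u + v = 1"
      obtain y t y' t' where a: "a = (y, t)" "p + y \<in> Z" "y \<in> ?V \<longrightarrow> t < 0"
        and b: "b = (y', t')" "p + y' \<in> Z" "y' \<in> ?V \<longrightarrow> t' < 0"
        using ab by (auto simp: M_def)
      have "u *\<^sub>R (p + y) + v *\<^sub>R (p + y') \<in> Z" by (rule convexD[OF Z a(2) b(2) uv])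
      moreover have "u *\<^sub>R (p + y) + v *\<^sub>R (p + y') = (u + v) *\<^sub>R p + (u *\<^sub>R y + v *\<^sub>R y')"
        by (simp add: scaleR_add_right scaleR_add_left)
      ultimately have 1: "p + (u *\<^sub>R y + v *\<^sub>R y') \<in> Z" using uv by simp
      have 2: "u * t + v * t' < 0" if V: "u *\<^sub>R y + v *\<^sub>R y' \<in> ?V"
      proof -
        have y: "u > 0 \<Longrightarrow> t < 0"
          using face_directions_face[OF Z p a(2) b(2) _ uv(2,3) V] a(3) by blast
        have "v *\<^sub>R y' + u *\<^sub>R y \<in> ?V" using V by (simp add: add.commute)
        then have y': "v > 0 \<Longrightarrow> t' < 0"
          using face_directions_face[OF Z p b(2) a(2) _ uv(1)] uv(3) b(3) by (simp add: add.commute)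
        show ?thesis
        proof (cases "u = 0")
          case True then show ?thesis using y' uv by simp
        next
          case False
          then have "u * t < 0" using y uv(1) by (simp add: mult_pos_neg)
          moreover have "v * t' \<le> 0" using y' uv(2) by (cases "v = 0") (auto simp: mult_nonneg_nonpos less_imp_le)
          ultimately show ?thesis by simp
        qed
      qed
      show "u *\<^sub>R a + v *\<^sub>R b \<in> M" using 1 2 by (auto simp: M_def a(1) b(1))
    qed
    then have "convex hull (q ` ?X) \<subseteq> M" using qM by (intro hull_minimal)
    moreover have "M \<inter> R = {}"
    proof -
      have "0 \<in> ?V" using subspace_0[OF subspace_face_directions[OF Z p]] .
      then show ?thesis by (auto simp: M_def R_def)
    qed
    ultimately have "convex hull (q ` ?X) \<inter> R = {}" by blast
    moreover have "convex R" "closed R"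
      unfolding R_def by (intro convex_Times closed_Times; simp)+
    ultimately obtain a b where ab: "\<forall>x\<in>convex hull (q ` ?X). inner a x < b" "\<forall>x\<in>R. inner a x > b"
      using separating_hyperplane_compact_closed[of "convex hull (q ` ?X)" R]
        compact_convex_hull[OF qc] False by (auto simp: convex_convex_hull)
    obtain l s where a: "a = (l, s)" by (cases a)
    have st: "s * t > b" if "t \<ge> 0" for t
      using ab(2) that by (auto simp: R_def a inner_prod_def)
    have b: "b < 0" using st[of 0] by simp
    \<comment> \<open>The ray is unbounded upwards, so the separating functional cannot decrease
      along it.\<close>
    have s: "s \<ge> 0"
    proof (rule ccontr)
      assume "\<not> s \<ge> 0"
      then show False using st[of "b / s"] b by (simp add: divide_nonpos_neg)
    qed
    have "inner l (x - p) + s * G (x - p) (x - p) < b" if "x \<in> ?X" for x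
    proof -
      have "q x \<in> convex hull (q ` ?X)" using that by (intro hull_inc) blast
      then have "inner a (q x) < b" using ab(1) by blast
      then show ?thesis by (simp add: a q_def inner_prod_def)
    qed
    then show ?thesis using s b by blast
  qed
  then obtain l s \<beta> where ls: "s \<ge> 0" "\<beta> < 0" "\<And>x. x \<in> ?X \<Longrightarrow> inner l (x - p) + s * G (x - p) (x - p) < \<beta>"
    by blast
  \<comment> \<open>\<open>d * r\<^sup>2\<close> and the added constant both equal
    \<open>- \<beta> / 4\<close>: on \<open>?X\<close> the value stays below
    \<open>\<beta> / 2\<close>, at \<open>p\<close> it is positive. The new term also supplies
    strictness in case \<open>s = 0\<close>.\<close>
  define d where "d = - \<beta> / (4 * r\<^sup>2)"
  have d: "d > 0" using ls r by (simp add: d_def divide_neg_pos)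
  define G' where "G' = (\<lambda>x y. s * G x y + d * inner x y)"
  define \<psi> where "\<psi> = (\<lambda>x. inner l (x - p) + G' (x - p) (x - p) + (- \<beta> / 4))"
  show ?thesis
  proof (rule that)
    show "d > 0" by (rule d)
    show "continuous_on UNIV \<psi>"
      unfolding \<psi>_def G'_def by (intro continuous_intros continuous_on_compose2[OF G(6)]) auto
    show "submean_excess UNIV d \<psi>"
      unfolding \<psi>_def
    proof (rule submean_excess_quadratic[where G=G' and l=l and p=p and k="- \<beta> / 4"])
      show "G' (x + y) z = G' x z + G' y z" for x y z
        by (simp add: G'_def G(1) inner_add_left algebra_simps)
      show "G' (r *\<^sub>R x) y = r * G' x y" for r x y
        by (simp add: G'_def G(2) algebra_simps)
      show "G' x y = G' y x" for x y
        using G(3)[of x y] by (simp add: G'_def inner_commute)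
      fix b :: "complex ^ 'n"
      have "s * (G b b + G (\<i> *s b) (\<i> *s b)) \<ge> 0"
        using ls(1) G(4)[of b] order_trans[OF zero_le_power2 G(4)[of b]] by (intro mult_nonneg_nonneg) auto
      moreover have "norm (\<i> *s b) = norm b" by (simp add: norm_cscale)
      ultimately show "2 * d * (norm b)\<^sup>2 \<le> G' b b + G' (\<i> *s b) (\<i> *s b)"
        by (simp add: G'_def algebra_simps flip: power2_norm_eq_inner)
    qed
    have "G 0 0 = 0" using G(2)[of 0 0 0] by simp
    then show "\<psi> p > 0" using ls(2) by (simp add: \<psi>_def G'_def)
    fix x assume x: "x \<in> ?X"
    then have "norm (x - p) = r" by (auto simp: dist_norm norm_minus_commute)
    then have "d * inner (x - p) (x - p) = - \<beta> / 4"
      using r by (simp add: d_def flip: power2_norm_eq_inner)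
    then show "\<psi> x < 0" using ls(2) ls(3)[OF x] by (simp add: \<psi>_def G'_def)
  qed
qed

section \<open>Comparison with the peak function\<close>

lemma ddf_locally_const:
  assumes "open S" "x \<in> S" "\<And>y. y \<in> S \<Longrightarrow> \<phi> y = k"
  shows "ddf (\<lambda>x ws. \<phi> x) x ws = 0"
proof -
  have "wd \<i> \<phi> y v = 0" if "y \<in> S" for y v
  proof -
    have "(\<phi> has_derivative (\<lambda>v. 0)) (at y)"
      by (rule has_derivative_transform_within_open[of "\<lambda>_. k" _ _ _ S]) (use assms that in auto)
    then show ?thesis by (simp add: wd_def frechet_derivative_eqI)
  qed
  then show ?thesis
    unfolding ddf_def wdf_def by (intro wd_eq_0_open[OF assms(1,2)])
qed

lemma closed_Collect_le_on:
  fixes f g :: "'a::topological_space \<Rightarrow> real"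
  assumes "closed S" "continuous_on S f" "continuous_on S g"
  shows "closed {x \<in> S. f x \<le> g x}"
proof -
  have "closed (S \<inter> (\<lambda>x. g x - f x) -` {0..})"
    by (intro continuous_closed_preimage continuous_on_diff assms closed_atLeast)
  moreover have "S \<inter> (\<lambda>x. g x - f x) -` {0..} = {x \<in> S. f x \<le> g x}" by auto
  ultimately show ?thesis by simp
qed

text \<open>The two strict hypotheses feed opposite ends of the estimate: \<open>v < u\<close> on
  the sphere yields a shell on which the maximum is \<open>u\<close>, and
  \<open>\<delta> > 0\<close> yields a lower bound for the mass near \<open>p\<close>.\<close>

lemma comparison_quadratic:
  fixes D :: "(complex ^ 'n::finite) set"
  assumes D: "open D" and psh: "plurisubharmonic_on D u" and u: "continuous_on D u"
    and ma: "monge_ampere_zero D u"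
    and r: "r > 0" "cball p r \<subseteq> D"
    and v: "continuous_on UNIV v" "submean_excess UNIV \<delta> v" "\<delta> > 0"
    and bdry: "\<And>x. x \<in> sphere p r \<Longrightarrow> v x < u x"
  shows "v p \<le> u p"
proof (rule ccontr)
  assume "\<not> v p \<le> u p"
  then have vp: "u p < v p" by simp
  let ?B = "cball p r"
  have ub: "continuous_on S u" if "S \<subseteq> ?B" for S
    using u r(2) that continuous_on_subset by blast
  have vc: "continuous_on S v" for S using v(1) continuous_on_subset by blast
  have pB: "p \<in> ?B" using r by simp
  obtain s where s: "s > 0" "s < r" "\<And>x. dist x p \<le> s \<Longrightarrow> u x < v x"
  proof -
    have "continuous_on ?B (\<lambda>x. v x - u x)" by (intro continuous_intros ub vc) simp
    then obtain d where d: "d > 0" "\<And>x. x \<in> ?B \<Longrightarrow> dist x p < d \<Longrightarrow> dist (v x - u x) (v p - u p) < v p - u p"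
      using pB vp unfolding continuous_on_iff by (metis diff_gt_0_iff_gt)
    define s where "s = min (d / 2) (r / 2)"
    have s: "s > 0" "s < r" "s < d" using d r by (auto simp: s_def)
    have "u x < v x" if "dist x p \<le> s" for x
    proof -
      have "x \<in> ?B" "dist x p < d" using that s by (auto simp: dist_commute)
      from d(2)[OF this] show ?thesis by (simp add: dist_real_def)
    qed
    then show ?thesis using that s by blast
  qed
  \<comment> \<open>The largest distance from \<open>p\<close> at which \<open>u \<le> v\<close>
    still happens in the ball.\<close>
  obtain r0 where r0: "0 \<le> r0" "r0 < r" "\<And>x. x \<in> ?B \<Longrightarrow> dist x p > r0 \<Longrightarrow> v x < u x"
  proof -
    let ?A = "{x \<in> ?B. u x \<le> v x}"
    have "closed ?A"
      by (rule closed_Collect_le_on[OF closed_cball ub vc]) simp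
    moreover have "bounded ?A" by (rule bounded_subset[OF bounded_cball]) auto
    ultimately have cA: "compact ?A" by (simp add: compact_eq_bounded_closed)
    have "p \<in> ?A" using vp pB by simp
    then have ne: "?A \<noteq> {}" by blast
    have "continuous_on ?A (\<lambda>x. dist x p)" by (intro continuous_intros)
    from continuous_attains_sup[OF cA ne this]
    obtain a where a: "a \<in> ?A" "\<And>x. x \<in> ?A \<Longrightarrow> dist x p \<le> dist a p" by blast
    have "dist a p \<noteq> r" using a(1) bdry[of a] by (auto simp: dist_commute)
    then have "dist a p < r" using a(1) by (auto simp: dist_commute)
    moreover have "v x < u x" if "x \<in> ?B" "dist x p > dist a p" for x
      using a(2)[of x] that by force
    ultimately show ?thesis by (intro that[of "dist a p"]) auto
  qed
  \<comment> \<open>Nine equal layers between \<open>r0\<close> and \<open>r\<close>: the cutoff is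
    1 up to the second and 0 beyond the sixth, and a kernel or a circle in the plurisubharmonicity
    estimate on \<open>K0\<close> reaches across at most one layer each.\<close>
  define g where "g = (r - r0) / 9"
  have g: "g > 0" "r0 + 9 * g = r" using r0(1,2) by (simp_all add: g_def field_simps)
  \<comment> \<open>\<open>s / 4\<close> leaves room for the strict estimate on \<open>N\<close>
    inside \<open>ball p s\<close>; 1 allows a single box for all kernels.\<close>
  define \<epsilon>0 where "\<epsilon>0 = min g (min (s / 4) 1)"
  have \<epsilon>0: "\<epsilon>0 > 0" "\<epsilon>0 \<le> g" "\<epsilon>0 \<le> s / 4" "\<epsilon>0 \<le> 1" using g s by (auto simp: \<epsilon>0_def)
  \<comment> \<open>The convolution wants a function continuous on the whole space, so the maximum
    is extended from the ball by the nearest-point projection.\<close>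
  define W where "W = (\<lambda>x. max (u (closest_point ?B x)) (v (closest_point ?B x)))"
  have cpc: "continuous_on UNIV (closest_point ?B)"
    by (rule continuous_on_closest_point) (use r in auto)
  have cpB: "closest_point ?B x \<in> ?B" for x
    by (rule closest_point_in_set) (use r in auto)
  have Wc: "continuous_on UNIV W"
    unfolding W_def
    by (intro continuous_on_max continuous_on_compose2[OF ub[OF subset_refl] cpc] continuous_on_compose2[OF vc[of UNIV] cpc])
      (use cpB in auto)
  have WB: "W x = max (u x) (v x)" if "x \<in> ?B" for x
    using closest_point_self[OF that] by (simp add: W_def)
  have Wu: "W x = u x" if "x \<in> ?B" "dist x p > r0" for x
    using WB[OF that(1)] r0(3)[OF that] by simp
  have Wv: "W x = v x" if "dist x p \<le> s" for x
  proof -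
    have "x \<in> ?B" using that s by (simp add: dist_commute)
    then show ?thesis using WB s(3)[OF that] by simp
  qed
  have disc: "cmod (cis t) \<le> 1" for t by simp
  have W_int: "(\<lambda>t. W (a + cis t *s b)) integrable_on {0..2 * pi}" for a b
    by (intro integrable_continuous_real continuous_on_compose2[OF Wc continuous_cis_path]) auto
  have sub0: "submean_excess (ball p r) 0 W"
    unfolding submean_excess_def
  proof (intro allI impI)
    fix a b assume ab: "\<forall>z. cmod z \<le> 1 \<longrightarrow> a + z *s b \<in> ball p r"
    have B: "a + cis t *s b \<in> ?B" for t using ab disc[of t] by fastforce
    have "a + 0 *s b \<in> ball p r" using ab[rule_format, of 0] by simp
    then have aB: "a \<in> ?B" by simp
    have "\<forall>z. cmod z \<le> 1 \<longrightarrow> a + z *s b \<in> D"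
      using ab r(2) ball_subset_cball by blast
    then have U: "(\<lambda>t. u (a + cis t *s b)) absolutely_integrable_on {0..2 * pi}"
      "u a \<le> integral {0..2 * pi} (\<lambda>t. u (a + cis t *s b)) / (2 * pi)"
      using psh unfolding plurisubharmonic_on_def by blast+
    have "integral {0..2 * pi} (\<lambda>t. u (a + cis t *s b)) \<le> integral {0..2 * pi} (\<lambda>t. W (a + cis t *s b))"
      by (rule integral_le[OF _ W_int])
        (use U(1) set_lebesgue_integral_eq_integral(1) WB[OF B] in auto)
    then have 1: "2 * pi * u a \<le> integral {0..2 * pi} (\<lambda>t. W (a + cis t *s b))"
      using U(2) by (simp add: field_simps)
    have "2 * pi * (v a + \<delta> * (norm b)\<^sup>2) \<le> integral {0..2 * pi} (\<lambda>t. v (a + cis t *s b))"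
      using v(2) unfolding submean_excess_def by blast
    also have "\<dots> \<le> integral {0..2 * pi} (\<lambda>t. W (a + cis t *s b))"
      by (rule integral_le[OF _ W_int])
        (use WB[OF B] in \<open>auto intro!: integrable_continuous_real continuous_on_compose2[OF vc[of UNIV] continuous_cis_path]\<close>)
    finally have "2 * pi * v a + 2 * pi * (\<delta> * (norm b)\<^sup>2) \<le> integral {0..2 * pi} (\<lambda>t. W (a + cis t *s b))"
      by (simp add: algebra_simps)
    moreover have "2 * pi * (\<delta> * (norm b)\<^sup>2) \<ge> 0" using v(3) by simp
    ultimately show "2 * pi * (W a + 0 * (norm b)\<^sup>2) \<le> integral {0..2 * pi} (\<lambda>t. W (a + cis t *s b))"
      using 1 WB[OF aB] by (simp add: max_def)
  qed
  have sub1: "submean_excess (ball p s) \<delta> W"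
    unfolding submean_excess_def
  proof (intro allI impI)
    fix a b assume ab: "\<forall>z. cmod z \<le> 1 \<longrightarrow> a + z *s b \<in> ball p s"
    have "W (a + cis t *s b) = v (a + cis t *s b)" for t
      using ab[rule_format, of "cis t"] by (intro Wv) (simp add: dist_commute)
    moreover have "W a = v a"
      using ab[rule_format, of 0] by (intro Wv) (simp add: dist_commute)
    ultimately show "2 * pi * (W a + \<delta> * (norm b)\<^sup>2) \<le> integral {0..2 * pi} (\<lambda>t. W (a + cis t *s b))"
      using v(2) unfolding submean_excess_def by simp
  qed
  obtain \<beta> where \<beta>: "\<And>x z. x \<in> cball p r \<Longrightarrow> z \<in> cbox (- One) One \<Longrightarrow> x - z \<in> cbox (- \<beta>) \<beta>"
  proof -
    have "bounded ((\<lambda>q. fst q - snd q) ` (cball p r \<times> cbox (- One) One))"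
      by (intro compact_imp_bounded compact_continuous_image compact_Times compact_cball compact_cbox continuous_intros)
    then obtain \<beta> where "(\<lambda>q. fst q - snd q) ` (cball p r \<times> cbox (- One) One) \<subseteq> cbox (- \<beta>) \<beta>"
      using bounded_subset_cbox_symmetric by blast
    then show ?thesis by (intro that[of \<beta>]) force
  qed
  have box: "x - z \<in> cbox (- \<beta>) \<beta>" if "x \<in> ?B" "z \<in> cbox (- (\<epsilon> *\<^sub>R One)) (\<epsilon> *\<^sub>R One)" "\<epsilon> \<le> \<epsilon>0" for x z \<epsilon>
  proof (rule \<beta>[OF that(1)])
    show "z \<in> cbox (- One) One" using that(2,3) \<epsilon>0(4) by (force simp: mem_box)
  qed
  define mol where "mol = (\<lambda>\<epsilon> (\<rho> :: complex ^ 'n \<Rightarrow> real). smooth \<rho> \<and> (\<forall>x. \<rho> x \<ge> 0) \<and> (\<forall>x. norm x \<ge> \<epsilon> \<longrightarrow> \<rho> x = 0) \<and>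
      (\<rho> has_integral 1) (cbox (- (\<epsilon> *\<^sub>R One)) (\<epsilon> *\<^sub>R One)))"
  have mol_ex: "\<exists>\<rho>. mol \<epsilon> \<rho>" if "\<epsilon> > 0" for \<epsilon>
    using mollifier[OF that] unfolding mol_def by metis
  define H where "H = {\<lambda>x. complex_of_real (conv \<beta> \<rho> W x) |\<epsilon> \<rho>. 0 < \<epsilon> \<and> \<epsilon> \<le> \<epsilon>0 \<and> mol \<epsilon> \<rho>}"
  have H_smooth: "smooth h" if "h \<in> H" for h
    using that unfolding H_def mol_def
    by (auto intro!: smooth_linear_comp[OF bounded_linear_of_real] smooth_conv[OF Wc])
  have H_real: "cnj (h x) = h x" if "h \<in> H" for h x using that by (auto simp: H_def)
  define K0 where "K0 = cball p (r0 + 6 * g)"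
  \<comment> \<open>The shell outside which \<open>dd\<^sup>c \<phi>\<close> will vanish; on it and
    within one layer of it \<open>W = u\<close>.\<close>
  define K where "K = K0 - ball p (r0 + 2 * g)"
  \<comment> \<open>At most \<open>g\<close>, so that the cutoff is 1 on \<open>N\<close>, and at
    most \<open>s / 4\<close> for the strict Levi bound.\<close>
  define n0 where "n0 = min (s / 4) g"
  define N where "N = cball p n0"
  have n0: "n0 > 0" using s g by (simp add: n0_def)
  have K0: "compact K0" "K0 \<subseteq> D" "K0 \<subseteq> ?B"
    using r(2) g by (auto simp: K0_def)
  have K: "compact K" "K \<subseteq> D" "K \<subseteq> ?B"
    using K0 by (auto simp: K_def intro: compact_diff)
  have N: "compact N" "N \<subseteq> K0" using r0 g by (auto simp: N_def K0_def n0_def)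
  have tri: "dist y p \<le> norm (y - x) + dist x p" for x y
    using dist_triangle[of y p x] by (simp add: dist_norm)
  have H_psh: "Re (levi h x w w) \<ge> 0" if h: "h \<in> H" and x: "x \<in> K0" for h x w
  proof -
    obtain \<epsilon> \<rho> where e: "h = (\<lambda>x. complex_of_real (conv \<beta> \<rho> W x))" "0 < \<epsilon>" "\<epsilon> \<le> \<epsilon>0" "mol \<epsilon> \<rho>"
      using h by (auto simp: H_def)
    note m = e(4)[unfolded mol_def]
    have xp: "dist x p \<le> r0 + 6 * g" using x by (simp add: K0_def dist_commute)
    have "Re (levi (\<lambda>x. complex_of_real (conv \<beta> \<rho> W x)) x w w) \<ge> 0 * (norm w)\<^sup>2"
    proof (rule conv_levi[OF Wc _ _ _ _ sub0 g(1)])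
      show "y \<in> ball p r" if "norm (y - x) \<le> \<epsilon> + g" for y
        using tri[of y x] that xp e(3) \<epsilon>0(2) g by (simp add: dist_commute)
      show "y - z \<in> cbox (- \<beta>) \<beta>"
        if "norm (y - x) \<le> g" "z \<in> cbox (- (\<epsilon> *\<^sub>R One)) (\<epsilon> *\<^sub>R One)" for y z
        by (rule box[OF _ that(2) e(3)]) (use tri[of y x] that(1) xp g in \<open>simp add: dist_commute\<close>)
    qed (use m in auto)
    then show ?thesis by (simp add: e(1))
  qed
  have H_strict: "Re (levi h x w w) \<ge> \<delta> * (norm w)\<^sup>2" if h: "h \<in> H" and x: "x \<in> N" for h x w
  proof -
    obtain \<epsilon> \<rho> where e: "h = (\<lambda>x. complex_of_real (conv \<beta> \<rho> W x))" "0 < \<epsilon>" "\<epsilon> \<le> \<epsilon>0" "mol \<epsilon> \<rho>"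
      using h by (auto simp: H_def)
    note m = e(4)[unfolded mol_def]
    have xp: "dist x p \<le> s / 4" using x by (simp add: N_def n0_def dist_commute)
    have s4: "s / 4 > 0" using s by simp
    have "Re (levi (\<lambda>x. complex_of_real (conv \<beta> \<rho> W x)) x w w) \<ge> \<delta> * (norm w)\<^sup>2"
    proof (rule conv_levi[OF Wc _ _ _ _ sub1 s4])
      show "y \<in> ball p s" if "norm (y - x) \<le> \<epsilon> + s / 4" for y
        using tri[of y x] that xp e(3) \<epsilon>0(3) s(1) by (simp add: dist_commute)
      show "y - z \<in> cbox (- \<beta>) \<beta>"
        if "norm (y - x) \<le> s / 4" "z \<in> cbox (- (\<epsilon> *\<^sub>R One)) (\<epsilon> *\<^sub>R One)" for y z
        by (rule box[OF _ that(2) e(3)]) (use tri[of y x] that(1) xp s in \<open>simp add: dist_commute\<close>)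
    qed (use m in auto)
    then show ?thesis by (simp add: e(1))
  qed
  have approx: "\<exists>h\<in>H. \<forall>x\<in>K. norm (h x - of_real (u x)) \<le> \<gamma>" if \<gamma>: "\<gamma> > 0" for \<gamma>
  proof -
    have "uniformly_continuous_on ?B W"
      by (rule compact_uniformly_continuous) (use Wc continuous_on_subset in auto)
    then obtain d where d: "d > 0" "\<And>x y. x \<in> ?B \<Longrightarrow> y \<in> ?B \<Longrightarrow> dist y x < d \<Longrightarrow> dist (W y) (W x) < \<gamma>"
      using \<gamma> unfolding uniformly_continuous_on_def by metis
    define \<epsilon> where "\<epsilon> = min \<epsilon>0 (d / 2)"
    have \<epsilon>: "0 < \<epsilon>" "\<epsilon> \<le> \<epsilon>0" "\<epsilon> < d" using \<epsilon>0 d by (auto simp: \<epsilon>_def)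
    obtain \<rho> where m: "mol \<epsilon> \<rho>" using mol_ex[OF \<epsilon>(1)] by blast
    note m' = m[unfolded mol_def]
    have "\<bar>conv \<beta> \<rho> W x - u x\<bar> \<le> \<gamma>" if x: "x \<in> K" for x
    proof (rule conv_approx[OF Wc])
      have xB: "x \<in> ?B" and xp: "dist x p \<le> r0 + 6 * g" "dist x p \<ge> r0 + 2 * g"
        using x K(3) by (auto simp: K_def K0_def dist_commute)
      show "x - z \<in> cbox (- \<beta>) \<beta>" if "z \<in> cbox (- (\<epsilon> *\<^sub>R One)) (\<epsilon> *\<^sub>R One)" for z
        by (rule box[OF xB that \<epsilon>(2)])
      show "\<bar>W (x - z) - u x\<bar> \<le> \<gamma>" if z: "norm z \<le> \<epsilon>" for z
      proof -
        have "x - z \<in> ?B" using tri[of "x - z" x] xp z \<epsilon> \<epsilon>0(2) g by (simp add: dist_commute)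
        moreover have "dist (x - z) x < d" using z \<epsilon> by (simp add: dist_norm)
        ultimately have "dist (W (x - z)) (W x) < \<gamma>" using d(2) xB by blast
        moreover have "W x = u x" using Wu[OF xB] xp g by simp
        ultimately show ?thesis by (simp add: dist_real_def)
      qed
    qed (use m' in auto)
    moreover have "(\<lambda>x. complex_of_real (conv \<beta> \<rho> W x)) \<in> H" using \<epsilon> m by (auto simp: H_def)
    moreover have "norm (complex_of_real a - of_real b) = \<bar>a - b\<bar>" for a b
      by (simp flip: of_real_diff)
    ultimately show ?thesis by (intro bexI) auto
  qed
  obtain \<rho>g where "mol \<epsilon>0 \<rho>g" using mol_ex[OF \<epsilon>0(1)] by blast
  note mg = this[unfolded mol_def]
  \<comment> \<open>A piecewise linear cutoff, descending from 1 to 0 between the distances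
    \<open>r0 + 7/2 * g\<close> and \<open>r0 + 9/2 * g\<close>; a kernel of radius at most
    \<open>g\<close> smooths it.\<close>
  define c where "c = (\<lambda>x. max 0 (min 1 ((r0 + 9/2 * g - dist x p) / g)))"
  have cc: "continuous_on UNIV c" unfolding c_def using g by (intro continuous_intros) auto
  have c01: "0 \<le> c x" for x by (simp add: c_def)
  have c1: "c x = 1" if "dist x p \<le> r0 + 3 * g" for x
  proof -
    have "1 \<le> (r0 + 9/2 * g - dist x p) / g" using that g by (simp add: field_simps)
    then show ?thesis by (simp add: c_def)
  qed
  have c0: "c x = 0" if "dist x p \<ge> r0 + 5 * g" for x
  proof -
    have "(r0 + 9/2 * g - dist x p) / g \<le> 0" using that g by (simp add: field_simps)
    then show ?thesis by (simp add: c_def)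
  qed
  define \<phi> where "\<phi> = conv \<beta> \<rho>g c"
  have \<phi>s: "smooth \<phi>" unfolding \<phi>_def using mg by (intro smooth_conv cc) auto
  have \<phi>sc: "smooth (\<lambda>x. complex_of_real (\<phi> x))"
    by (rule smooth_linear_comp[OF bounded_linear_of_real \<phi>s])
  have \<phi>_nn: "\<phi> x \<ge> 0" for x
    unfolding \<phi>_def conv_def
  proof (rule integral_nonneg)
    show "(\<lambda>y. \<rho>g (x - y) * c y) integrable_on cbox (- \<beta>) \<beta>"
      by (intro integrable_continuous continuous_on_mult
          continuous_on_compose2[OF smooth_continuous_on[of \<rho>g UNIV]] continuous_intros continuous_on_subset[OF cc])
        (use mg in auto)
  qed (use mg c01 in auto)
  have \<phi>1: "\<phi> x = 1" if "dist x p \<le> r0 + 2 * g" for x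
  proof -
    have "\<bar>conv \<beta> \<rho>g c x - 1\<bar> \<le> 0"
    proof (rule conv_approx[OF cc])
      have xB: "x \<in> ?B" using that g by (simp add: dist_commute)
      show "x - z \<in> cbox (- \<beta>) \<beta>" if "z \<in> cbox (- (\<epsilon>0 *\<^sub>R One)) (\<epsilon>0 *\<^sub>R One)" for z
        by (rule box[OF xB that]) simp
      show "\<bar>c (x - z) - 1\<bar> \<le> 0" if "norm z \<le> \<epsilon>0" for z
        using c1[of "x - z"] tri[of "x - z" x] that \<open>dist x p \<le> r0 + 2 * g\<close> \<epsilon>0(2) by simp
    qed (use mg in auto)
    then show ?thesis by (simp add: \<phi>_def)
  qed
  have \<phi>0: "\<phi> x = 0" if "x \<notin> K0" for x
  proof -
    have "\<rho>g (x - y) * c y = 0" for y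
    proof (cases "norm (x - y) \<ge> \<epsilon>0")
      case False
      have "dist x p > r0 + 6 * g" using that by (simp add: K0_def dist_commute)
      then have "dist y p \<ge> r0 + 5 * g" using tri[of x y] False \<epsilon>0(2) by simp
      then show ?thesis using c0 by simp
    qed (use mg in simp)
    then show ?thesis unfolding \<phi>_def conv_def by (simp only: integral_0)
  qed
  define C where "C = (\<lambda>x (ws :: (complex ^ 'n) list). complex_of_real (\<phi> x))"
  have C: "smooth_form 0 C" using \<phi>sc by (simp add: smooth_form_def C_def)
  have C0: "C x ws = 0" if "x \<notin> K0" for x ws using \<phi>0[OF that] by (simp add: C_def)
  have ddfC: "ddf C x ws = 0" if "x \<notin> K" for x ws
  proof (cases "x \<in> ball p (r0 + 2 * g)")
    case True
    then show ?thesis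
      unfolding C_def by (intro ddf_locally_const[of "ball p (r0 + 2 * g)" _ _ 1]) (auto simp: \<phi>1 dist_commute)
  next
    case False
    then have "x \<in> - K0" using that by (simp add: K_def)
    then show ?thesis
      unfolding C_def
      by (intro ddf_locally_const[of "- K0" _ _ 0]) (use K0 compact_imp_closed \<phi>0 in auto)
  qed
  obtain T where T: "bedford_taylor D u CARD('n) T" "\<And>\<phi>. test_form D 0 \<phi> \<Longrightarrow> T \<phi> = 0"
    using ma unfolding monge_ampere_zero_def by blast
  define \<eta> where "\<eta> = (4 * \<delta>) ^ CARD('n) * measure lborel N"
  have "measure lborel N > 0" unfolding N_def by (rule content_cball_pos[OF n0])
  then have \<eta>: "\<eta> > 0" using v(3) by (simp add: \<eta>_def)
  have "test_form D 0 (altform 0 C)"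
    by (rule test_form_altform[OF C K0(1,2)]) (rule C0)
  \<comment> \<open>The chain starts in dimension 0, where the vanishing of the Monge-Ampere current
    applies directly.\<close>
  then have small: "norm (T (altform (2 * (CARD('n) - CARD('n))) C)) < \<eta>"
    using T(2) \<eta> by simp
  have C': "smooth_form (2 * (CARD('n) - CARD('n))) C" using C by simp
  obtain hs where hs: "length hs = CARD('n)" "set hs \<subseteq> H"
    "norm (LINT x|lborel. altform (2 * CARD('n)) (fold dd_step hs C) x oriented_basis) < \<eta>"
    using bedford_taylor_chain[OF T(1) D u K(1,2) H_smooth approx C' K0(1,2) C0 ddfC small] by blast
  have "norm (LINT x|lborel. altform (2 * CARD('n)) (fold dd_step hs (\<lambda>x ws. of_real (\<phi> x))) x oriented_basis) \<ge> \<eta>"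
    unfolding \<eta>_def
  proof (rule integral_dd_chain_lower_bound[OF hs(1) _ _ \<phi>sc \<phi>_nn K0(1) \<phi>0 _ N])
    show "\<phi> x = 1" if "x \<in> N" for x
      using that r0 g by (intro \<phi>1) (simp add: N_def n0_def dist_commute)
  qed (use hs(2) H_smooth H_real H_psh H_strict v(3) in \<open>auto simp: subset_iff\<close>)
  then show False using hs(3) by (simp add: C_def)
qed

theorem theorem2:
  fixes D :: "(complex ^ 'n::finite) set" and u :: "complex ^ 'n \<Rightarrow> real"
  assumes "open D" and "connected D"
    and "plurisubharmonic_on D u" and "continuous_on D u"
    and "\<And>x. x \<in> D \<Longrightarrow> 0 \<le> u x"
    and "monge_ampere_zero D u"
    and "{x \<in> D. u x = 0} \<noteq> {}" and "convex {x \<in> D. u x = 0}"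
  shows "\<forall>p \<in> {x \<in> D. u x = 0}.
           \<exists>C. complex_one_dim_convex C \<and> C \<subseteq> {x \<in> D. u x = 0} \<and> p \<in> rel_interior C"
proof
  let ?Z = "{x \<in> D. u x = 0}"
  fix p assume p: "p \<in> ?Z"
  show "\<exists>C. complex_one_dim_convex C \<and> C \<subseteq> ?Z \<and> p \<in> rel_interior C"
  proof (cases "\<exists>b. b \<in> face_directions ?Z p \<and> \<i> *s b \<in> face_directions ?Z p \<and> b \<noteq> 0")
    case True
    then obtain b e f where b: "b \<noteq> 0" and
      e: "e > 0" "p + e *\<^sub>R b \<in> ?Z" "p - e *\<^sub>R b \<in> ?Z" and
      f: "f > 0" "p + f *\<^sub>R (\<i> *s b) \<in> ?Z" "p - f *\<^sub>R (\<i> *s b) \<in> ?Z"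
      unfolding face_directions_def by blast
    let ?k = "min e f"
    have k: "p + ?k *\<^sub>R w \<in> ?Z" if "p + l *\<^sub>R w \<in> ?Z" "?k \<le> l" for w l
      by (rule convex_toward[OF assms(8) p that(1) _ that(2)]) (use e f in simp)
    show ?thesis
    proof (rule complex_disc_in_convex[OF assms(8) _ b])
      show "?k > 0" using e f by simp
      show "p + ?k *\<^sub>R b \<in> ?Z" "p + ?k *\<^sub>R (\<i> *s b) \<in> ?Z"
        by (rule k[OF e(2)], simp) (rule k[OF f(2)], simp)
      show "p - ?k *\<^sub>R b \<in> ?Z" "p - ?k *\<^sub>R (\<i> *s b) \<in> ?Z"
        using k[of e "- b"] k[of f "- (\<i> *s b)"] e f by simp_all
    qed
  next
    case False
    obtain r where r: "r > 0" "cball p r \<subseteq> D"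
      using assms(1) p open_contains_cball by blast
    have uc: "continuous_on (sphere p r) u"
      using assms(4) r(2) sphere_cball continuous_on_subset by (metis (no_types, lifting) order_trans)
    have "?Z \<inter> sphere p r = {x \<in> sphere p r. u x = 0}"
      using r(2) sphere_cball[of p r] by auto
    moreover have "closed {x \<in> sphere p r. u x = 0}"
      by (rule continuous_closed_preimage_constant[OF uc]) simp
    ultimately have X: "compact (?Z \<inter> sphere p r)"
      by (metis (no_types, lifting) bounded_Int bounded_sphere compact_eq_bounded_closed)
    obtain \<psi> \<delta> where \<psi>: "\<delta> > 0" "continuous_on UNIV \<psi>" "submean_excess UNIV \<delta> \<psi>" "\<psi> p > 0"
      "\<And>x. x \<in> ?Z \<inter> sphere p r \<Longrightarrow> \<psi> x < 0"
    proof (rule psh_peak_function[OF assms(8) p r(1) X])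
      fix b assume "b \<in> face_directions ?Z p" "\<i> *s b \<in> face_directions ?Z p"
      then show "b = 0" using False by blast
    qed (rule that)
    have \<psi>c: "continuous_on S \<psi>" for S using \<psi>(2) continuous_on_subset by blast
    \<comment> \<open>The only points of the sphere at which a positive multiple of
      \<open>\<psi>\<close> could exceed \<open>u\<close>; they avoid the zero set, so
      \<open>u\<close> has a positive minimum there unless there are none.\<close>
    let ?Y = "{x \<in> sphere p r. 0 \<le> \<psi> x}"
    have uD: "u x \<ge> 0" if "x \<in> sphere p r" for x
      using assms(5) r(2) sphere_cball that by blast
    have upos: "u x > 0" if "x \<in> ?Y" for x
    proof -
      have "u x \<noteq> 0" using \<psi>(5)[of x] that r(2) sphere_cball[of p r] by force
      then show ?thesis using uD[of x] that by simp
    qed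
    have "\<exists>\<kappa>>0. \<forall>x\<in>?Y. \<kappa> * \<psi> x < u x"
    proof (cases "?Y = {}")
      case True
      then show ?thesis by (intro exI[of _ 1]) auto
    next
      case False
      have "closed ?Y"
        by (rule closed_Collect_le_on[OF closed_sphere continuous_on_const \<psi>c])
      moreover have "bounded ?Y" by (rule bounded_subset[OF bounded_sphere]) blast
      ultimately have Y: "compact ?Y" by (simp add: compact_eq_bounded_closed)
      have "continuous_on ?Y u" by (rule continuous_on_subset[OF uc]) blast
      from continuous_attains_inf[OF Y False this]
      obtain a where a: "a \<in> ?Y" "\<And>x. x \<in> ?Y \<Longrightarrow> u a \<le> u x" by blast
      obtain b where b: "b \<in> ?Y" "\<And>x. x \<in> ?Y \<Longrightarrow> \<psi> x \<le> \<psi> b"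
        using continuous_attains_sup[OF Y False \<psi>c] by blast
      \<comment> \<open>The summand 1 keeps the denominator positive when the maximum of
        \<open>\<psi>\<close> on \<open>?Y\<close> is 0, and makes the resulting inequality
        strict.\<close>
      define \<kappa> where "\<kappa> = u a / (\<psi> b + 1)"
      have pb: "\<psi> b + 1 > 0" using b(1) by simp
      have \<kappa>: "\<kappa> > 0" using upos[OF a(1)] pb by (simp add: \<kappa>_def)
      have "\<kappa> * \<psi> x < u x" if "x \<in> ?Y" for x
      proof -
        have "\<kappa> * \<psi> x < \<kappa> * (\<psi> b + 1)" using \<kappa> b(2)[OF that] by (intro mult_strict_left_mono) auto
        also have "\<dots> = u a" using pb by (simp add: \<kappa>_def)
        finally show ?thesis using a(2)[OF that] by simp
      qed
      then show ?thesis using \<kappa> by blast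
    qed
    then obtain \<kappa> where \<kappa>: "\<kappa> > 0" "\<And>x. x \<in> ?Y \<Longrightarrow> \<kappa> * \<psi> x < u x" by blast
    have "\<kappa> * \<psi> p \<le> u p"
    proof (rule comparison_quadratic[OF assms(1,3,4,6) r, of "\<lambda>x. \<kappa> * \<psi> x" "\<kappa> * \<delta>"])
      show "continuous_on UNIV (\<lambda>x. \<kappa> * \<psi> x)" by (intro continuous_intros \<psi>)
      show "\<kappa> * \<delta> > 0" using \<kappa> \<psi> by simp
      show "submean_excess UNIV (\<kappa> * \<delta>) (\<lambda>x. \<kappa> * \<psi> x)"
        unfolding submean_excess_def
      proof (intro allI impI)
        fix a b
        have "2 * pi * (\<psi> a + \<delta> * (norm b)\<^sup>2) \<le> integral {0..2 * pi} (\<lambda>t. \<psi> (a + cis t *s b))"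
          using \<psi>(3) unfolding submean_excess_def by blast
        from mult_left_mono[OF this, of \<kappa>] \<kappa>(1)
        show "2 * pi * (\<kappa> * \<psi> a + \<kappa> * \<delta> * (norm b)\<^sup>2) \<le> integral {0..2 * pi} (\<lambda>t. \<kappa> * \<psi> (a + cis t *s b))"
          by (simp add: algebra_simps)
      qed
      show "\<kappa> * \<psi> x < u x" if "x \<in> sphere p r" for x
      proof (cases "\<psi> x \<ge> 0")
        case True
        then show ?thesis using \<kappa>(2) that by simp
      next
        case False
        then have "\<kappa> * \<psi> x < 0" using \<kappa>(1) by (simp add: mult_pos_neg)
        then show ?thesis using uD[OF that] by simp
      qed
    qed
    moreover have "\<kappa> * \<psi> p > 0" using \<kappa>(1) \<psi>(4) by simp
    ultimately show ?thesis using p by simp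
  qed
qed

end
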